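(* Let $A$ be a finite abelian group. Then there exists a flat solvmanifold with holonomy group (isomorphic to) $A$.
   Context: A solvmanifold is a compact quotient $\Gamma\backslash G$, where $G$ is a simply connected solvable Lie group and $\Gamma$ is a lattice (discrete co-compact subgroup) of $G$. A flat solvmanifold is a solvmanifold $\Gamma\backslash G$ equipped with a flat Riemannian metric induced by a flat left invariant metric on $G$; its holonomy group is the Riemannian holonomy group of this metric (up to isomorphism). *)

theory Defs
  imports "HOL-Analysis.Analysis" "HOL-Algebra.Solvable_Groups" "HOL-Algebra.Bij"
begin

section \<open>Smooth functions of several variables\<close>

text \<open>
  Since the dimension has to be quantified over inside a formula, n-dimensional space is the
  library's \<^const>\<open>Euclidean_space\<close>: the functions from the naturals to the reals that vanish from
  index n on, with coordinates 0, ..., n - 1.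
\<close>

definition partial :: "nat \<Rightarrow> ((nat \<Rightarrow> real) \<Rightarrow> real) \<Rightarrow> (nat \<Rightarrow> real) \<Rightarrow> real" where
  "partial i f x = deriv (\<lambda>t. f (x(i := t))) (x i)"

text \<open>For a set U that is open in n-space: the functions of class C^k on U.\<close>

primrec Ck_on :: "nat \<Rightarrow> nat \<Rightarrow> (nat \<Rightarrow> real) set \<Rightarrow> ((nat \<Rightarrow> real) \<Rightarrow> real) \<Rightarrow> bool" where
  "Ck_on 0 n U f \<longleftrightarrow> continuous_map (subtopology (Euclidean_space n) U) euclideanreal f"
| "Ck_on (Suc k) n U f \<longleftrightarrow>
     continuous_map (subtopology (Euclidean_space n) U) euclideanreal f \<and>
     (\<forall>i<n. (\<forall>x\<in>U. (\<lambda>t. f (x(i := t))) differentiable (at (x i))) \<and> Ck_on k n U (partial i f))"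

definition smooth_on :: "nat \<Rightarrow> (nat \<Rightarrow> real) set \<Rightarrow> ((nat \<Rightarrow> real) \<Rightarrow> real) \<Rightarrow> bool" where
  "smooth_on n U f \<longleftrightarrow> (\<forall>k. Ck_on k n U f)"

section \<open>Smooth manifolds\<close>

text \<open>
  A chart is an open set together with its coordinate map. Atlases are not required to be maximal:
  an atlas determines the smooth structure, and no notion below depends on the choice of the
  atlas within its smooth structure.
\<close>

type_synonym 'a chart = "'a set \<times> ('a \<Rightarrow> nat \<Rightarrow> real)"

record 'a manifold =
  mfd_dim :: nat
  mfd_top :: "'a topology"
  mfd_charts :: "'a chart set"

definition chart_inv :: "'a chart \<Rightarrow> (nat \<Rightarrow> real) \<Rightarrow> 'a" where
  "chart_inv c = inv_into (fst c) (snd c)"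

definition charts_at :: "'a manifold \<Rightarrow> 'a \<Rightarrow> 'a chart set" where
  "charts_at M p = {c \<in> mfd_charts M. p \<in> fst c}"

definition second_countable_space :: "'a topology \<Rightarrow> bool" where
  "second_countable_space X \<longleftrightarrow>
     (\<exists>\<B>. countable \<B> \<and> (\<forall>B\<in>\<B>. openin X B) \<and> (\<forall>U. openin X U \<longrightarrow> (\<exists>\<U>\<subseteq>\<B>. \<Union>\<U> = U)))"

definition smooth_manifold :: "'a manifold \<Rightarrow> bool" where
  "smooth_manifold M \<longleftrightarrow>
     Hausdorff_space (mfd_top M) \<and> second_countable_space (mfd_top M) \<and>
     \<Union>(fst ` mfd_charts M) = topspace (mfd_top M) \<and>
     (\<forall>c\<in>mfd_charts M.
        openin (mfd_top M) (fst c) \<and>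
        openin (Euclidean_space (mfd_dim M)) (snd c ` fst c) \<and>
        homeomorphic_map (subtopology (mfd_top M) (fst c))
          (subtopology (Euclidean_space (mfd_dim M)) (snd c ` fst c)) (snd c)) \<and>
     (\<forall>c\<in>mfd_charts M. \<forall>d\<in>mfd_charts M. \<forall>i<mfd_dim M.
        smooth_on (mfd_dim M) (snd c ` (fst c \<inter> fst d)) (\<lambda>x. snd d (chart_inv c x) i))"

definition smooth_map :: "'a manifold \<Rightarrow> 'b manifold \<Rightarrow> ('a \<Rightarrow> 'b) \<Rightarrow> bool" where
  "smooth_map M N F \<longleftrightarrow>
     continuous_map (mfd_top M) (mfd_top N) F \<and>
     (\<forall>c\<in>mfd_charts M. \<forall>d\<in>mfd_charts N. \<forall>i<mfd_dim N.
        smooth_on (mfd_dim M) (snd c ` (fst c \<inter> F -` fst d)) (\<lambda>x. snd d (F (chart_inv c x)) i))"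

definition prod_manifold :: "'a manifold \<Rightarrow> 'b manifold \<Rightarrow> ('a \<times> 'b) manifold" where
  "prod_manifold M N =
     \<lparr>mfd_dim = mfd_dim M + mfd_dim N,
      mfd_top = prod_topology (mfd_top M) (mfd_top N),
      mfd_charts =
        {(fst c \<times> fst d,
          \<lambda>(a, b) i. if i < mfd_dim M then snd c a i else snd d b (i - mfd_dim M)) |
         c d. c \<in> mfd_charts M \<and> d \<in> mfd_charts N}\<rparr>"

text \<open>The partial derivative at p of f with respect to the i-th coordinate of the chart c.\<close>

definition cpartial :: "'a chart \<Rightarrow> nat \<Rightarrow> ('a \<Rightarrow> real) \<Rightarrow> 'a \<Rightarrow> real" where
  "cpartial c i f p = partial i (\<lambda>x. f (chart_inv c x)) (snd c p)"

text \<open>Entry (k, i) of the matrix of the differential of F at p in the charts c and d.\<close>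

definition jac :: "'a chart \<Rightarrow> 'b chart \<Rightarrow> ('a \<Rightarrow> 'b) \<Rightarrow> 'a \<Rightarrow> nat \<Rightarrow> nat \<Rightarrow> real" where
  "jac c d F p k i = cpartial c i (\<lambda>q. snd d (F q) k) p"

text \<open>
  A tangent vector at p assigns to every chart around p a coordinate vector, in such a way that
  these are related by the Jacobian matrices of the coordinate changes.
\<close>

type_synonym 'a tangent = "'a chart \<Rightarrow> nat \<Rightarrow> real"

definition tangent_space :: "'a manifold \<Rightarrow> 'a \<Rightarrow> 'a tangent set" where
  "tangent_space M p =
     {v \<in> charts_at M p \<rightarrow>\<^sub>E topspace (Euclidean_space (mfd_dim M)).
        \<forall>c\<in>charts_at M p. \<forall>d\<in>charts_at M p. \<forall>i<mfd_dim M.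
          v d i = (\<Sum>j<mfd_dim M. jac c d (\<lambda>q. q) p i j * v c j)}"

section \<open>Riemannian metrics and curvature\<close>

text \<open>
  A metric is given by its component matrices: g c p i j is the inner product, at the point p,
  of the i-th and the j-th coordinate vector field of the chart c.
\<close>

type_synonym 'a metric_tensor = "'a chart \<Rightarrow> 'a \<Rightarrow> nat \<Rightarrow> nat \<Rightarrow> real"

text \<open>The pullback of h along F is g.\<close>

definition preserves_metric ::
  "'a manifold \<Rightarrow> 'a metric_tensor \<Rightarrow> 'b manifold \<Rightarrow> 'b metric_tensor \<Rightarrow> ('a \<Rightarrow> 'b) \<Rightarrow> bool" where
  "preserves_metric M g N h F \<longleftrightarrow>
     (\<forall>p\<in>topspace (mfd_top M). \<forall>c\<in>charts_at M p. \<forall>d\<in>charts_at N (F p).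
        \<forall>i<mfd_dim M. \<forall>j<mfd_dim M.
          g c p i j = (\<Sum>k<mfd_dim N. \<Sum>l<mfd_dim N.
                         h d (F p) k l * jac c d F p k i * jac c d F p l j))"

text \<open>The last condition is the transformation law of a covariant 2-tensor.\<close>

definition riemannian_metric :: "'a manifold \<Rightarrow> 'a metric_tensor \<Rightarrow> bool" where
  "riemannian_metric M g \<longleftrightarrow>
     (\<forall>c\<in>mfd_charts M. \<forall>i<mfd_dim M. \<forall>j<mfd_dim M.
        smooth_on (mfd_dim M) (snd c ` fst c) (\<lambda>x. g c (chart_inv c x) i j)) \<and>
     (\<forall>c\<in>mfd_charts M. \<forall>p\<in>fst c. \<forall>i<mfd_dim M. \<forall>j<mfd_dim M. g c p i j = g c p j i) \<and>
     (\<forall>c\<in>mfd_charts M. \<forall>p\<in>fst c. \<forall>v. (\<exists>i<mfd_dim M. v i \<noteq> 0) \<longrightarrow>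
        0 < (\<Sum>i<mfd_dim M. \<Sum>j<mfd_dim M. g c p i j * v i * v j)) \<and>
     preserves_metric M g M g (\<lambda>p. p)"

definition matrix_inverse :: "nat \<Rightarrow> (nat \<Rightarrow> nat \<Rightarrow> real) \<Rightarrow> nat \<Rightarrow> nat \<Rightarrow> real" where
  "matrix_inverse n a =
     (SOME b. \<forall>i<n. \<forall>k<n. (\<Sum>j<n. a i j * b j k) = (if i = k then 1 else 0))"

text \<open>The coefficients of the Levi-Civita connection; k is the upper index.\<close>

definition christoffel ::
  "'a manifold \<Rightarrow> 'a metric_tensor \<Rightarrow> 'a chart \<Rightarrow> 'a \<Rightarrow> nat \<Rightarrow> nat \<Rightarrow> nat \<Rightarrow> real" where
  "christoffel M g c p k i j =
     (\<Sum>l<mfd_dim M. matrix_inverse (mfd_dim M) (g c p) k l *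
        (cpartial c i (\<lambda>q. g c q j l) p + cpartial c j (\<lambda>q. g c q i l) p
          - cpartial c l (\<lambda>q. g c q i j) p)) / 2"

text \<open>The l-th component of R(e i, e j) (e k), where e is the coordinate frame of the chart c.\<close>

definition curvature ::
  "'a manifold \<Rightarrow> 'a metric_tensor \<Rightarrow> 'a chart \<Rightarrow> 'a \<Rightarrow> nat \<Rightarrow> nat \<Rightarrow> nat \<Rightarrow> nat \<Rightarrow> real" where
  "curvature M g c p l k i j =
     cpartial c i (\<lambda>q. christoffel M g c q l j k) p
     - cpartial c j (\<lambda>q. christoffel M g c q l i k) p
     + (\<Sum>m<mfd_dim M. christoffel M g c p l i m * christoffel M g c p m j k
                      - christoffel M g c p l j m * christoffel M g c p m i k)"

definition flat_metric :: "'a manifold \<Rightarrow> 'a metric_tensor \<Rightarrow> bool" where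
  "flat_metric M g \<longleftrightarrow>
     (\<forall>c\<in>mfd_charts M. \<forall>p\<in>fst c.
        \<forall>l<mfd_dim M. \<forall>k<mfd_dim M. \<forall>i<mfd_dim M. \<forall>j<mfd_dim M. curvature M g c p l k i j = 0)"

section \<open>Parallel transport and holonomy\<close>

definition smooth_curve_on :: "'a manifold \<Rightarrow> real set \<Rightarrow> (real \<Rightarrow> 'a) \<Rightarrow> bool" where
  "smooth_curve_on M J \<gamma> \<longleftrightarrow>
     continuous_map (top_of_set J) (mfd_top M) \<gamma> \<and>
     (\<forall>t\<in>J. \<forall>c\<in>charts_at M (\<gamma> t). \<forall>i<mfd_dim M. \<forall>k.
        ((deriv ^^ k) (\<lambda>s. snd c (\<gamma> s) i)) differentiable (at t))"

text \<open>On a compact interval, smooth means having a smooth extension to a larger open interval.\<close>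

definition piecewise_smooth_path :: "'a manifold \<Rightarrow> (real \<Rightarrow> 'a) \<Rightarrow> bool" where
  "piecewise_smooth_path M \<gamma> \<longleftrightarrow>
     pathin (mfd_top M) \<gamma> \<and>
     (\<exists>T. finite T \<and> {0, 1} \<subseteq> T \<and> T \<subseteq> {0..1} \<and>
        (\<forall>a\<in>T. \<forall>b\<in>T. a < b \<and> {a<..<b} \<inter> T = {} \<longrightarrow>
           (\<exists>e>0. \<exists>\<delta>. smooth_curve_on M {a - e<..<b + e} \<delta> \<and> (\<forall>t\<in>{a..b}. \<delta> t = \<gamma> t))))"

text \<open>
  A continuous vector field V along a piecewise smooth curve is parallel if its covariant
  derivative vanishes; the finite exceptional set contains the points where the curve is not smooth
  and the end points of the interval.
\<close>

definition parallel_along ::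
  "'a manifold \<Rightarrow> 'a metric_tensor \<Rightarrow> (real \<Rightarrow> 'a) \<Rightarrow> (real \<Rightarrow> 'a tangent) \<Rightarrow> bool" where
  "parallel_along M g \<gamma> V \<longleftrightarrow>
     (\<forall>t\<in>{0..1}. V t \<in> tangent_space M (\<gamma> t)) \<and>
     (\<forall>t\<in>{0..1}. \<forall>c\<in>charts_at M (\<gamma> t). \<forall>k<mfd_dim M.
        ((\<lambda>s. V s c k) \<longlongrightarrow> V t c k) (at t within {0..1})) \<and>
     (\<exists>S. finite S \<and>
        (\<forall>t\<in>{0..1} - S. \<forall>c\<in>charts_at M (\<gamma> t). \<forall>k<mfd_dim M.
           ((\<lambda>s. V s c k) has_real_derivative
              - (\<Sum>i<mfd_dim M. \<Sum>j<mfd_dim M. christoffel M g c (\<gamma> t) k i j *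
                   deriv (\<lambda>s. snd c (\<gamma> s) i) t * V t c j)) (at t)))"

definition parallel_transport ::
  "'a manifold \<Rightarrow> 'a metric_tensor \<Rightarrow> (real \<Rightarrow> 'a) \<Rightarrow> 'a tangent \<Rightarrow> 'a tangent" where
  "parallel_transport M g \<gamma> =
     (\<lambda>v\<in>tangent_space M (\<gamma> 0). THE w. \<exists>V. parallel_along M g \<gamma> V \<and> V 0 = v \<and> V 1 = w)"

definition holonomy_group ::
  "'a manifold \<Rightarrow> 'a metric_tensor \<Rightarrow> 'a \<Rightarrow> ('a tangent \<Rightarrow> 'a tangent) monoid" where
  "holonomy_group M g p =
     (BijGroup (tangent_space M p))
       \<lparr>carrier := {parallel_transport M g \<gamma> | \<gamma>.
                     piecewise_smooth_path M \<gamma> \<and> \<gamma> 0 = p \<and> \<gamma> 1 = p}\<rparr>"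

section \<open>Lie groups, lattices and flat solvmanifolds\<close>

definition lie_group :: "'g monoid \<Rightarrow> 'g manifold \<Rightarrow> bool" where
  "lie_group G M \<longleftrightarrow>
     group G \<and> smooth_manifold M \<and> carrier G = topspace (mfd_top M) \<and>
     smooth_map (prod_manifold M M) M (\<lambda>(a, b). a \<otimes>\<^bsub>G\<^esub> b) \<and>
     smooth_map M M (\<lambda>a. inv\<^bsub>G\<^esub> a)"

text \<open>The counterpart of \<^const>\<open>simply_connected\<close> for abstract topologies.\<close>

definition simply_connected_space :: "'a topology \<Rightarrow> bool" where
  "simply_connected_space X \<longleftrightarrow>
     (\<forall>p q. pathin X p \<and> p 1 = p 0 \<and> pathin X q \<and> q 1 = q 0 \<longrightarrow>
        homotopic_with (\<lambda>r. r 1 = r 0) (top_of_set {0..1}) X p q)"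

text \<open>The quotient topology on the set of right cosets H x.\<close>

definition coset_topology :: "'g monoid \<Rightarrow> 'g topology \<Rightarrow> 'g set \<Rightarrow> 'g set topology" where
  "coset_topology G X H =
     topology (\<lambda>S. S \<subseteq> rcosets\<^bsub>G\<^esub> H \<and> openin X {x \<in> topspace X. H #>\<^bsub>G\<^esub> x \<in> S})"

lemma openin_coset_topology:
  "openin (coset_topology G X H) S \<longleftrightarrow>
     S \<subseteq> rcosets\<^bsub>G\<^esub> H \<and> openin X {x \<in> topspace X. H #>\<^bsub>G\<^esub> x \<in> S}"
proof -
  let ?P = "\<lambda>S. S \<subseteq> rcosets\<^bsub>G\<^esub> H \<and> openin X {x \<in> topspace X. H #>\<^bsub>G\<^esub> x \<in> S}"
  have "istopology ?P"
    unfolding istopology_def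
  proof (rule conjI; intro allI impI)
    fix S T assume S: "?P S" and T: "?P T"
    have "{x \<in> topspace X. H #>\<^bsub>G\<^esub> x \<in> S \<inter> T} =
      {x \<in> topspace X. H #>\<^bsub>G\<^esub> x \<in> S} \<inter> {x \<in> topspace X. H #>\<^bsub>G\<^esub> x \<in> T}" by blast
    with S T show "?P (S \<inter> T)" by auto
  next
    fix K assume K: "\<forall>S\<in>K. ?P S"
    have "{x \<in> topspace X. H #>\<^bsub>G\<^esub> x \<in> \<Union>K} = (\<Union>S\<in>K. {x \<in> topspace X. H #>\<^bsub>G\<^esub> x \<in> S})" by blast
    with K show "?P (\<Union>K)" by auto
  qed
  then show ?thesis by (simp add: coset_topology_def)
qed

lemma quotient_map_coset_topology:
  assumes "carrier G = topspace X"
  shows "quotient_map X (coset_topology G X H) (\<lambda>x. H #>\<^bsub>G\<^esub> x)"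
proof -
  have "{x \<in> topspace X. H #>\<^bsub>G\<^esub> x \<in> rcosets\<^bsub>G\<^esub> H} = topspace X"
    using assms by (auto simp: RCOSETS_def)
  then have "openin (coset_topology G X H) (rcosets\<^bsub>G\<^esub> H)"
    by (simp add: openin_coset_topology)
  then have "topspace (coset_topology G X H) = rcosets\<^bsub>G\<^esub> H"
    by (meson openin_coset_topology openin_subset openin_topspace subset_antisym)
  then show ?thesis
    using assms by (auto simp: quotient_map_def openin_coset_topology RCOSETS_def)
qed

definition lattice_in :: "'g monoid \<Rightarrow> 'g topology \<Rightarrow> 'g set \<Rightarrow> bool" where
  "lattice_in G X H \<longleftrightarrow>
     subgroup H G \<and> subtopology X H = discrete_topology H \<and> compact_space (coset_topology G X H)"

definition left_invariant_metric :: "'g monoid \<Rightarrow> 'g manifold \<Rightarrow> 'g metric_tensor \<Rightarrow> bool" where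
  "left_invariant_metric G M g \<longleftrightarrow>
     riemannian_metric M g \<and> (\<forall>a\<in>carrier G. preserves_metric M g M g (\<lambda>x. a \<otimes>\<^bsub>G\<^esub> x))"

text \<open>
  N, with the metric h, is the quotient of the Lie group G (with underlying manifold M) by the
  lattice H. The smooth structure of N and h are the induced ones: they are uniquely determined
  by the requirement that the projection is smooth and preserves the metrics, since it is then a
  local diffeomorphism.
\<close>

definition flat_solvmanifold ::
  "'g monoid \<Rightarrow> 'g manifold \<Rightarrow> 'g metric_tensor \<Rightarrow> 'g set \<Rightarrow>
   'g set manifold \<Rightarrow> 'g set metric_tensor \<Rightarrow> bool" where
  "flat_solvmanifold G M g H N h \<longleftrightarrow>
     lie_group G M \<and> simply_connected_space (mfd_top M) \<and> solvable G \<and>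
     left_invariant_metric G M g \<and> flat_metric M g \<and>
     lattice_in G (mfd_top M) H \<and>
     smooth_manifold N \<and> mfd_dim N = mfd_dim M \<and>
     mfd_top N = coset_topology G (mfd_top M) H \<and>
     riemannian_metric N h \<and>
     smooth_map M N (\<lambda>x. H #>\<^bsub>G\<^esub> x) \<and>
     preserves_metric M g N h (\<lambda>x. H #>\<^bsub>G\<^esub> x)"

end

theory Submission
  imports Defs "HOL-Algebra.Multiplicative_Group" "HOL-Combinatorics.Permutations"
begin

text \<open>
  Let n be the order of A. On the group algebra \<open>\<complex>[A]\<close>, translation by an element a is a unitary
  operator T with \<open>T\<^sup>n = 1\<close>, so it lies on the one-parameter group of unitary operators
  \<open>T\<^sup>t = \<Sum>j<n. c\<^sub>j(t) T\<^sup>j\<close>, where \<open>c\<^sub>j\<close> is a finite Fourier sum. For different a these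
  one-parameter groups commute, and with one real parameter for every a in A they define an action of
  \<open>\<real>\<^sup>n\<close> on \<open>\<complex>[A]\<close> by isometries such that \<open>\<int>\<^sup>n\<close> acts through all translations. No
  decomposition of A into cyclic groups is needed.

  In the semidirect product of \<open>\<real>\<^sup>n\<close> and \<open>\<complex>[A]\<close> the left translations are Euclidean isometries, so the
  Euclidean metric is left invariant and flat. The integer points form a lattice that acts by integer
  translations combined with permutations of the coordinates, the permutations being given by A. Open
  cubes with side 1 therefore embed in the quotient; in these charts the metric is constant, and a
  parallel field along a loop is a constant vector along a lift of the loop. Hence parallel transport
  along loops is the action of A by permutations of the coordinates.
\<close>

section \<open>Elementary functions on Euclidean space\<close>

text \<open>Complex coefficients are forced: on the real group algebra a translation may have
  determinant -1 (already for the group of order 2), and then it lies on no one-parameter group of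
  orthogonal maps. The factor R^n does more than supply the times of the flows. It also makes the
  lattice act freely: a lattice point whose times vanish permutes nothing and is a pure translation,
  and a nonzero integer entry moves points by at least 1. This is the origin of the side 1 of the
  cubes. Two choices keep the analysis elementary. The group operations have coordinates in a class
  of functions closed under partial derivatives, so smoothness needs no chain rule in several
  variables. And each transition map of the quotient is locally a permutation of the coordinates
  plus a constant, so all Jacobians are permutation matrices and tangent vectors can be handled by
  explicit formulas. Commutativity of A enters twice: the flows have to commute, and precomposition
  with permutations reverses products.\<close>

definition vecs :: "nat \<Rightarrow> (nat \<Rightarrow> real) set" where
  "vecs n = {x. \<forall>i\<ge>n. x i = 0}"

lemma topspace_Euclidean_space_vecs [simp]: "topspace (Euclidean_space n) = vecs n"
  by (simp add: topspace_Euclidean_space vecs_def)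

text \<open>Presents n-space as a subspace of a function type, so that the type-class facts about
  \<open>open\<close> and \<open>continuous_on\<close> apply to it.\<close>

lemma Euclidean_space_eq: "Euclidean_space n = top_of_set (vecs n)"
  by (simp add: Euclidean_space_def euclidean_product_topology vecs_def)

lemma subtopology_Euclidean_space: "subtopology (Euclidean_space n) U = top_of_set (vecs n \<inter> U)"
  by (simp add: Euclidean_space_eq subtopology_subtopology)

lemma vecs_upd: "x \<in> vecs n \<Longrightarrow> i < n \<Longrightarrow> x(i := t) \<in> vecs n"
  by (auto simp: vecs_def)

lemma vecs_eqI: "x \<in> vecs n \<Longrightarrow> y \<in> vecs n \<Longrightarrow> (\<And>i. i < n \<Longrightarrow> x i = y i) \<Longrightarrow> x = y"
  by (rule ext) (metis (mono_tags, lifting) mem_Collect_eq not_less vecs_def)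

lemma continuous_on_fun_upd: "continuous_on S (\<lambda>t::real. x(i := t) :: nat \<Rightarrow> real)"
proof (rule continuous_on_coordinatewise_then_product)
  fix j show "continuous_on S (\<lambda>t. (x(i := t)) j)"
    by (cases "j = i") (auto intro!: continuous_intros)
qed

text \<open>Moving one coordinate with \<open>i < n\<close> is a continuous curve inside
  \<open>vecs n\<close>. Hence a partial derivative at a point of \<open>W\<close> depends only on
  the values on \<open>W\<close>.\<close>

lemma eventually_fun_upd_mem:
  assumes "openin (Euclidean_space n) W" "x \<in> W" "i < n"
  shows "\<forall>\<^sub>F t in nhds (x i). x(i := t) \<in> W"
proof -
  obtain O' where O: "open O'" "W = vecs n \<inter> O'"
    using assms by (auto simp: Euclidean_space_eq openin_open)
  have "open ((\<lambda>t. x(i := t)) -` O')"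
    using O continuous_on_fun_upd[of UNIV] by (simp add: open_vimage)
  moreover have "x i \<in> (\<lambda>t. x(i := t)) -` O'"
    using O assms by auto
  ultimately have "\<forall>\<^sub>F t in nhds (x i). t \<in> (\<lambda>t. x(i := t)) -` O'"
    by (rule eventually_nhds_in_open)
  then show ?thesis
    by (rule eventually_mono) (use O assms vecs_upd in auto)
qed

text \<open>Sine and cosine are there for the finite Fourier sums of the flows, products for
  applying these sums to coordinates.\<close>

inductive_set elementary :: "((nat \<Rightarrow> real) \<Rightarrow> real) set" where
  elementary_const: "(\<lambda>x. c) \<in> elementary"
| elementary_coord: "(\<lambda>x. x i) \<in> elementary"
| elementary_add: "f \<in> elementary \<Longrightarrow> g \<in> elementary \<Longrightarrow> (\<lambda>x. f x + g x) \<in> elementary"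
| elementary_mult: "f \<in> elementary \<Longrightarrow> g \<in> elementary \<Longrightarrow> (\<lambda>x. f x * g x) \<in> elementary"
| elementary_sin: "f \<in> elementary \<Longrightarrow> (\<lambda>x. sin (f x)) \<in> elementary"
| elementary_cos: "f \<in> elementary \<Longrightarrow> (\<lambda>x. cos (f x)) \<in> elementary"

lemma elementary_minus: "f \<in> elementary \<Longrightarrow> (\<lambda>x. - f x) \<in> elementary"
  using elementary_mult[OF elementary_const[of "-1"], of f] by simp

lemma elementary_diff: "f \<in> elementary \<Longrightarrow> g \<in> elementary \<Longrightarrow> (\<lambda>x. f x - g x) \<in> elementary"
  using elementary_add[OF _ elementary_minus, of f g] by simp

lemma elementary_sum: "(\<And>j. j \<in> J \<Longrightarrow> f j \<in> elementary) \<Longrightarrow> (\<lambda>x. \<Sum>j\<in>J. f j x) \<in> elementary"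
  by (induction J rule: infinite_finite_induct)
    (auto intro: elementary_const elementary_add)

text \<open>Only one coordinate varies, so the one-variable rules for sums, products and
  compositions suffice. Existence of the derivative is part of the claim because
  \<open>Ck_on\<close> asks for differentiability and not just for a value of
  \<open>deriv\<close>.\<close>

lemma elementary_partial:
  assumes "f \<in> elementary"
  shows "\<exists>g\<in>elementary. \<forall>x. ((\<lambda>t. f (x(i := t))) has_real_derivative g x) (at (x i))"
  using assms
proof induction
  case (elementary_const c)
  then show ?case by (intro bexI[of _ "\<lambda>x. 0"]) (auto intro: elementary.intros)
next
  case (elementary_coord j)
  show ?case
    by (cases "j = i")
      (auto intro!: bexI[of _ "\<lambda>x. if j = i then 1 else 0"] elementary.intros derivative_eq_intros)
next
  case (elementary_add f1 f2)
  then obtain g1 g2 where g: "g1 \<in> elementary" "g2 \<in> elementary"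
    and d: "\<And>x. ((\<lambda>t. f1 (x(i := t))) has_real_derivative g1 x) (at (x i))"
      "\<And>x. ((\<lambda>t. f2 (x(i := t))) has_real_derivative g2 x) (at (x i))"
    by blast
  show ?case
    using g d by (intro bexI[of _ "\<lambda>x. g1 x + g2 x"] allI DERIV_add elementary.intros)
next
  case (elementary_mult f1 f2)
  then obtain g1 g2 where g: "g1 \<in> elementary" "g2 \<in> elementary"
    and d: "\<And>x. ((\<lambda>t. f1 (x(i := t))) has_real_derivative g1 x) (at (x i))"
      "\<And>x. ((\<lambda>t. f2 (x(i := t))) has_real_derivative g2 x) (at (x i))"
    by blast
  have "((\<lambda>t. f1 (x(i := t)) * f2 (x(i := t))) has_real_derivative g1 x * f2 x + g2 x * f1 x) (at (x i))" for x
    using DERIV_mult[OF d[of x]] by simp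
  then show ?case
    using g elementary_mult.hyps
    by (intro bexI[of _ "\<lambda>x. g1 x * f2 x + g2 x * f1 x"] allI elementary.intros)
next
  case (elementary_sin f)
  then obtain g where g: "g \<in> elementary"
    and d: "\<And>x. ((\<lambda>t. f (x(i := t))) has_real_derivative g x) (at (x i))"
    by blast
  have "((\<lambda>t. sin (f (x(i := t)))) has_real_derivative cos (f x) * g x) (at (x i))" for x
    using DERIV_chain2[OF DERIV_sin d[of x]] by simp
  then show ?case
    using g elementary_sin.hyps
    by (intro bexI[of _ "\<lambda>x. cos (f x) * g x"] allI elementary.intros)
next
  case (elementary_cos f)
  then obtain g where g: "g \<in> elementary"
    and d: "\<And>x. ((\<lambda>t. f (x(i := t))) has_real_derivative g x) (at (x i))"
    by blast
  have "((\<lambda>t. cos (f (x(i := t)))) has_real_derivative - sin (f x) * g x) (at (x i))" for x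
    using DERIV_chain2[OF DERIV_cos d[of x]] by simp
  then show ?case
    using g elementary_cos.hyps
    by (intro bexI[of _ "\<lambda>x. - sin (f x) * g x"] allI elementary.intros elementary_minus)
qed

lemma continuous_on_elementary: "f \<in> elementary \<Longrightarrow> continuous_on S f"
  by (induction rule: elementary.induct)
    (auto intro!: continuous_intros continuous_on_subset[OF continuous_on_product_coordinates])

text \<open>On the overlap of two charts of the quotient the transition map is given by a lattice
  element that may change from one piece of the overlap to another. A single elementary formula for
  the whole overlap need not exist.\<close>

definition locally_elementary :: "nat \<Rightarrow> (nat \<Rightarrow> real) set \<Rightarrow> ((nat \<Rightarrow> real) \<Rightarrow> real) \<Rightarrow> bool" where
  "locally_elementary n U f \<longleftrightarrow>
     (\<forall>x\<in>U. \<exists>W g. openin (Euclidean_space n) W \<and> x \<in> W \<and> W \<subseteq> U \<and> g \<in> elementary \<and> (\<forall>z\<in>W. f z = g z))"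

lemma deriv_cong_openin:
  assumes "openin (Euclidean_space n) W" "x \<in> W" "i < n" "\<And>z. z \<in> W \<Longrightarrow> f z = g z"
    and "((\<lambda>t. g (x(i := t))) has_real_derivative D) (at (x i))"
  shows "((\<lambda>t. f (x(i := t))) has_real_derivative D) (at (x i))"
proof -
  have "\<forall>\<^sub>F t in nhds (x i). f (x(i := t)) = g (x(i := t))"
    using eventually_fun_upd_mem[OF assms(1-3)] by (rule eventually_mono) (use assms in auto)
  then show ?thesis
    using DERIV_cong_ev[OF refl _ refl, where x = "x i"] assms(5) by simp
qed

lemma locally_elementary_partial:
  assumes "locally_elementary n U f" "i < n"
  shows "locally_elementary n U (partial i f)"
    and "x \<in> U \<Longrightarrow> (\<lambda>t. f (x(i := t))) differentiable (at (x i))"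
proof -
  have *: "\<exists>W h. openin (Euclidean_space n) W \<and> x \<in> W \<and> W \<subseteq> U \<and> h \<in> elementary \<and>
      (\<forall>z\<in>W. ((\<lambda>t. f (z(i := t))) has_real_derivative h z) (at (z i)))" if xU: "x \<in> U" for x
  proof -
    obtain W g where W: "openin (Euclidean_space n) W" "x \<in> W" "W \<subseteq> U" "g \<in> elementary" "\<forall>z\<in>W. f z = g z"
      using assms(1)[unfolded locally_elementary_def, THEN bspec, OF xU] by (elim exE conjE)
    obtain h where h: "h \<in> elementary" "\<forall>x. ((\<lambda>t. g (x(i := t))) has_real_derivative h x) (at (x i))"
      using elementary_partial[OF W(4), of i] by blast
    have "\<forall>z\<in>W. ((\<lambda>t. f (z(i := t))) has_real_derivative h z) (at (z i))"
      using deriv_cong_openin[OF W(1) _ assms(2)] W(5) h(2) by metis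
    with W h show ?thesis by blast
  qed
  show "locally_elementary n U (partial i f)"
    unfolding locally_elementary_def
  proof
    fix x assume "x \<in> U"
    from *[OF this] obtain W h where W: "openin (Euclidean_space n) W" "x \<in> W" "W \<subseteq> U" "h \<in> elementary"
      and h: "\<forall>z\<in>W. ((\<lambda>t. f (z(i := t))) has_real_derivative h z) (at (z i))"
      by (elim exE conjE)
    have "\<forall>z\<in>W. partial i f z = h z"
      using h by (auto simp: partial_def intro: DERIV_imp_deriv)
    with W show "\<exists>W g. openin (Euclidean_space n) W \<and> x \<in> W \<and> W \<subseteq> U \<and> g \<in> elementary \<and>
        (\<forall>z\<in>W. partial i f z = g z)"
      by blast
  qed
  show "(\<lambda>t. f (x(i := t))) differentiable (at (x i))" if "x \<in> U"
    using *[OF that] real_differentiable_def by blast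
qed

lemma locally_elementary_continuous:
  assumes "locally_elementary n U f"
  shows "continuous_map (subtopology (Euclidean_space n) U) euclideanreal f"
proof -
  have "continuous (at x within vecs n \<inter> U) f" if xU: "x \<in> vecs n \<inter> U" for x
  proof -
    have "x \<in> U" using xU by blast
    from assms[unfolded locally_elementary_def, THEN bspec, OF this]
    obtain W g where W: "openin (Euclidean_space n) W" "x \<in> W" "W \<subseteq> U" "g \<in> elementary" "\<forall>z\<in>W. f z = g z"
      by (elim exE conjE)
    have "W \<subseteq> vecs n" using openin_subset[OF W(1)] by simp
    then have o: "openin (top_of_set (vecs n \<inter> U)) W"
      using W(1,3) openin_subset_trans[where S = W and T = "vecs n \<inter> U" and U = "vecs n"]
      by (simp add: Euclidean_space_eq)
    have "continuous (at x within vecs n \<inter> U) g"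
      using continuous_on_elementary[OF W(4)] xU by (simp add: continuous_on_eq_continuous_within)
    then show ?thesis
      by (rule continuous_transform_within_openin[OF _ o W(2)]) (use W(5) in auto)
  qed
  then show ?thesis
    by (simp add: subtopology_Euclidean_space continuous_on_eq_continuous_within)
qed

lemma Ck_on_locally_elementary: "locally_elementary n U f \<Longrightarrow> Ck_on k n U f"
  by (induction k arbitrary: f)
    (auto intro: locally_elementary_continuous locally_elementary_partial)

lemma smooth_on_locally_elementary: "locally_elementary n U f \<Longrightarrow> smooth_on n U f"
  by (simp add: smooth_on_def Ck_on_locally_elementary)

lemma smooth_on_elementary:
  assumes "openin (Euclidean_space n) U" "g \<in> elementary" "\<And>x. x \<in> U \<Longrightarrow> f x = g x"
  shows "smooth_on n U f"
  by (rule smooth_on_locally_elementary) (use assms in \<open>auto simp: locally_elementary_def\<close>)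

section \<open>Cubes, and the topological properties of n-space\<close>

definition cube :: "nat \<Rightarrow> (nat \<Rightarrow> real) \<Rightarrow> real \<Rightarrow> (nat \<Rightarrow> real) set" where
  "cube n x r = {y \<in> vecs n. \<forall>i<n. \<bar>y i - x i\<bar> < r}"

lemma openin_cube [simp]: "openin (Euclidean_space n) (cube n x r)"
proof -
  \<comment> \<open>For n = 0 the intersection over the empty family would be everything instead of
    \<open>vecs 0\<close>.\<close>
  have *: "cube n x r = (if n = 0 then vecs n else \<Inter>i<n. {y \<in> vecs n. \<bar>y i - x i\<bar> \<in> {..<r}})"
    by (auto simp: cube_def)
  have "openin (top_of_set (vecs n)) {y \<in> vecs n. \<bar>y i - x i\<bar> \<in> {..<r}}" for i
  proof -
    have "continuous_on (vecs n) (\<lambda>y. \<bar>y i - x i\<bar>)"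
      by (intro continuous_intros continuous_on_subset[OF continuous_on_product_coordinates]) simp
    from continuous_openin_preimage_gen[OF this, of "{..<r}"] show ?thesis
      by (simp add: vimage_def Int_def)
  qed
  then show ?thesis
    unfolding * Euclidean_space_eq by (auto intro!: openin_INT2)
qed

lemma cube_subset_vecs: "cube n x r \<subseteq> vecs n"
  by (auto simp: cube_def)

lemma centre_in_cube [simp]: "x \<in> vecs n \<Longrightarrow> 0 < r \<Longrightarrow> x \<in> cube n x r"
  by (simp add: cube_def)

lemma cube_basis:
  assumes "openin (Euclidean_space n) W" "x \<in> W"
  obtains r where "r > 0" "cube n x r \<subseteq> W"
proof -
  obtain O' where O: "open O'" "W = vecs n \<inter> O'"
    using assms by (auto simp: Euclidean_space_eq openin_open)
  then have "openin (product_topology (\<lambda>i. euclidean) UNIV) O'" "x \<in> O'"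
    using assms by (auto simp: euclidean_product_topology)
  then obtain X where X: "x \<in> PiE UNIV X" "\<And>i. openin euclideanreal (X i)" "PiE UNIV X \<subseteq> O'"
    using product_topology_open_contains_basis[of "\<lambda>i. euclidean" UNIV O' x] by blast
  have "\<exists>e>0. \<forall>z. \<bar>z - x i\<bar> < e \<longrightarrow> z \<in> X i" for i
    using X(1,2) by (metis PiE_mem UNIV_I open_openin open_real)
  then obtain e where e: "\<And>i. e i > 0" "\<And>i z. \<bar>z - x i\<bar> < e i \<Longrightarrow> z \<in> X i"
    by metis
  \<comment> \<open>\<open>insert 1\<close> covers n = 0, where no coordinate bounds the radius.
    Coordinates from n on give no condition, since they vanish on \<open>vecs n\<close>.\<close>
  define r where "r = Min (insert 1 (e ` {..<n}))"
  have r: "r > 0" "\<And>i. i < n \<Longrightarrow> r \<le> e i"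
    using e(1) by (auto simp: r_def)
  have "y \<in> W" if "y \<in> cube n x r" for y
  proof -
    have "y i \<in> X i" for i
    proof (cases "i < n")
      case True
      then show ?thesis using that r(2)[OF True] e(2) by (force simp: cube_def)
    next
      case False
      then have "y i = x i"
        using that assms O by (auto simp: cube_def vecs_def)
      then show ?thesis using X(1) by auto
    qed
    then show ?thesis
      using X(3) O that by (auto simp: cube_def)
  qed
  with r(1) that show ?thesis by blast
qed

text \<open>Tychonoff's theorem with the factor \<open>{0}\<close> at every index from n on. The
  quotient is the image of this cube, hence compact.\<close>

lemma compactin_closed_cube: "compactin (Euclidean_space n) {x \<in> vecs n. \<forall>i<n. x i \<in> {0..1}}"
proof -
  have "compactin (product_topology (\<lambda>i. euclideanreal) UNIV) (PiE UNIV (\<lambda>i. if i < n then {0..1} else {0}))"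
    by (subst compactin_PiE) (auto)
  moreover have "PiE UNIV (\<lambda>i. if i < n then {0..1} else {0}) = {x \<in> vecs n. \<forall>i<n. x i \<in> {0..1::real}}"
    by (auto simp: vecs_def PiE_iff split: if_splits)
  ultimately show ?thesis
    by (auto simp: Euclidean_space_eq euclidean_product_topology compactin_subtopology)
qed

lemma second_countable_Euclidean_space: "second_countable_space (Euclidean_space n)"
proof -
  obtain B :: "(nat \<Rightarrow> real) set set" where B: "countable B" "topological_basis B"
    using ex_countable_basis by blast
  show ?thesis unfolding second_countable_space_def
  proof (rule exI[of _ "(\<inter>) (vecs n) ` B"], intro conjI allI impI ballI)
    show "openin (Euclidean_space n) b" if "b \<in> (\<inter>) (vecs n) ` B" for b
    proof -
      obtain c where "c \<in> B" "b = vecs n \<inter> c" using \<open>b \<in> _\<close> by (rule imageE)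
      then show ?thesis
        using B(2) by (simp add: Euclidean_space_eq openin_open_Int topological_basis_open)
    qed
    fix U assume "openin (Euclidean_space n) U"
    then obtain O' where O: "open O'" "U = vecs n \<inter> O'"
      by (auto simp: Euclidean_space_eq openin_open)
    then obtain B' where "B' \<subseteq> B" "\<Union>B' = O'"
      using B(2) unfolding topological_basis_def by metis
    then show "\<exists>\<U>\<subseteq>(\<inter>) (vecs n) ` B. \<Union> \<U> = U"
      using O by (intro exI[of _ "(\<inter>) (vecs n) ` B'"]) auto
  qed (use B in auto)
qed

text \<open>The straight-line homotopy stays in \<open>vecs n\<close> and keeps
  \<open>r 1 = r 0\<close> at every stage, so it is a homotopy of loops.\<close>

lemma simply_connected_Euclidean_space: "simply_connected_space (Euclidean_space n)"
  unfolding simply_connected_space_def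
proof (intro allI impI)
  fix p q :: "real \<Rightarrow> nat \<Rightarrow> real"
  assume pq: "pathin (Euclidean_space n) p \<and> p 1 = p 0 \<and> pathin (Euclidean_space n) q \<and> q 1 = q 0"
  let ?I = "top_of_set {0..1::real}"
  let ?h = "\<lambda>(s, t) i. (1 - s) * p t i + s * q t i"
  have "continuous_map (prod_topology ?I ?I) (Euclidean_space n) (\<lambda>z i. ?h z i)"
  proof -
    have pc: "continuous_map (prod_topology ?I ?I) euclideanreal (\<lambda>z. r (snd z) i)"
      if "pathin (Euclidean_space n) r" for r i
    proof -
      have "continuous_map ?I euclidean r"
        using that by (auto simp: pathin_def Euclidean_space_eq continuous_map_in_subtopology)
      then have "continuous_map ?I euclideanreal (\<lambda>x. r x i)"
        by (simp add: continuous_on_product_coordinates continuous_on_product_then_coordinatewise)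
      then show ?thesis
        using continuous_map_compose[OF continuous_map_snd, of ?I euclideanreal "\<lambda>x. r x i" ?I]
        by (simp add: o_def)
    qed
    have f: "continuous_map (prod_topology ?I ?I) euclideanreal fst"
      by (metis continuous_map_fst continuous_map_in_subtopology)
    have "p t \<in> vecs n" "q t \<in> vecs n" if "t \<in> {0..1}" for t
      using pq that by (auto simp: pathin_def continuous_map_def Euclidean_space_eq)
    then have im: "(\<lambda>z i. ?h z i) \<in> topspace (prod_topology ?I ?I) \<rightarrow> vecs n"
      by (auto simp: vecs_def)
    have "continuous_map (prod_topology ?I ?I) (product_topology (\<lambda>i. euclideanreal) UNIV) (\<lambda>z i. ?h z i)"
      unfolding continuous_map_componentwise_UNIV case_prod_beta
      by (intro allI continuous_intros continuous_map_real_mult continuous_map_add continuous_map_diff f pc)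
         (use pq in auto)
    then show ?thesis
      using im by (simp add: Euclidean_space_eq continuous_map_in_subtopology euclidean_product_topology)
  qed
  then show "homotopic_with (\<lambda>r. r 1 = r 0) ?I (Euclidean_space n) p q"
    unfolding homotopic_with_def
    by (intro exI[of _ ?h]) (use pq in auto)
qed

section \<open>Quotients by groups of integer translations and coordinate permutations\<close>

text \<open>Openness in terms of cubes is what the lattice respects: its elements map cubes to cubes
  of the same size (\<open>act_cube\<close>).\<close>

lemma openin_Euclidean_space_cube:
  "openin (Euclidean_space n) W \<longleftrightarrow> W \<subseteq> vecs n \<and> (\<forall>x\<in>W. \<exists>r>0. cube n x r \<subseteq> W)"
proof
  assume "openin (Euclidean_space n) W"
  then show "W \<subseteq> vecs n \<and> (\<forall>x\<in>W. \<exists>r>0. cube n x r \<subseteq> W)"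
    using openin_subset cube_basis by (metis topspace_Euclidean_space_vecs)
next
  assume W: "W \<subseteq> vecs n \<and> (\<forall>x\<in>W. \<exists>r>0. cube n x r \<subseteq> W)"
  show "openin (Euclidean_space n) W"
  proof (subst openin_subopen, intro ballI)
    fix x assume x: "x \<in> W"
    then obtain r where "r > 0" "cube n x r \<subseteq> W"
      using W by blast
    with x W show "\<exists>T. openin (Euclidean_space n) T \<and> x \<in> T \<and> T \<subseteq> W"
      by (intro exI[of _ "cube n x r"]) auto
  qed
qed

definition euclidean_manifold :: "nat \<Rightarrow> (nat \<Rightarrow> real) manifold" where
  "euclidean_manifold n = \<lparr>mfd_dim = n, mfd_top = Euclidean_space n, mfd_charts = {(vecs n, \<lambda>x. x)}\<rparr>"

text \<open>Polymorphic and independent of chart and point, so that it denotes both the Euclidean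
  metric of the group and the metric induced on the quotient.\<close>

definition delta_metric :: "'a metric_tensor" where
  "delta_metric c p i j = (if i = j then 1 else 0)"

lemma euclidean_manifold_sel [simp]:
  "mfd_dim (euclidean_manifold n) = n"
  "mfd_top (euclidean_manifold n) = Euclidean_space n"
  "mfd_charts (euclidean_manifold n) = {(vecs n, \<lambda>x. x)}"
  by (simp_all add: euclidean_manifold_def)

lemma chart_inv_euclidean [simp]: "z \<in> vecs n \<Longrightarrow> chart_inv (vecs n, \<lambda>x. x) z = z"
  by (simp add: chart_inv_def f_inv_into_f[where f = "\<lambda>x. x", simplified])

text \<open>Turns \<open>preserves_metric\<close> between two such metrics into the statement that
  the columns of the Jacobian are orthonormal.\<close>

lemma sum_delta_metric:
  "(\<Sum>k<n. \<Sum>l<n. delta_metric c p k l * f k * g l) = (\<Sum>k<n. f k * g k)"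
proof (rule sum.cong[OF refl])
  fix k assume "k \<in> {..<n}"
  have "(\<Sum>l<n. delta_metric c p k l * f k * g l) = (\<Sum>l<n. if l = k then f k * g k else 0)"
    by (rule sum.cong) (auto simp: delta_metric_def)
  then show "(\<Sum>l<n. delta_metric c p k l * f k * g l) = f k * g k"
    using \<open>k \<in> {..<n}\<close> by simp
qed

lemma smooth_on_const: "openin (Euclidean_space n) U \<Longrightarrow> smooth_on n U (\<lambda>x. c)"
  by (rule smooth_on_elementary[OF _ elementary_const[of c]]) simp_all

lemma smooth_manifold_Euclidean: "smooth_manifold (euclidean_manifold n)"
proof -
  have "homeomorphic_map (Euclidean_space n) (Euclidean_space n) (\<lambda>x. x)"
    using homeomorphic_map_id[of "Euclidean_space n"] by (simp add: id_def)
  moreover have "smooth_on n (vecs n) (\<lambda>x. chart_inv (vecs n, \<lambda>x. x) x i)" for i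
    by (rule smooth_on_elementary[OF _ elementary_coord[of i]])
      (simp_all add: Euclidean_space_eq)
  ultimately show ?thesis
    using openin_topspace[of "Euclidean_space n"] subtopology_topspace[of "Euclidean_space n"]
    by (simp add: smooth_manifold_def Hausdorff_Euclidean_space second_countable_Euclidean_space)
qed

text \<open>The components are constant, symmetric and positive definite in any chart; the
  transformation law is the only condition that depends on the atlas.\<close>

lemma riemannian_metric_deltaI:
  assumes "\<And>c. c \<in> mfd_charts M \<Longrightarrow> openin (Euclidean_space (mfd_dim M)) (snd c ` fst c)"
    and "preserves_metric M delta_metric M delta_metric (\<lambda>p. p)"
  shows "riemannian_metric M delta_metric"
proof -
  have "0 < (\<Sum>i<n. \<Sum>j<n. delta_metric c p i j * v i * v j)" if "i < n" "v i \<noteq> 0" for c p n i and v :: "nat \<Rightarrow> real"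
    unfolding sum_delta_metric using that by (intro sum_pos2[of _ i]) (auto simp: zero_less_mult_iff not_less)
  moreover have "smooth_on n U (\<lambda>x. delta_metric c (f x) i j)" if "openin (Euclidean_space n) U" for n U c f i j
    unfolding delta_metric_def using that by (rule smooth_on_const)
  ultimately show ?thesis
    using assms unfolding riemannian_metric_def by (auto simp: delta_metric_def)
qed

text \<open>The properties of the lattice from which the quotient and its holonomy are determined.
  \<open>separated\<close> makes the action free with a uniform gap, \<open>cobounded\<close>
  provides a compact set that meets every orbit, and \<open>P_inj\<close> makes the holonomy all of
  A instead of a quotient of A. In \<open>act\<close> the permutation acts on indices, so
  \<open>h \<otimes> k\<close> permutes by \<open>P (\<theta> k) \<circ> P (\<theta> h)\<close>.
  This agrees with \<open>P_mult\<close> and \<open>\<theta>_mult\<close> because A is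
  commutative.\<close>

locale crystallographic =
  group G + A: comm_group A
  for G :: "(nat \<Rightarrow> real) monoid" (structure) and A :: "('a, 'b) monoid_scheme" +
  fixes d :: nat and H :: "(nat \<Rightarrow> real) set" and \<theta> :: "(nat \<Rightarrow> real) \<Rightarrow> 'a" and P :: "'a \<Rightarrow> nat \<Rightarrow> nat"
  assumes carrier_G: "carrier G = vecs d"
    and subgroup_H: "subgroup H G"
    and act: "h \<in> H \<Longrightarrow> x \<in> vecs d \<Longrightarrow> i < d \<Longrightarrow> (h \<otimes> x) i = h i + x (P (\<theta> h) i)"
    and P_permutes: "a \<in> carrier A \<Longrightarrow> P a permutes {..<d}"
    and P_mult: "a \<in> carrier A \<Longrightarrow> b \<in> carrier A \<Longrightarrow> P (a \<otimes>\<^bsub>A\<^esub> b) = P a \<circ> P b"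
    and P_inj: "inj_on P (carrier A)"
    and \<theta>_mult: "h \<in> H \<Longrightarrow> k \<in> H \<Longrightarrow> \<theta> (h \<otimes> k) = \<theta> h \<otimes>\<^bsub>A\<^esub> \<theta> k"
    and \<theta>_image: "\<theta> ` H = carrier A"
    and separated: "h \<in> H \<Longrightarrow> h \<noteq> \<one> \<Longrightarrow> x \<in> vecs d \<Longrightarrow> \<exists>i<d. 1 \<le> \<bar>(h \<otimes> x) i - x i\<bar>"
    and cobounded: "x \<in> vecs d \<Longrightarrow> \<exists>h\<in>H. \<forall>i<d. (h \<otimes> x) i \<in> {0..1}"
begin

section \<open>Charts and topology of the quotient\<close>

abbreviation q :: "(nat \<Rightarrow> real) \<Rightarrow> (nat \<Rightarrow> real) set" where
  "q x \<equiv> H #> x"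

abbreviation box :: "(nat \<Rightarrow> real) \<Rightarrow> (nat \<Rightarrow> real) set" where
  "box x \<equiv> cube d x (1/2)"

text \<open>An orbit meets a box in at most one point, and this point is the coordinate vector: the
  chart is the inverse of \<open>q\<close> on the box.\<close>

definition ch :: "(nat \<Rightarrow> real) \<Rightarrow> (nat \<Rightarrow> real) set chart" where
  "ch x = (q ` box x, \<lambda>S. the_elem (S \<inter> box x))"

definition N :: "(nat \<Rightarrow> real) set manifold" where
  "N = \<lparr>mfd_dim = d, mfd_top = coset_topology G (Euclidean_space d) H, mfd_charts = ch ` vecs d\<rparr>"

lemma N_sel [simp]: "mfd_dim N = d" "mfd_charts N = ch ` vecs d"
  by (simp_all add: N_def)

lemma H_vecs: "h \<in> H \<Longrightarrow> h \<in> vecs d"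
  using subgroup.subset[OF subgroup_H] carrier_G by blast

lemma mult_vecs [simp]: "x \<in> vecs d \<Longrightarrow> y \<in> vecs d \<Longrightarrow> x \<otimes> y \<in> vecs d"
  using m_closed by (simp add: carrier_G)

lemma act_vecs [simp]: "h \<in> H \<Longrightarrow> x \<in> vecs d \<Longrightarrow> h \<otimes> x \<in> vecs d"
  by (simp add: H_vecs)

lemma one_H [simp]: "\<one> \<in> H"
  by (rule subgroup.one_closed[OF subgroup_H])

lemma H_mult [simp]: "h \<in> H \<Longrightarrow> k \<in> H \<Longrightarrow> h \<otimes> k \<in> H"
  by (rule subgroup.m_closed[OF subgroup_H])

lemma H_inv [simp]: "h \<in> H \<Longrightarrow> inv h \<in> H"
  by (rule subgroup.m_inv_closed[OF subgroup_H])

lemma H_assoc: "h \<in> H \<Longrightarrow> k \<in> H \<Longrightarrow> x \<in> vecs d \<Longrightarrow> (h \<otimes> k) \<otimes> x = h \<otimes> (k \<otimes> x)"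
  using m_assoc by (simp add: carrier_G H_vecs)

lemma one_act [simp]: "x \<in> vecs d \<Longrightarrow> \<one> \<otimes> x = x"
  by (simp add: carrier_G)

lemma inv_act [simp]: "h \<in> H \<Longrightarrow> x \<in> vecs d \<Longrightarrow> inv h \<otimes> (h \<otimes> x) = x"
  "h \<in> H \<Longrightarrow> x \<in> vecs d \<Longrightarrow> h \<otimes> (inv h \<otimes> x) = x"
  using H_vecs by (simp_all flip: H_assoc add: carrier_G)

lemma \<theta>_closed [simp]: "h \<in> H \<Longrightarrow> \<theta> h \<in> carrier A"
  using \<theta>_image by blast

lemma \<theta>_one [simp]: "\<theta> \<one> = \<one>\<^bsub>A\<^esub>"
  using \<theta>_mult[of \<one> \<one>] by (simp add: A.l_cancel_one)

lemma \<theta>_inv: "h \<in> H \<Longrightarrow> \<theta> (inv h) = inv\<^bsub>A\<^esub> \<theta> h"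
  using \<theta>_mult[of "inv h" h] H_vecs[of h] carrier_G
  by (intro A.inv_equality[symmetric]) auto

lemma P_lt: "a \<in> carrier A \<Longrightarrow> i < d \<Longrightarrow> P a i < d"
  using permutes_in_image[OF P_permutes] by blast

text \<open>\<open>P\<close> is only assumed to be multiplicative. The permutation of the unit is
  idempotent and injective, therefore the identity, and the rest follows.\<close>

lemma P_inv: "a \<in> carrier A \<Longrightarrow> P a (P (inv\<^bsub>A\<^esub> a) i) = i" "a \<in> carrier A \<Longrightarrow> P (inv\<^bsub>A\<^esub> a) (P a i) = i"
proof -
  have "P \<one>\<^bsub>A\<^esub> \<circ> P \<one>\<^bsub>A\<^esub> = P \<one>\<^bsub>A\<^esub>"
    using P_mult[of "\<one>\<^bsub>A\<^esub>" "\<one>\<^bsub>A\<^esub>"] by simp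
  then have "P \<one>\<^bsub>A\<^esub> (P \<one>\<^bsub>A\<^esub> i) = P \<one>\<^bsub>A\<^esub> i" for i
    by (metis comp_apply)
  then have 1: "P \<one>\<^bsub>A\<^esub> i = i" for i
    using permutes_inj[OF P_permutes[OF A.one_closed]] by (meson injD)
  show "a \<in> carrier A \<Longrightarrow> P a (P (inv\<^bsub>A\<^esub> a) i) = i" "a \<in> carrier A \<Longrightarrow> P (inv\<^bsub>A\<^esub> a) (P a i) = i"
    using P_mult[of a "inv\<^bsub>A\<^esub> a"] P_mult[of "inv\<^bsub>A\<^esub> a" a] 1 by (metis A.inv_closed A.r_inv comp_apply)
      (metis A.inv_closed A.l_inv P_mult 1 comp_apply)
qed

lemma P_one [simp]: "P \<one>\<^bsub>A\<^esub> i = i"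
  using P_inv[of "\<one>\<^bsub>A\<^esub>" i] P_mult[of "\<one>\<^bsub>A\<^esub>" "\<one>\<^bsub>A\<^esub>"] by (metis A.inv_one A.one_closed A.r_one comp_apply)

text \<open>A permutation of the coordinates followed by a translation is an isometry of the maximum
  norm.\<close>

lemma act_cube:
  assumes "h \<in> H" "x \<in> vecs d" "y \<in> cube d x r"
  shows "h \<otimes> y \<in> cube d (h \<otimes> x) r"
  using assms P_lt[of "\<theta> h"] by (auto simp: cube_def act)

text \<open>Two points of an open cube of radius 1/2 differ by less than 1 in every coordinate,
  against \<open>separated\<close>.\<close>

lemma separated_eq:
  assumes "h \<in> H" "y \<in> vecs d" "y \<in> box x" "h \<otimes> y \<in> box x"
  shows "h = \<one>"
proof (rule ccontr)
  assume "h \<noteq> \<one>"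
  then obtain i where i: "i < d" "1 \<le> \<bar>(h \<otimes> y) i - y i\<bar>"
    using separated assms by blast
  then have "\<bar>(h \<otimes> y) i - x i\<bar> < 1/2" "\<bar>y i - x i\<bar> < 1/2"
    using assms by (auto simp: cube_def)
  with i show False by linarith
qed

lemma box_vecs: "y \<in> box x \<Longrightarrow> y \<in> vecs d"
  using cube_subset_vecs by blast

lemma q_mem: "y \<in> q x \<longleftrightarrow> (\<exists>h\<in>H. y = h \<otimes> x)"
  by (auto simp: r_coset_def)

lemma q_act: "h \<in> H \<Longrightarrow> x \<in> vecs d \<Longrightarrow> q (h \<otimes> x) = q x"
proof -
  assume h: "h \<in> H" "x \<in> vecs d"
  show "q (h \<otimes> x) = q x"
  proof (intro equalityI subsetI)
    fix y assume "y \<in> q (h \<otimes> x)"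
    then obtain k where "k \<in> H" "y = k \<otimes> (h \<otimes> x)" by (auto simp: q_mem)
    with h show "y \<in> q x"
      unfolding q_mem by (intro bexI[of _ "k \<otimes> h"]) (auto simp: H_assoc)
  next
    fix y assume "y \<in> q x"
    then obtain k where "k \<in> H" "y = k \<otimes> x" by (auto simp: q_mem)
    with h show "y \<in> q (h \<otimes> x)"
      unfolding q_mem by (intro bexI[of _ "k \<otimes> inv h"]) (auto simp: H_assoc)
  qed
qed

lemma q_self: "x \<in> vecs d \<Longrightarrow> x \<in> q x"
  unfolding q_mem by (intro bexI[of _ \<one>]) auto

lemma q_eqD: "q x = q y \<Longrightarrow> y \<in> vecs d \<Longrightarrow> \<exists>h\<in>H. y = h \<otimes> x"
  using q_self q_mem by metis

text \<open>Any translate of \<open>z\<close> that lies in the box is the coordinate vector of its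
  orbit, since by \<open>separated_eq\<close> there is no second one. All later computations in
  charts rest on this rule.\<close>

lemma chart_q_act:
  assumes "h \<in> H" "z \<in> vecs d" "h \<otimes> z \<in> box x"
  shows "snd (ch x) (q z) = h \<otimes> z"
proof -
  have "q z \<inter> box x = {h \<otimes> z}"
  proof (intro equalityI subsetI)
    fix y assume y: "y \<in> q z \<inter> box x"
    then obtain k where k: "k \<in> H" "y = k \<otimes> z" by (auto simp: q_mem)
    then have "y = (k \<otimes> inv h) \<otimes> (h \<otimes> z)"
      using assms by (simp add: H_assoc)
    moreover have "k \<otimes> inv h = \<one>"
      using separated_eq[of "k \<otimes> inv h" "h \<otimes> z" x] assms k y calculation by (auto simp: box_vecs)
    ultimately show "y \<in> {h \<otimes> z}" using assms by (simp add: box_vecs)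
  qed (use assms q_mem in auto)
  then show ?thesis by (simp add: ch_def)
qed

lemma chart_q: "z \<in> box x \<Longrightarrow> snd (ch x) (q z) = z"
  using chart_q_act[of \<one> z x] by (simp add: box_vecs)

lemma fst_ch [simp]: "fst (ch x) = q ` box x"
  by (simp add: ch_def)

lemma snd_ch_image: "snd (ch x) ` fst (ch x) = box x"
  using chart_q by (force simp: image_image)

lemma chart_inv_ch: "z \<in> box x \<Longrightarrow> chart_inv (ch x) z = q z"
proof -
  assume z: "z \<in> box x"
  have "inj_on (snd (ch x)) (fst (ch x))"
    by (rule inj_onI) (auto simp: chart_q)
  then have "inv_into (fst (ch x)) (snd (ch x)) (snd (ch x) (q z)) = q z"
    using z by (intro inv_into_f_f) auto
  then show ?thesis using z by (simp add: chart_inv_def chart_q)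
qed

lemma q_mem_chart: "z \<in> vecs d \<Longrightarrow> q z \<in> q ` box y \<longleftrightarrow> (\<exists>h\<in>H. h \<otimes> z \<in> box y)"
proof
  assume z: "z \<in> vecs d"
  { assume "q z \<in> q ` box y"
    then obtain w where w: "w \<in> box y" "q z = q w" by auto
    then show "\<exists>h\<in>H. h \<otimes> z \<in> box y" using q_eqD[of z w] box_vecs by metis }
  { assume "\<exists>h\<in>H. h \<otimes> z \<in> box y"
    then show "q z \<in> q ` box y" using z q_act by (metis image_eqI) }
qed

lemma openin_N:
  "openin (mfd_top N) S \<longleftrightarrow> S \<subseteq> q ` vecs d \<and> openin (Euclidean_space d) {x \<in> vecs d. q x \<in> S}"
  by (auto simp: N_def openin_coset_topology RCOSETS_def carrier_G)

lemma quotient_map_q: "quotient_map (Euclidean_space d) (mfd_top N) q"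
  using quotient_map_coset_topology[of G "Euclidean_space d" H] by (simp add: N_def carrier_G)

lemma continuous_map_q: "continuous_map (Euclidean_space d) (mfd_top N) q"
  by (rule quotient_imp_continuous_map[OF quotient_map_q])

lemma topspace_N: "topspace (mfd_top N) = q ` vecs d"
  using quotient_imp_surjective_map[OF quotient_map_q] by simp

lemma openin_q_image:
  assumes "openin (Euclidean_space d) W"
  shows "openin (mfd_top N) (q ` W)"
proof -
  have W: "W \<subseteq> vecs d" "\<And>x. x \<in> W \<Longrightarrow> \<exists>r>0. cube d x r \<subseteq> W"
    using assms by (auto simp: openin_Euclidean_space_cube)
  have "\<exists>r>0. cube d x r \<subseteq> {x \<in> vecs d. q x \<in> q ` W}" if x: "x \<in> vecs d" "q x \<in> q ` W" for x
  proof -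
    obtain w where w: "w \<in> W" "q x = q w"
      using x(2) by (rule imageE)
    then obtain h where h: "h \<in> H" "h \<otimes> x \<in> W"
      using q_eqD[of x w] W(1) by auto
    then obtain r where r: "r > 0" "cube d (h \<otimes> x) r \<subseteq> W"
      using W by blast
    have "q y \<in> q ` W" if "y \<in> cube d x r" for y
    proof (rule image_eqI)
      have "y \<in> vecs d" using that by (simp add: cube_def)
      then show "q y = q (h \<otimes> y)" by (simp add: q_act h(1))
      show "h \<otimes> y \<in> W" using act_cube[OF h(1) x(1) that] r(2) by blast
    qed
    then have "cube d x r \<subseteq> {x \<in> vecs d. q x \<in> q ` W}"
      by (auto simp: cube_def)
    with r(1) show ?thesis by blast
  qed
  then show ?thesis
    using W(1) unfolding openin_N openin_Euclidean_space_cube by auto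
qed

text \<open>It suffices that the orbit of \<open>x\<close> avoids a cube of some radius
  \<open>e\<close> around \<open>y\<close>. If the cubes of radius \<open>e/2\<close> around both
  points had a common orbit, a lattice element would carry \<open>x\<close> into that cube.\<close>

lemma Hausdorff_N: "Hausdorff_space (mfd_top N)"
  unfolding Hausdorff_space_def topspace_N
proof (intro allI impI, elim conjE imageE)
  fix p p' x y assume pq: "p \<noteq> p'" "p = q x" "p' = q y" and x: "x \<in> vecs d" and y: "y \<in> vecs d"
  obtain e where e: "e > 0" "\<And>h. h \<in> H \<Longrightarrow> h \<otimes> x \<notin> cube d y e"
  proof (cases "\<exists>h\<in>H. h \<otimes> x \<in> box y")
    case True
    then obtain h where h: "h \<in> H" "h \<otimes> x \<in> box y" by blast
    have "h \<otimes> x \<noteq> y"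
      using pq q_act[OF h(1) x] by auto
    then obtain i where i: "i < d" "(h \<otimes> x) i \<noteq> y i"
      using vecs_eqI[of "h \<otimes> x" d y] h x y by (auto simp: box_vecs)
    \<comment> \<open>\<open>h \<otimes> x\<close> is the only point of the orbit inside
      \<open>box y\<close>; the second entry of the minimum excludes it through coordinate
      \<open>i\<close>, the first excludes all others.\<close>
    define e where "e = min (1/2) \<bar>(h \<otimes> x) i - y i\<bar>"
    have "k \<otimes> x \<notin> cube d y e" if "k \<in> H" for k
    proof
      assume k: "k \<otimes> x \<in> cube d y e"
      then have "k \<otimes> x \<in> box y"
        by (auto simp: cube_def e_def)
      then have "k \<otimes> x = h \<otimes> x"
        using chart_q_act[of k x y] chart_q_act[of h x y] that h x by metis
      then show False using k i by (auto simp: cube_def e_def)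
    qed
    moreover have "e > 0" using i by (simp add: e_def)
    ultimately show ?thesis using that by blast
  next
    case False
    then show ?thesis using that[of "1/2"] by auto
  qed
  show "\<exists>U V. openin (mfd_top N) U \<and> openin (mfd_top N) V \<and> p \<in> U \<and> p' \<in> V \<and> disjnt U V"
  proof (intro exI conjI)
    show "openin (mfd_top N) (q ` cube d x (e/2))" "openin (mfd_top N) (q ` cube d y (e/2))"
      by (simp_all add: openin_q_image)
    show "p \<in> q ` cube d x (e/2)" "p' \<in> q ` cube d y (e/2)"
      using pq x y e by auto
    show "disjnt (q ` cube d x (e/2)) (q ` cube d y (e/2))"
      unfolding disjnt_iff
    proof (intro allI notI, elim conjE imageE)
      fix S a b assume ab: "a \<in> cube d x (e/2)" "b \<in> cube d y (e/2)" "S = q a" "S = q b"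
      then obtain h where h: "h \<in> H" "b = h \<otimes> a"
        using q_eqD[of a b] cube_subset_vecs by blast
      have "h \<otimes> a \<in> cube d (h \<otimes> x) (e/2)"
        using act_cube h x ab by blast
      then have "\<bar>(h \<otimes> x) i - y i\<bar> < e" if "i < d" for i
        using ab(2) h(2) that unfolding cube_def by (smt (verit, best) field_sum_of_halves mem_Collect_eq)
      then have "h \<otimes> x \<in> cube d y e"
        using h x H_vecs by (auto simp: cube_def)
      with e h show False by blast
    qed
  qed
qed

text \<open>\<open>q\<close> is continuous, open and onto, so the images of a countable basis form a
  basis.\<close>

lemma second_countable_N: "second_countable_space (mfd_top N)"
proof -
  obtain B where B: "countable B" "\<forall>b\<in>B. openin (Euclidean_space d) b"
      "\<And>U. openin (Euclidean_space d) U \<Longrightarrow> \<exists>\<U>\<subseteq>B. \<Union>\<U> = U"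
    using second_countable_Euclidean_space[of d] unfolding second_countable_space_def by metis
  show ?thesis unfolding second_countable_space_def
  proof (rule exI[of _ "(`) q ` B"], intro conjI allI impI ballI)
    show "openin (mfd_top N) b" if "b \<in> (`) q ` B" for b
      using that B(2) openin_q_image by blast
    fix U assume "openin (mfd_top N) U"
    then have U: "U \<subseteq> q ` vecs d" "openin (Euclidean_space d) {x \<in> vecs d. q x \<in> U}"
      by (auto simp: openin_N)
    then obtain B' where B': "B' \<subseteq> B" "\<Union>B' = {x \<in> vecs d. q x \<in> U}"
      using B(3) by meson
    have "\<Union> ((`) q ` B') = q ` \<Union>B'" by blast
    also have "\<dots> = U" using U(1) B'(2) by auto
    finally show "\<exists>\<U>\<subseteq>(`) q ` B. \<Union>\<U> = U"
      using B'(1) by (intro exI[of _ "(`) q ` B'"]) auto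
  qed (use B in auto)
qed

lemma openin_chart [simp]: "openin (mfd_top N) (q ` box x)"
  by (simp add: openin_q_image)

lemma homeomorphic_chart:
  "homeomorphic_maps (subtopology (mfd_top N) (q ` box x)) (subtopology (Euclidean_space d) (box x)) (snd (ch x)) q"
  unfolding homeomorphic_maps_def
proof (intro conjI ballI)
  have ts: "topspace (subtopology (mfd_top N) (q ` box x)) = q ` box x"
    "topspace (subtopology (Euclidean_space d) (box x)) = box x"
    by (auto simp: topspace_N box_vecs)
  show "continuous_map (subtopology (mfd_top N) (q ` box x)) (subtopology (Euclidean_space d) (box x)) (snd (ch x))"
    unfolding continuous_map_def ts
  proof (intro conjI allI impI)
    show "snd (ch x) \<in> q ` box x \<rightarrow> box x"
      by (auto simp: chart_q)
    fix U assume "openin (subtopology (Euclidean_space d) (box x)) U"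
    then have U: "openin (Euclidean_space d) U" "U \<subseteq> box x"
      by (auto simp: openin_open_subtopology)
    have "{S \<in> q ` box x. snd (ch x) S \<in> U} = q ` U"
      using U(2) by (auto simp: chart_q)
    then show "openin (subtopology (mfd_top N) (q ` box x)) {S \<in> q ` box x. snd (ch x) S \<in> U}"
      using U by (simp add: openin_open_subtopology openin_q_image image_mono)
  qed
  show "continuous_map (subtopology (Euclidean_space d) (box x)) (subtopology (mfd_top N) (q ` box x)) q"
    unfolding continuous_map_in_subtopology
    by (auto simp: continuous_map_from_subtopology continuous_map_q)
  show "q (snd (ch x) S) = S" if "S \<in> topspace (subtopology (mfd_top N) (q ` box x))" for S
    using that unfolding ts by (auto simp: chart_q)
  show "snd (ch x) (q y) = y" if "y \<in> topspace (subtopology (Euclidean_space d) (box x))" for y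
    using that unfolding ts by (auto simp: chart_q)
qed

text \<open>\<open>box (inv h \<otimes> y)\<close> is exactly the region that \<open>h\<close>
  carries into \<open>box y\<close>; there the chart with centre \<open>y\<close> composed with
  \<open>q\<close> is the action of \<open>h\<close>.\<close>

lemma chart_comp_local:
  assumes "h \<in> H" "y \<in> vecs d"
  shows "z \<in> vecs d \<Longrightarrow> h \<otimes> z \<in> box y \<Longrightarrow> z \<in> box (inv h \<otimes> y)"
    and "w \<in> box (inv h \<otimes> y) \<Longrightarrow> h \<otimes> w \<in> box y"
    and "w \<in> box (inv h \<otimes> y) \<Longrightarrow> snd (ch y) (q w) = h \<otimes> w"
proof -
  show "z \<in> box (inv h \<otimes> y)" if "z \<in> vecs d" "h \<otimes> z \<in> box y" for z
    using act_cube[of "inv h" y "h \<otimes> z"] assms that by simp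
  show *: "h \<otimes> w \<in> box y" if "w \<in> box (inv h \<otimes> y)" for w
    using act_cube[OF assms(1) _ that] assms by simp
  show "snd (ch y) (q w) = h \<otimes> w" if "w \<in> box (inv h \<otimes> y)" for w
    using chart_q_act[OF assms(1) _ *[OF that]] box_vecs[OF that] by simp
qed

text \<open>\<open>F\<close> need only agree with \<open>q\<close> on \<open>U\<close>. This covers
  the transition maps, where \<open>F\<close> is \<open>chart_inv (ch x)\<close> on a box, as well
  as the projection from the group.\<close>

lemma locally_elementary_chart:
  assumes U: "openin (Euclidean_space d) U" and F: "\<And>z. z \<in> U \<Longrightarrow> F z = q z"
    and y: "y \<in> vecs d" and i: "i < d"
  shows "locally_elementary d {z \<in> U. q z \<in> q ` box y} (\<lambda>z. snd (ch y) (F z) i)"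
  unfolding locally_elementary_def
proof
  fix z assume "z \<in> {z \<in> U. q z \<in> q ` box y}"
  then have z: "z \<in> U" "q z \<in> q ` box y" "z \<in> vecs d"
    using openin_subset[OF U] by auto
  then obtain h where h: "h \<in> H" "h \<otimes> z \<in> box y"
    using q_mem_chart by blast
  let ?W = "U \<inter> box (inv h \<otimes> y)"
  let ?g = "\<lambda>z. h i + z (P (\<theta> h) i)"
  have "openin (Euclidean_space d) ?W"
    using U by (intro openin_Int) auto
  moreover have "z \<in> ?W"
    using chart_comp_local(1)[OF h(1) y] z h by blast
  moreover have "?W \<subseteq> {z \<in> U. q z \<in> q ` box y}"
    using q_mem_chart chart_comp_local(2)[OF h(1) y] h(1) box_vecs by blast
  moreover have "?g \<in> elementary"
    by (intro elementary.intros)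
  moreover have "\<forall>w\<in>?W. snd (ch y) (F w) i = ?g w"
    using chart_comp_local(3)[OF h(1) y] F act[OF h(1) _ i] box_vecs by auto
  ultimately show "\<exists>W g. openin (Euclidean_space d) W \<and> z \<in> W \<and> W \<subseteq> {z \<in> U. q z \<in> q ` box y} \<and>
      g \<in> elementary \<and> (\<forall>w\<in>W. snd (ch y) (F w) i = g w)"
    by (intro exI[of _ ?W] exI[of _ ?g] conjI)
qed

text \<open>Near \<open>z\<close> the map is the affine action of \<open>h\<close>, so its Jacobian
  is the matrix of the permutation \<open>P (\<theta> h)\<close>.\<close>

lemma partial_chart:
  assumes U: "openin (Euclidean_space d) U" and F: "\<And>z. z \<in> U \<Longrightarrow> F z = q z" and z: "z \<in> U"
    and h: "h \<in> H" "h \<otimes> z \<in> box y" and y: "y \<in> vecs d" and i: "i < d" "k < d"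
  shows "partial i (\<lambda>z. snd (ch y) (F z) k) z = (if P (\<theta> h) k = i then 1 else 0)"
proof -
  let ?W = "U \<inter> box (inv h \<otimes> y)"
  have zd: "z \<in> vecs d"
    using openin_subset[OF U] z by auto
  have W: "openin (Euclidean_space d) ?W"
    using U by (intro openin_Int) auto
  have zW: "z \<in> ?W"
    using chart_comp_local(1)[OF h(1) y] z zd h by blast
  have eq: "snd (ch y) (F w) k = h k + w (P (\<theta> h) k)" if "w \<in> ?W" for w
    using chart_comp_local(3)[OF h(1) y] F act[OF h(1) _ i(2)] box_vecs that by auto
  have "((\<lambda>t. h k + (z(i := t)) (P (\<theta> h) k)) has_real_derivative (if P (\<theta> h) k = i then 1 else 0)) (at (z i))"
    by (auto intro!: derivative_eq_intros)
  from deriv_cong_openin[where f = "\<lambda>z. snd (ch y) (F z) k", OF W zW i(1) eq this] show ?thesis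
    unfolding partial_def by (rule DERIV_imp_deriv)
qed

lemma jac_chart:
  assumes "z \<in> box x" "h \<in> H" "h \<otimes> z \<in> box y" "x \<in> vecs d" "y \<in> vecs d" "i < d" "k < d"
  shows "jac (ch x) (ch y) (\<lambda>p. p) (q z) k i = (if P (\<theta> h) k = i then 1 else 0)"
  using partial_chart[of "box x" "chart_inv (ch x)" z h y i k] assms
  by (simp add: jac_def cpartial_def chart_inv_ch chart_q)

lemma jac_q:
  assumes "z \<in> vecs d" "h \<in> H" "h \<otimes> z \<in> box y" "y \<in> vecs d" "i < d" "k < d"
  shows "jac (vecs d, \<lambda>x. x) (ch y) q z k i = (if P (\<theta> h) k = i then 1 else 0)"
  using partial_chart[of "vecs d" "\<lambda>z. q (chart_inv (vecs d, \<lambda>x. x) z)" z h y i k] assms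
    openin_topspace[of "Euclidean_space d"]
  by (simp add: jac_def cpartial_def)

text \<open>Orthonormality of the columns of a permutation matrix, which makes the metric well
  defined on the quotient and the projection isometric.\<close>

lemma sum_permuted_delta:
  assumes "a \<in> carrier A" "i < d"
  shows "(\<Sum>k<d. (if P a k = i then 1 else 0) * (if P a k = j then 1 else 0)) = (if i = j then 1 else 0 :: real)"
proof -
  have "(\<Sum>k<d. (if P a k = i then 1 else 0) * (if P a k = j then 1 else 0)) =
      (\<Sum>k<d. (if k = i then 1 else 0) * (if k = j then 1 else 0 :: real))"
    using sum.permute[OF P_permutes[OF assms(1)], of "\<lambda>k. (if k = i then 1 else 0) * (if k = j then 1 else 0 :: real)"]
    by (simp add: o_def)
  also have "\<dots> = (\<Sum>k<d. if k = i then (if i = j then 1 else 0) else 0)"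
    by (rule sum.cong) auto
  also have "\<dots> = (if i = j then 1 else 0)"
    using assms(2) by simp
  finally show ?thesis .
qed

lemma charts_at_N: "charts_at N p = {ch x |x. x \<in> vecs d \<and> p \<in> q ` box x}"
  by (auto simp: charts_at_def)

lemma snd_ch_image_Int: "snd (ch x) ` (fst (ch x) \<inter> S) = {z \<in> box x. q z \<in> S}"
proof (intro equalityI subsetI)
  fix z assume "z \<in> snd (ch x) ` (fst (ch x) \<inter> S)"
  then obtain w where "w \<in> box x" "q w \<in> S" "z = snd (ch x) (q w)"
    unfolding fst_ch by blast
  then show "z \<in> {z \<in> box x. q z \<in> S}" by (simp add: chart_q)
next
  fix z assume "z \<in> {z \<in> box x. q z \<in> S}"
  then show "z \<in> snd (ch x) ` (fst (ch x) \<inter> S)"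
    unfolding fst_ch by (intro image_eqI[of _ _ "q z"]) (simp_all add: chart_q)
qed

lemma smooth_manifold_N: "smooth_manifold N"
  unfolding smooth_manifold_def N_sel
proof (intro conjI ballI allI impI)
  show "Hausdorff_space (mfd_top N)" "second_countable_space (mfd_top N)"
    by (rule Hausdorff_N second_countable_N)+
  show "\<Union> (fst ` ch ` vecs d) = topspace (mfd_top N)"
    unfolding topspace_N using box_vecs centre_in_cube[of _ d "1/2"] by auto
  fix c assume "c \<in> ch ` vecs d"
  then obtain x where x: "x \<in> vecs d" "c = ch x" by auto
  show "openin (mfd_top N) (fst c)" "openin (Euclidean_space d) (snd c ` fst c)"
    by (simp_all only: x snd_ch_image) simp_all
  show "homeomorphic_map (subtopology (mfd_top N) (fst c))
      (subtopology (Euclidean_space d) (snd c ` fst c)) (snd c)"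
    unfolding x snd_ch_image unfolding fst_ch by (rule homeomorphic_maps_imp_map[OF homeomorphic_chart])
  fix c' i assume "c' \<in> ch ` vecs d" and i: "i < d"
  then obtain y where y: "y \<in> vecs d" "c' = ch y" by auto
  have "snd c ` (fst c \<inter> fst c') = {z \<in> box x. q z \<in> q ` box y}"
    unfolding x y snd_ch_image_Int unfolding fst_ch ..
  then show "smooth_on d (snd c ` (fst c \<inter> fst c')) (\<lambda>z. snd c' (chart_inv c z) i)"
    unfolding x y using locally_elementary_chart[of "box x" "chart_inv (ch x)" y i] i y
    by (simp add: smooth_on_locally_elementary chart_inv_ch)
qed

lemma preserves_metric_N: "preserves_metric N delta_metric N delta_metric (\<lambda>p. p)"
  unfolding preserves_metric_def N_sel charts_at_N sum_delta_metric
proof (intro ballI allI impI)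
  fix p c c' i j assume "c \<in> {ch x |x. x \<in> vecs d \<and> p \<in> q ` box x}" "c' \<in> {ch x |x. x \<in> vecs d \<and> p \<in> q ` box x}"
    and i: "i < d" and j: "j < d"
  then obtain x y z where x: "c = ch x" "x \<in> vecs d" and y: "c' = ch y" "y \<in> vecs d" and "p \<in> q ` box y"
    and z: "p = q z" "z \<in> box x" by auto
  then obtain h where h: "h \<in> H" "h \<otimes> z \<in> box y"
    using q_mem_chart box_vecs by blast
  have "(\<Sum>k<d. jac c c' (\<lambda>p. p) p k i * jac c c' (\<lambda>p. p) p k j) =
     (\<Sum>k<d. (if P (\<theta> h) k = i then 1 else 0) * (if P (\<theta> h) k = j then 1 else 0))"
    using jac_chart[OF z(2) h x(2) y(2)] i j unfolding x y z by (intro sum.cong) auto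
  then show "delta_metric c p i j = (\<Sum>k<d. jac c c' (\<lambda>p. p) p k i * jac c c' (\<lambda>p. p) p k j)"
    using sum_permuted_delta[of "\<theta> h" i j] h i by (simp add: delta_metric_def)
qed

lemma riemannian_metric_N: "riemannian_metric N delta_metric"
  by (rule riemannian_metric_deltaI[OF _ preserves_metric_N]) (auto simp: snd_ch_image simp flip: fst_ch)

lemma smooth_map_q: "smooth_map (euclidean_manifold d) N q"
  unfolding smooth_map_def N_sel euclidean_manifold_sel
proof (intro conjI ballI allI impI continuous_map_q)
  fix c :: "(nat \<Rightarrow> real) chart" and c' i assume c: "c \<in> {(vecs d, \<lambda>x. x)}" and "c' \<in> ch ` vecs d" and i: "i < d"
  then obtain y where y: "y \<in> vecs d" "c' = ch y" by auto
  have "snd c ` (fst c \<inter> q -` fst c') = {z \<in> vecs d. q z \<in> q ` box y}"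
    using c unfolding y fst_ch by auto
  then show "smooth_on d (snd c ` (fst c \<inter> q -` fst c')) (\<lambda>z. snd c' (q (chart_inv c z)) i)"
    using locally_elementary_chart[of "vecs d" "\<lambda>z. q (chart_inv c z)" y i] i y c
      openin_topspace[of "Euclidean_space d"]
    by (simp add: smooth_on_locally_elementary)
qed

lemma preserves_metric_q: "preserves_metric (euclidean_manifold d) delta_metric N delta_metric q"
  unfolding preserves_metric_def N_sel charts_at_N sum_delta_metric
proof (intro ballI allI impI)
  fix z c c' i j
  assume "z \<in> topspace (mfd_top (euclidean_manifold d))" "c \<in> charts_at (euclidean_manifold d) z"
    "c' \<in> {ch x |x. x \<in> vecs d \<and> q z \<in> q ` box x}"
    and i: "i < mfd_dim (euclidean_manifold d)" and j: "j < mfd_dim (euclidean_manifold d)"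
  then obtain y where c: "c = (vecs d, \<lambda>x. x)" and z: "z \<in> vecs d" and y: "c' = ch y" "y \<in> vecs d"
    "q z \<in> q ` box y"
    by (auto simp: charts_at_def)
  then obtain h where h: "h \<in> H" "h \<otimes> z \<in> box y"
    using q_mem_chart by blast
  have "(\<Sum>k<d. jac c c' q z k i * jac c c' q z k j) =
     (\<Sum>k<d. (if P (\<theta> h) k = i then 1 else 0) * (if P (\<theta> h) k = j then 1 else 0))"
    using jac_q[OF z h y(2)] i j unfolding c y by (intro sum.cong) auto
  then show "delta_metric c z i j = (\<Sum>k<d. jac c c' q z k i * jac c c' q z k j)"
    using sum_permuted_delta[of "\<theta> h" i j] h i by (simp add: delta_metric_def)
qed

text \<open>Discreteness: a lattice element \<open>k\<close> is the image of the point
  \<open>h\<close> under \<open>k \<otimes> inv h\<close>, so \<open>separated_eq\<close> leaves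
  only \<open>h\<close> itself in \<open>box h\<close>. Compactness: by \<open>cobounded\<close> the
  closed unit cube maps onto the quotient.\<close>

lemma lattice_H: "lattice_in G (Euclidean_space d) H"
  unfolding lattice_in_def
proof (intro conjI)
  show "subgroup H G" by (rule subgroup_H)
  have "openin (subtopology (Euclidean_space d) H) {h}" if h: "h \<in> H" for h
  proof -
    have "H \<inter> box h \<subseteq> {h}"
    proof
      fix k assume k: "k \<in> H \<inter> box h"
      have e: "(k \<otimes> inv h) \<otimes> h = k"
        using k h H_vecs[of h] H_vecs[of k] H_vecs[of "inv h"] by (simp add: m_assoc carrier_G)
      then have "k \<otimes> inv h = \<one>"
        using separated_eq[of "k \<otimes> inv h" h h] h H_vecs[of h] k by simp
      with e have "k = h"
        using H_vecs[OF h] by simp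
      then show "k \<in> {h}" by simp
    qed
    moreover have "h \<in> box h"
      using H_vecs[OF h] by simp
    ultimately have "{h} = box h \<inter> H"
      using h by blast
    then show ?thesis
      using openin_subtopology[of "Euclidean_space d" H "{h}"] openin_cube by blast
  qed
  moreover have "topspace (subtopology (Euclidean_space d) H) = H"
    using H_vecs by auto
  ultimately show "subtopology (Euclidean_space d) H = discrete_topology H"
    by (metis discrete_topology_unique)
  have "q ` {x \<in> vecs d. \<forall>i<d. x i \<in> {0..1}} = topspace (mfd_top N)"
  proof -
    have "q x \<in> q ` {x \<in> vecs d. \<forall>i<d. x i \<in> {0..1}}" if x: "x \<in> vecs d" for x
    proof -
      obtain h where "h \<in> H" "\<forall>i<d. (h \<otimes> x) i \<in> {0..1}"
        using cobounded[OF x] by blast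
      then show ?thesis
        using x by (intro rev_image_eqI[of "h \<otimes> x"]) (auto simp: q_act)
    qed
    then show ?thesis unfolding topspace_N by auto
  qed
  then have "compact_space (mfd_top N)"
    using image_compactin[OF compactin_closed_cube continuous_map_q] by (simp add: compact_space_def)
  then show "compact_space (coset_topology G (Euclidean_space d) H)"
    by (simp add: N_def)
qed

end

section \<open>Holonomy of the quotient\<close>

text \<open>Every summand contains derivatives of constant components. Parallel fields are thus
  those whose chart components have derivative 0.\<close>

lemma christoffel_delta [simp]: "christoffel M delta_metric c p k i j = 0"
  by (simp add: christoffel_def cpartial_def partial_def delta_metric_def)

lemma flat_delta: "flat_metric M delta_metric"
  by (simp add: flat_metric_def curvature_def cpartial_def partial_def)

text \<open>The derivative of an affine germ is again an affine germ, with slope 0, so the induction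
  runs over all \<open>a\<close> and \<open>b\<close>. It serves for the chart coordinates of
  projected line segments.\<close>

lemma differentiable_higher_deriv_affine:
  fixes f :: "real \<Rightarrow> real"
  assumes "\<forall>\<^sub>F s in nhds t. f s = a + b * s"
  shows "((deriv ^^ k) f) differentiable (at t)"
  using assms
proof (induction k arbitrary: f a b)
  case 0
  have "((\<lambda>s. a + b * s) has_real_derivative b) (at t)"
    by (auto intro!: derivative_eq_intros)
  then have "(f has_real_derivative b) (at t)"
    using DERIV_cong_ev[OF refl 0 refl] by simp
  then show ?case using real_differentiable_def by auto
next
  case (Suc k)
  have "((\<lambda>s. a + b * s) has_real_derivative b) (at s)" for s
    by (auto intro!: derivative_eq_intros)
  then have "deriv (\<lambda>s. a + b * s) s = b" for s
    by (rule DERIV_imp_deriv)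
  moreover have "\<forall>\<^sub>F s in nhds t. deriv f s = deriv (\<lambda>s. a + b * s) s"
    using Suc.prems[THEN eventually_eventually[THEN iffD2]]
    by (rule eventually_mono) (rule deriv_cong_ev[OF _ refl])
  ultimately have "\<forall>\<^sub>F s in nhds t. deriv f s = b + 0 * s"
    by simp
  from Suc.IH[OF this] show ?case
    by (simp add: funpow_swap1)
qed

lemma eventually_curve_mem:
  fixes y :: "real \<Rightarrow> nat \<Rightarrow> real"
  assumes y: "continuous_on S y" "\<And>s. s \<in> S \<Longrightarrow> y s \<in> vecs n"
    and W: "openin (Euclidean_space n) W" "t \<in> S" "y t \<in> W"
  shows "\<forall>\<^sub>F s in at t within S. y s \<in> W"
proof -
  obtain O' where O: "open O'" "W = vecs n \<inter> O'"
    using W by (auto simp: Euclidean_space_eq openin_open)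
  have "(y \<longlongrightarrow> y t) (at t within S)"
    using y(1) W(2) by (auto simp: continuous_on_def)
  then have "\<forall>\<^sub>F s in at t within S. y s \<in> O'"
    using O W(3) by (auto dest: topological_tendstoD)
  moreover have "\<forall>\<^sub>F s in at t within S. s \<in> S"
    by (simp add: eventually_at_filter)
  ultimately show ?thesis
    by eventually_elim (use O y(2) in auto)
qed

section \<open>Tangent vectors of the quotient, described at a point of the orbit\<close>

context crystallographic
begin

text \<open>The image under the differential of \<open>q\<close> at \<open>x\<close> of the vector \<open>u\<close>.\<close>

definition push :: "(nat \<Rightarrow> real) \<Rightarrow> (nat \<Rightarrow> real) \<Rightarrow> (nat \<Rightarrow> real) set tangent" where
  "push x u = (\<lambda>c\<in>charts_at N (q x). u \<circ> P (\<theta> (SOME h. h \<in> H \<and> h \<otimes> x \<in> snd c ` fst c)))"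

lemma act_inj:
  assumes "h \<in> H" "k \<in> H" "x \<in> vecs d" "h \<otimes> x = k \<otimes> x"
  shows "h = k"
  using assms right_cancel[of x h k] H_vecs[of h] H_vecs[of k] by (simp add: carrier_G)

text \<open>The choice in \<open>push\<close> is unambiguous: the translate of \<open>x\<close> in
  the box is unique, and so is the lattice element, by cancellation.\<close>

lemma push_chart:
  assumes "x \<in> vecs d" "y \<in> vecs d" "h \<in> H" "h \<otimes> x \<in> box y"
  shows "push x u (ch y) = u \<circ> P (\<theta> h)"
proof -
  have "(SOME h. h \<in> H \<and> h \<otimes> x \<in> box y) = h"
  proof (rule some_equality)
    fix k assume "k \<in> H \<and> k \<otimes> x \<in> box y"
    then show "k = h"
      using act_inj[of k h x] chart_q_act[of k x y] chart_q_act[of h x y] assms by simp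
  qed (use assms in auto)
  moreover have "ch y \<in> charts_at N (q x)"
    using assms q_mem_chart by (auto simp: charts_at_N)
  ultimately show ?thesis
    by (simp add: push_def snd_ch_image del: fst_ch)
qed

lemma push_centre [simp]: "x \<in> vecs d \<Longrightarrow> push x u (ch x) = u"
  using push_chart[of x x \<one> u] by (simp add: fun_eq_iff)

lemma perm_vecs: "u \<in> vecs d \<Longrightarrow> a \<in> carrier A \<Longrightarrow> u \<circ> P a \<in> vecs d"
  using permutes_not_in[OF P_permutes] by (auto simp: vecs_def)

lemma sum_perm:
  assumes "a \<in> carrier A" "k < d"
  shows "(\<Sum>j<d. (if P a k = j then 1 else 0) * u j) = (u (P a k) :: real)"
proof -
  have "(\<Sum>j<d. (if P a k = j then 1 else 0) * u j) = (\<Sum>j<d. if j = P a k then u j else 0)"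
    by (rule sum.cong) auto
  then show ?thesis using P_lt[OF assms] by simp
qed

lemma charts_at_q:
  assumes "c \<in> charts_at N (q x)" "x \<in> vecs d"
  obtains y h where "c = ch y" "y \<in> vecs d" "h \<in> H" "h \<otimes> x \<in> box y"
proof -
  obtain y where y: "c = ch y" "y \<in> vecs d" "q x \<in> q ` box y"
    using assms(1) unfolding charts_at_N by blast
  then show ?thesis using that q_mem_chart[OF assms(2)] by blast
qed

text \<open>The transition from the chart around \<open>h \<otimes> x\<close> to the chart around
  \<open>k \<otimes> x\<close> is the action of \<open>k \<otimes> inv h\<close>, so its permutation
  turns the component for \<open>h\<close> into the one for \<open>k\<close>.\<close>

lemma tangent_push:
  assumes "x \<in> vecs d" "u \<in> vecs d"
  shows "push x u \<in> tangent_space N (q x)"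
  unfolding tangent_space_def N_sel topspace_Euclidean_space_vecs
proof (intro CollectI conjI ballI allI impI)
  show "push x u \<in> charts_at N (q x) \<rightarrow>\<^sub>E vecs d"
  proof (rule PiE_I)
    fix c assume "c \<in> charts_at N (q x)"
    then obtain y h where "c = ch y" "y \<in> vecs d" "h \<in> H" "h \<otimes> x \<in> box y"
      using assms(1) by (rule charts_at_q)
    then show "push x u c \<in> vecs d"
      using push_chart[of x y h u] perm_vecs assms by simp
  qed (simp add: push_def)
  fix c c' i assume "c \<in> charts_at N (q x)" "c' \<in> charts_at N (q x)" and i: "i < d"
  then obtain y h z k where y: "c = ch y" "y \<in> vecs d" "h \<in> H" "h \<otimes> x \<in> box y"
    and z: "c' = ch z" "z \<in> vecs d" "k \<in> H" "k \<otimes> x \<in> box z"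
    using assms(1) charts_at_q by metis
  have g: "k \<otimes> inv h \<in> H" "(k \<otimes> inv h) \<otimes> (h \<otimes> x) \<in> box z"
    using y z assms by (simp_all add: H_assoc)
  have "(\<Sum>j<d. jac c c' (\<lambda>q. q) (q x) i j * push x u c j) =
      (\<Sum>j<d. (if P (\<theta> (k \<otimes> inv h)) i = j then 1 else 0) * (u \<circ> P (\<theta> h)) j)"
    using jac_chart[OF y(4) g y(2) z(2) _ i] y z assms
    by (intro sum.cong) (auto simp: push_chart q_act)
  also have "\<dots> = u (P (\<theta> h) (P (\<theta> (k \<otimes> inv h)) i))"
    using sum_perm[of "\<theta> (k \<otimes> inv h)" i "u \<circ> P (\<theta> h)"] g i by simp
  also have "P (\<theta> h) (P (\<theta> (k \<otimes> inv h)) i) = P (\<theta> h \<otimes>\<^bsub>A\<^esub> \<theta> (k \<otimes> inv h)) i"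
    using P_mult[of "\<theta> h" "\<theta> (k \<otimes> inv h)"] g y by simp
  \<comment> \<open>Components are permuted by precomposition, which yields the factors in the
    reverse order; commutativity of A restores it.\<close>
  also have "\<theta> h \<otimes>\<^bsub>A\<^esub> \<theta> (k \<otimes> inv h) = \<theta> (k \<otimes> inv h \<otimes> h)"
    using A.m_comm[of "\<theta> h" "\<theta> (k \<otimes> inv h)"] g y \<theta>_mult by simp
  also have "k \<otimes> inv h \<otimes> h = k"
    using H_assoc[of k "inv h" h] y z H_vecs[of h] H_vecs[of k] by (simp add: carrier_G)
  finally show "push x u c' i = (\<Sum>j<d. jac c c' (\<lambda>q. q) (q x) i j * push x u c j)"
    using push_chart[of x z k u] z assms by simp
qed

lemma ch_charts_at: "x \<in> vecs d \<Longrightarrow> ch x \<in> charts_at N (q x)"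
  unfolding charts_at_N by auto

lemma tangent_component:
  assumes "v \<in> tangent_space N (q x)" "x \<in> vecs d"
  shows "v (ch x) \<in> vecs d"
  using assms ch_charts_at unfolding tangent_space_def N_sel topspace_Euclidean_space_vecs by blast

text \<open>The transformation law determines a tangent vector from its component in the chart
  centred at \<open>x\<close>. Together with \<open>tangent_push\<close> this identifies the tangent
  space with \<open>vecs d\<close>.\<close>

lemma push_component:
  assumes v: "v \<in> tangent_space N (q x)" and x: "x \<in> vecs d"
  shows "push x (v (ch x)) = v"
proof (rule extensionalityI[of _ "charts_at N (q x)"])
  show "v \<in> extensional (charts_at N (q x))"
    using v by (auto simp: tangent_space_def PiE_def)
  fix c assume c: "c \<in> charts_at N (q x)"
  then obtain y h where y: "c = ch y" "y \<in> vecs d" "h \<in> H" "h \<otimes> x \<in> box y"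
    using x by (rule charts_at_q)
  have "v c i = (v (ch x) \<circ> P (\<theta> h)) i" if i: "i < d" for i
  proof -
    have "v c i = (\<Sum>j<d. jac (ch x) c (\<lambda>q. q) (q x) i j * v (ch x) j)"
      using v c ch_charts_at[OF x] i unfolding tangent_space_def N_sel by blast
    also have "\<dots> = (\<Sum>j<d. (if P (\<theta> h) i = j then 1 else 0) * v (ch x) j)"
      using jac_chart[of x x h y _ i] y x i by (intro sum.cong) auto
    finally show ?thesis
      using sum_perm[of "\<theta> h" i "v (ch x)"] y i by simp
  qed
  moreover have "v c \<in> vecs d"
    using v c unfolding tangent_space_def N_sel topspace_Euclidean_space_vecs by blast
  moreover have "v (ch x) \<circ> P (\<theta> h) \<in> vecs d"
    using perm_vecs tangent_component[OF v x] y by simp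
  ultimately have "v c = v (ch x) \<circ> P (\<theta> h)"
    using vecs_eqI by metis
  then show "push x (v (ch x)) c = v c"
    using push_chart[of x y h] y x by simp
qed (simp add: push_def)

text \<open>The source of the holonomy. Since \<open>q\<close> is invariant under \<open>h\<close>,
  its differential at \<open>h \<otimes> x\<close> is the one at \<open>x\<close> after the inverse
  of the linear part of \<open>h\<close>, and this linear part is precomposition with
  \<open>P (\<theta> h)\<close>.\<close>

lemma push_act:
  assumes "x \<in> vecs d" "h \<in> H"
  shows "push (h \<otimes> x) u = push x (u \<circ> P (inv\<^bsub>A\<^esub> \<theta> h))"
proof (rule extensionalityI[of _ "charts_at N (q x)"])
  show "push (h \<otimes> x) u \<in> extensional (charts_at N (q x))"
    using assms by (simp add: push_def q_act)
  fix c assume "c \<in> charts_at N (q x)"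
  then obtain y k where y: "c = ch y" "y \<in> vecs d" "k \<in> H" "k \<otimes> x \<in> box y"
    using assms(1) by (rule charts_at_q)
  have "(k \<otimes> inv h) \<otimes> (h \<otimes> x) \<in> box y"
    using y assms by (simp add: H_assoc)
  then have "push (h \<otimes> x) u c = u \<circ> P (\<theta> (k \<otimes> inv h))"
    using push_chart[of "h \<otimes> x" y "k \<otimes> inv h" u] y assms by simp
  also have "\<theta> (k \<otimes> inv h) = inv\<^bsub>A\<^esub> \<theta> h \<otimes>\<^bsub>A\<^esub> \<theta> k"
    using y assms by (simp add: \<theta>_mult \<theta>_inv A.m_comm)
  also have "P \<dots> = P (inv\<^bsub>A\<^esub> \<theta> h) \<circ> P (\<theta> k)"
    using y assms by (simp add: P_mult)
  also have "u \<circ> \<dots> = push x (u \<circ> P (inv\<^bsub>A\<^esub> \<theta> h)) c"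
    using push_chart[of x y k] y assms by (simp add: o_assoc)
  finally show "push (h \<otimes> x) u c = push x (u \<circ> P (inv\<^bsub>A\<^esub> \<theta> h)) c" .
qed (simp add: push_def)

lemma chart_near:
  assumes "y \<in> vecs d" "c \<in> charts_at N (q y)"
  obtains W h z where "openin (Euclidean_space d) W" "y \<in> W" "h \<in> H" "c = ch z" "z \<in> vecs d"
    "\<And>w. w \<in> W \<Longrightarrow> h \<otimes> w \<in> box z"
proof -
  obtain z h where z: "c = ch z" "z \<in> vecs d" "h \<in> H" "h \<otimes> y \<in> box z"
    using assms(2,1) by (rule charts_at_q)
  show ?thesis
    by (rule that[of "box (inv h \<otimes> z)" h z])
      (use z assms(1) chart_comp_local[OF z(3,2)] in auto)
qed

section \<open>Parallel transport along a curve with a continuous lift\<close>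

context
  fixes y :: "real \<Rightarrow> nat \<Rightarrow> real" and \<gamma> :: "real \<Rightarrow> (nat \<Rightarrow> real) set"
  assumes cont: "continuous_on {0..1} y" and y_vecs: "\<And>t. t \<in> {0..1} \<Longrightarrow> y t \<in> vecs d"
    and lift: "\<And>t. t \<in> {0..1} \<Longrightarrow> \<gamma> t = q (y t)"
begin

text \<open>Near any time a single lattice element carries the lift into the box of a given chart,
  so the component in that chart is locally constant.\<close>

lemma parallel_push:
  assumes u: "u \<in> vecs d"
  shows "parallel_along N delta_metric \<gamma> (\<lambda>t. push (y t) u)"
  unfolding parallel_along_def christoffel_delta
\<comment> \<open>The end points are excepted because two-sided derivatives there would involve
  \<open>y\<close> outside the unit interval.\<close>
proof (intro conjI ballI allI impI exI[of _ "{0, 1}"])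
  show "push (y t) u \<in> tangent_space N (\<gamma> t)" if "t \<in> {0..1}" for t
    using that by (simp add: lift y_vecs u tangent_push)
  have *: "\<forall>\<^sub>F s in at t within {0..1}. push (y s) u c k = push (y t) u c k"
    if t: "t \<in> {0..1}" and c: "c \<in> charts_at N (\<gamma> t)" for t c k
  proof -
    obtain W h z where W: "openin (Euclidean_space d) W" "y t \<in> W" "h \<in> H" "c = ch z" "z \<in> vecs d"
      "\<And>w. w \<in> W \<Longrightarrow> h \<otimes> w \<in> box z"
      using chart_near[of "y t" c] y_vecs t c lift by metis
    have eq: "push w u c = u \<circ> P (\<theta> h)" if "w \<in> W" for w
      using push_chart[of w z h u] W that openin_subset[OF W(1)] by auto
    have "\<forall>\<^sub>F s in at t within {0..1}. y s \<in> W"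
      using eventually_curve_mem[OF cont y_vecs W(1) t W(2)] by blast
    then show ?thesis
      by (rule eventually_mono) (simp add: eq W(2))
  qed
  show "((\<lambda>s. push (y s) u c k) \<longlongrightarrow> push (y t) u c k) (at t within {0..1})"
    if "t \<in> {0..1}" "c \<in> charts_at N (\<gamma> t)" for t c k
    using *[OF that, of k] by (rule tendsto_eventually)
  show "((\<lambda>s. push (y s) u c k) has_real_derivative
      - (\<Sum>i<mfd_dim N. \<Sum>j<mfd_dim N. 0 * deriv (\<lambda>s. snd c (\<gamma> s) i) t * push (y t) u c j)) (at t)"
    if t: "t \<in> {0..1} - {0, 1}" and c: "c \<in> charts_at N (\<gamma> t)" for t c k
  proof -
    have "at t within {0..1} = at t"
      using t by (intro at_within_interior) auto
    then have "\<forall>\<^sub>F s in nhds t. push (y s) u c k = push (y t) u c k"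
      using *[of t c k] t c by (auto simp: eventually_at_filter elim: eventually_mono)
    then show ?thesis
      using DERIV_cong_ev[OF refl _ refl, where g = "\<lambda>s. push (y t) u c k" and x = t] by simp
  qed
qed simp

text \<open>The field is observed in the moving chart centred at the lift. The charts centred at
  nearby points of the lift have the identity as transition there, so the observed vector is
  continuous with derivative 0 off a finite set, hence constant.\<close>

lemma parallel_unique:
  assumes par: "parallel_along N delta_metric \<gamma> W" and W0: "W 0 = push (y 0) u"
  shows "W 1 = push (y 1) u"
proof -
  obtain S where S: "finite S" "\<forall>t\<in>{0..1} - S. \<forall>c\<in>charts_at N (\<gamma> t). \<forall>k<d.
      ((\<lambda>s. W s c k) has_real_derivative 0) (at t)"
    using par unfolding parallel_along_def christoffel_delta N_sel by auto
  have W: "W t \<in> tangent_space N (q (y t))" if "t \<in> {0..1}" for t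
    using par that unfolding parallel_along_def by (simp add: lift)
  have lim: "((\<lambda>s. W s c k) \<longlongrightarrow> W t c k) (at t within {0..1})"
    if "t \<in> {0..1}" "c \<in> charts_at N (q (y t))" "k < d" for t c k
    using par that unfolding parallel_along_def by (simp add: lift)
  have near: "\<forall>\<^sub>F s in at t within {0..1}. W s (ch (y s)) = W s (ch (y t))" if t: "t \<in> {0..1}" for t
  proof -
    have "\<forall>\<^sub>F s in at t within {0..1}. y s \<in> box (y t)"
      using eventually_curve_mem[OF cont y_vecs openin_cube t] y_vecs t by simp
    moreover have "\<forall>\<^sub>F s in at t within {0..1}. s \<in> {0..1}"
      by (simp add: eventually_at_filter)
    ultimately show ?thesis
    proof eventually_elim
      case (elim s)
      \<comment> \<open>\<open>y s\<close> itself lies in the box around \<open>y t\<close>, so the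
        lattice element is the unit and nothing is permuted.\<close>
      have "push (y s) (W s (ch (y s))) (ch (y t)) = W s (ch (y s)) \<circ> P (\<theta> \<one>)"
        using elim y_vecs t by (intro push_chart) auto
      also have "push (y s) (W s (ch (y s))) = W s"
        using push_component W y_vecs elim by blast
      finally show ?case by (simp add: o_def)
    qed
  qed
  have "W 1 (ch (y 1)) k = W 0 (ch (y 0)) k" if k: "k < d" for k
  proof (rule has_derivative_zero_unique_strong_interval[where f = "\<lambda>t. W t (ch (y t)) k"])
    show "finite (S \<union> {0, 1})" using S by simp
    show "continuous_on {0..1} (\<lambda>t. W t (ch (y t)) k)"
      unfolding continuous_on_def
    proof
      fix t :: real assume t: "t \<in> {0..1}"
      have "((\<lambda>s. W s (ch (y t)) k) \<longlongrightarrow> W t (ch (y t)) k) (at t within {0..1})"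
        using lim[OF t ch_charts_at k] y_vecs t by blast
      then show "((\<lambda>s. W s (ch (y s)) k) \<longlongrightarrow> W t (ch (y t)) k) (at t within {0..1})"
        by (rule Lim_transform_eventually) (use near[OF t] in eventually_elim, simp)
    qed
    fix t :: real assume t: "t \<in> {0..1} - (S \<union> {0, 1})"
    have "at t within {0..1} = at t"
      using t by (intro at_within_interior) auto
    then have ev: "\<forall>\<^sub>F s in nhds t. W s (ch (y s)) k = W s (ch (y t)) k"
      using near[of t] t by (auto simp: eventually_at_filter elim: eventually_mono)
    have "((\<lambda>s. W s (ch (y t)) k) has_real_derivative 0) (at t)"
      using S(2) t k ch_charts_at[of "y t"] y_vecs[of t] lift[of t] by auto
    then have "((\<lambda>s. W s (ch (y s)) k) has_real_derivative 0) (at t)"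
      by (rule DERIV_cong_ev[OF refl ev refl, THEN iffD2])
    then show "((\<lambda>s. W s (ch (y s)) k) has_derivative (\<lambda>h. 0)) (at t within {0..1})"
      by (auto simp: has_field_derivative_def lambda_zero intro: has_derivative_at_withinI)
  qed auto
  then have "W 1 (ch (y 1)) = W 0 (ch (y 0))"
    using vecs_eqI[of _ d] tangent_component[OF W y_vecs] by simp
  also have "\<dots> = u"
    using W0 y_vecs by simp
  finally show ?thesis
    using push_component[of "W 1" "y 1"] W[of 1] y_vecs[of 1] by simp
qed

text \<open>\<open>parallel_push\<close> and \<open>parallel_unique\<close> give existence and
  uniqueness for the definite description. The result depends only on the end points of the
  lift.\<close>

lemma parallel_transport_lift:
  "parallel_transport N delta_metric \<gamma> = (\<lambda>v\<in>tangent_space N (q (y 0)). push (y 1) (v (ch (y 0))))"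
  unfolding parallel_transport_def lift[of 0, simplified]
proof (rule restrict_ext)
  fix v assume v: "v \<in> tangent_space N (q (y 0))"
  have y0: "y 0 \<in> vecs d" by (simp add: y_vecs)
  show "(THE w. \<exists>V. parallel_along N delta_metric \<gamma> V \<and> V 0 = v \<and> V 1 = w) = push (y 1) (v (ch (y 0)))"
  proof (rule the_equality)
    show "\<exists>V. parallel_along N delta_metric \<gamma> V \<and> V 0 = v \<and> V 1 = push (y 1) (v (ch (y 0)))"
      using parallel_push[OF tangent_component[OF v y0]] push_component[OF v y0] by blast
    show "w = push (y 1) (v (ch (y 0)))"
      if "\<exists>V. parallel_along N delta_metric \<gamma> V \<and> V 0 = v \<and> V 1 = w" for w
      using that parallel_unique push_component[OF v y0] by metis
  qed
qed

end

text \<open>The candidate for the holonomy transformation of \<open>a\<close>. Restriction to the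
  tangent space is the extensional form in which \<open>parallel_transport\<close> and
  \<open>BijGroup\<close> keep their maps.\<close>

definition tau :: "(nat \<Rightarrow> real) \<Rightarrow> 'a \<Rightarrow> (nat \<Rightarrow> real) set tangent \<Rightarrow> (nat \<Rightarrow> real) set tangent" where
  "tau x a = (\<lambda>v\<in>tangent_space N (q x). push x (v (ch x) \<circ> P a))"

lemma tau_closed:
  assumes "x \<in> vecs d" "a \<in> carrier A" "v \<in> tangent_space N (q x)"
  shows "tau x a v \<in> tangent_space N (q x)"
  using assms tangent_push perm_vecs tangent_component by (simp add: tau_def)

lemma tau_tau:
  assumes "x \<in> vecs d" "a \<in> carrier A" "b \<in> carrier A" "v \<in> tangent_space N (q x)"
  shows "tau x a (tau x b v) = tau x (a \<otimes>\<^bsub>A\<^esub> b) v"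
  using tau_closed[OF assms(1,3,4)] assms A.m_comm[of a b]
  by (simp add: tau_def P_mult o_assoc)

lemma tau_one: "x \<in> vecs d \<Longrightarrow> v \<in> tangent_space N (q x) \<Longrightarrow> tau x \<one>\<^bsub>A\<^esub> v = v"
  using push_component by (simp add: tau_def o_def)

lemma tau_Bij:
  assumes "x \<in> vecs d" "a \<in> carrier A"
  shows "tau x a \<in> Bij (tangent_space N (q x))"
proof -
  have "bij_betw (tau x a) (tangent_space N (q x)) (tangent_space N (q x))"
    using assms tau_closed tau_tau tau_one
    by (intro bij_betw_byWitness[where f' = "tau x (inv\<^bsub>A\<^esub> a)"]) auto
  then show ?thesis
    by (simp add: Bij_def tau_def)
qed

lemma tau_inj:
  assumes "x \<in> vecs d" "a \<in> carrier A" "b \<in> carrier A" "tau x a = tau x b"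
  shows "a = b"
proof -
  \<comment> \<open>A vector with pairwise distinct entries below d, from which a permutation of
    these entries can be read off.\<close>
  define u :: "nat \<Rightarrow> real" where "u = (\<lambda>i. if i < d then real i + 1 else 0)"
  have u: "u \<in> vecs d" by (simp add: u_def vecs_def)
  have "tau x c (push x u) (ch x) = u \<circ> P c" if "c \<in> carrier A" for c
    using tangent_push[OF assms(1) u] assms(1) by (simp add: tau_def)
  then have e: "u \<circ> P a = u \<circ> P b"
    using assms by metis
  have "P a i = P b i" for i
  proof (cases "i < d")
    case True
    then have "P a i < d" "P b i < d" using P_lt assms by auto
    then show ?thesis using fun_cong[OF e, of i] by (simp add: u_def)
  next
    case False
    then show ?thesis
      using permutes_not_in[OF P_permutes[OF assms(2)], of i] permutes_not_in[OF P_permutes[OF assms(3)], of i] by simp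
  qed
  then show ?thesis
    using P_inj assms(2,3) by (auto dest: inj_onD)
qed

section \<open>Lifting of paths: within one chart, then by bisection\<close>

lemma local_lift:
  fixes a b :: real
  assumes "continuous_map (top_of_set {a..b}) (mfd_top N) \<gamma>" "z \<in> vecs d"
    and g: "\<And>t. t \<in> {a..b} \<Longrightarrow> \<gamma> t \<in> q ` box z" and x: "x \<in> vecs d" "q x = \<gamma> a" and ab: "a \<le> b"
  shows "\<exists>y. continuous_on {a..b} y \<and> (\<forall>t\<in>{a..b}. y t \<in> vecs d \<and> q (y t) = \<gamma> t) \<and> y a = x"
proof -
  define s where "s t = snd (ch z) (\<gamma> t)" for t
  have s: "s t \<in> box z" "q (s t) = \<gamma> t" if t: "t \<in> {a..b}" for t
  proof -
    obtain w where "w \<in> box z" "\<gamma> t = q w" using g[OF t] by blast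
    then show "s t \<in> box z" "q (s t) = \<gamma> t" by (simp_all add: s_def chart_q)
  qed
  have "continuous_map (subtopology (mfd_top N) (q ` box z)) (Euclidean_space d) (snd (ch z))"
    using homeomorphic_chart[of z] by (auto simp: homeomorphic_maps_def continuous_map_in_subtopology)
  moreover have "continuous_map (top_of_set {a..b}) (subtopology (mfd_top N) (q ` box z)) \<gamma>"
    using assms(1) g by (auto simp: continuous_map_in_subtopology)
  ultimately have "continuous_map (top_of_set {a..b}) (Euclidean_space d) (snd (ch z) \<circ> \<gamma>)"
    by (rule continuous_map_compose[rotated])
  then have "continuous_map (top_of_set {a..b}) euclidean (snd (ch z) \<circ> \<gamma>)"
    unfolding Euclidean_space_eq continuous_map_in_subtopology by blast
  then have cont: "continuous_on {a..b} s"
    by (simp add: s_def[abs_def] o_def)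
  \<comment> \<open>The chart coordinate \<open>s\<close> is already a lift; a lattice element moves
    its initial point to the prescribed \<open>x\<close>.\<close>
  obtain h where h: "h \<in> H" "x = h \<otimes> s a"
  proof -
    have "q (s a) = q x" using s(2)[of a] x(2) ab by simp
    from q_eqD[OF this x(1)] show ?thesis using that by blast
  qed
  have sd: "s t \<in> vecs d" if "t \<in> {a..b}" for t
    using s(1)[OF that] by (rule box_vecs)
  have "continuous_on {a..b} (\<lambda>t. h \<otimes> s t)"
  proof (rule continuous_on_coordinatewise_then_product)
    fix i
    show "continuous_on {a..b} (\<lambda>t. (h \<otimes> s t) i)"
    proof (cases "i < d")
      case True
      have "continuous_on {a..b} (\<lambda>t. h i + s t (P (\<theta> h) i))"
        by (intro continuous_intros continuous_on_product_then_coordinatewise[OF cont])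
      then show ?thesis
        by (rule continuous_on_eq) (simp add: act[OF h(1) sd True])
    next
      case False
      have z: "(h \<otimes> s t) i = 0" if "t \<in> {a..b}" for t
        using act_vecs[OF h(1) sd[OF that]] False by (simp add: vecs_def)
      show ?thesis
        by (rule continuous_on_eq[where f = "\<lambda>t. 0"]) (simp_all add: z)
    qed
  qed
  then show ?thesis
    using h s(2) sd by (intro exI[of _ "\<lambda>t. h \<otimes> s t"]) (auto simp: q_act)
qed

lemma lift_exists:
  assumes \<gamma>: "pathin (mfd_top N) \<gamma>" and x: "x \<in> vecs d" "\<gamma> 0 = q x"
  shows "\<exists>y. continuous_on {0..1} y \<and> (\<forall>t\<in>{0..1}. y t \<in> vecs d \<and> q (y t) = \<gamma> t) \<and> y 0 = x"
proof -
  \<comment> \<open>Allowing every starting point makes \<open>Q\<close> additive for adjacent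
    intervals, as Bolzano's bisection principle requires. The guard is there because the local
    condition of that principle also speaks of intervals that stick out of
    \<open>{0..1}\<close>.\<close>
  define Q where "Q a b \<longleftrightarrow> ({a..b} \<subseteq> {0..1} \<longrightarrow> (\<forall>x\<in>vecs d. q x = \<gamma> a \<longrightarrow>
      (\<exists>y. continuous_on {a..b} y \<and> (\<forall>t\<in>{a..b}. y t \<in> vecs d \<and> q (y t) = \<gamma> t) \<and> y a = x)))" for a b :: real
  have cont: "continuous_map (top_of_set {0..1}) (mfd_top N) \<gamma>"
    using \<gamma> by (simp add: pathin_def)
  have "Q 0 1"
  proof (rule Bolzano[of 0 1 Q])
    fix a b c assume Q: "Q a b" "Q b c" and ab: "a \<le> b" "b \<le> c"
    show "Q a c"
      unfolding Q_def
    proof (intro impI ballI)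
      fix x assume ac: "{a..c} \<subseteq> {0..1}" and x: "x \<in> vecs d" "q x = \<gamma> a"
      have sub: "{a..b} \<subseteq> {0..1}" "{b..c} \<subseteq> {0..1}" using ac ab by auto
      obtain y1 where y1: "continuous_on {a..b} y1" "\<forall>t\<in>{a..b}. y1 t \<in> vecs d \<and> q (y1 t) = \<gamma> t" "y1 a = x"
        using Q(1) sub x unfolding Q_def by blast
      obtain y2 where y2: "continuous_on {b..c} y2" "\<forall>t\<in>{b..c}. y2 t \<in> vecs d \<and> q (y2 t) = \<gamma> t" "y2 b = y1 b"
        using Q(2) sub y1(2) ab unfolding Q_def by (metis atLeastAtMost_iff order_refl)
      have "continuous_on ({a..b} \<union> {b..c}) (\<lambda>t. if t \<le> b then y1 t else y2 t)"
        by (rule continuous_on_If) (use y1(1) y2(1,3) in auto)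
      moreover have "{a..b} \<union> {b..c} = {a..c}" using ab by auto
      ultimately show "\<exists>y. continuous_on {a..c} y \<and> (\<forall>t\<in>{a..c}. y t \<in> vecs d \<and> q (y t) = \<gamma> t) \<and> y a = x"
        using y1 y2 ab by (intro exI[of _ "\<lambda>t. if t \<le> b then y1 t else y2 t"]) auto
    qed
  next
    fix t :: real assume t: "0 \<le> t" "t \<le> 1"
    then obtain z where z: "z \<in> vecs d" "\<gamma> t = q z"
      using continuous_map_image_subset_topspace[OF cont] unfolding topspace_N by force
    have "openin (top_of_set {0..1}) {s \<in> {0..1}. \<gamma> s \<in> q ` box z}"
      using openin_continuous_map_preimage[OF cont openin_chart[of z]] by simp
    moreover have "t \<in> {s \<in> {0..1}. \<gamma> s \<in> q ` box z}"
      using t z by auto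
    ultimately obtain e where e: "e > 0" "\<And>s. s \<in> {0..1} \<Longrightarrow> dist s t < e \<Longrightarrow> \<gamma> s \<in> q ` box z"
      unfolding openin_euclidean_subtopology_iff by blast
    show "\<exists>e>0. \<forall>a b. a \<le> t \<and> t \<le> b \<and> b - a < e \<longrightarrow> Q a b"
    proof (intro exI[of _ e] conjI allI impI e(1))
      fix a b assume ab: "a \<le> t \<and> t \<le> b \<and> b - a < e"
      show "Q a b"
        unfolding Q_def
      proof (intro impI ballI)
        fix x assume sub: "{a..b} \<subseteq> {0..1}" and x: "x \<in> vecs d" "q x = \<gamma> a"
        have "continuous_map (top_of_set {a..b}) (mfd_top N) \<gamma>"
          using continuous_map_from_subtopology_mono[of euclidean "{0..1}" "mfd_top N" \<gamma> "{a..b}"] cont sub by simp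
        moreover have "\<gamma> s \<in> q ` box z" if "s \<in> {a..b}" for s
          using e(2)[of s] sub that ab by (auto simp: dist_real_def)
        ultimately show "\<exists>y. continuous_on {a..b} y \<and> (\<forall>t\<in>{a..b}. y t \<in> vecs d \<and> q (y t) = \<gamma> t) \<and> y a = x"
          using local_lift[where \<gamma> = \<gamma> and z = z and a = a and b = b and x = x] z(1) x ab by simp
      qed
    qed
  qed simp
  then show ?thesis
    using x by (simp add: Q_def)
qed

lemma holonomy_loop:
  assumes x: "x \<in> vecs d" and \<gamma>: "pathin (mfd_top N) \<gamma>" "\<gamma> 0 = q x" "\<gamma> 1 = q x"
  shows "\<exists>a\<in>carrier A. parallel_transport N delta_metric \<gamma> = tau x a"
proof -
  obtain y where y: "continuous_on {0..1} y" "\<And>t. t \<in> {0..1} \<Longrightarrow> y t \<in> vecs d"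
      "\<And>t. t \<in> {0..1} \<Longrightarrow> \<gamma> t = q (y t)" "y 0 = x"
    using lift_exists[OF \<gamma>(1) x \<gamma>(2)] by metis
  then obtain h where h: "h \<in> H" "y 1 = h \<otimes> x"
    using q_eqD[of x "y 1"] \<gamma>(3) by force
  \<comment> \<open>Rewriting the push from the end point \<open>h \<otimes> x\<close> as a push
    from \<open>x\<close> brings in the inverse, see \<open>push_act\<close>.\<close>
  have "parallel_transport N delta_metric \<gamma> = tau x (inv\<^bsub>A\<^esub> \<theta> h)"
    unfolding parallel_transport_lift[of y, OF y(1-3), simplified] tau_def y(4) h(2) push_act[OF x h(1)] ..
  then show ?thesis
    using h(1) by auto
qed

text \<open>The straight segment from \<open>x\<close> to \<open>h \<otimes> x\<close> projects to a
  loop, and in each chart its coordinates are affine functions of time.\<close>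

lemma holonomy_loop_exists:
  assumes x: "x \<in> vecs d" and a: "a \<in> carrier A"
  shows "\<exists>\<gamma>. piecewise_smooth_path N \<gamma> \<and> \<gamma> 0 = q x \<and> \<gamma> 1 = q x \<and> parallel_transport N delta_metric \<gamma> = tau x a"
proof -
  \<comment> \<open>The inverse compensates for the one in \<open>push_act\<close>.\<close>
  obtain h where h: "h \<in> H" "\<theta> h = inv\<^bsub>A\<^esub> a"
    using \<theta>_image a by (metis A.inv_closed imageE)
  define y where "y t = (\<lambda>i. x i + t * ((h \<otimes> x) i - x i))" for t
  have yd: "y t \<in> vecs d" for t
    using x act_vecs[OF h(1) x] by (auto simp: y_def vecs_def)
  have y01: "y 0 = x" "y 1 = h \<otimes> x"
    by (auto simp: y_def)
  have cont: "continuous_on S y" for S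
    unfolding y_def by (intro continuous_on_coordinatewise_then_product continuous_intros)
  then have "continuous_map (top_of_set S) (Euclidean_space d) y" for S
    using yd by (auto simp: Euclidean_space_eq continuous_map_in_subtopology)
  then have cq: "continuous_map (top_of_set S) (mfd_top N) (\<lambda>t. q (y t))" for S
    using continuous_map_compose[OF _ continuous_map_q] by (fastforce simp: o_def)
  \<comment> \<open>The segment extends to all real times, so 1 serves as the margin
    \<open>e\<close>; the bounds are left in the shape of the definition.\<close>
  have "smooth_curve_on N {0 - 1<..<1 + 1} (\<lambda>t. q (y t))"
    unfolding smooth_curve_on_def
  proof (intro conjI ballI allI impI cq)
    fix t c i k assume c: "c \<in> charts_at N (q (y t))" and i: "i < mfd_dim N"
    obtain W g z where W: "openin (Euclidean_space d) W" "y t \<in> W" "g \<in> H" "c = ch z" "z \<in> vecs d"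
      "\<And>w. w \<in> W \<Longrightarrow> g \<otimes> w \<in> box z"
      using chart_near[OF yd c] by metis
    have "\<forall>\<^sub>F s in at t. y s \<in> W"
      using eventually_curve_mem[OF cont[of UNIV] yd W(1) UNIV_I W(2)] by simp
    then have "\<forall>\<^sub>F s in nhds t. y s \<in> W"
      using W(2) unfolding eventually_at_filter by (auto elim: eventually_mono)
    then have "\<forall>\<^sub>F s in nhds t. snd c (q (y s)) i =
        (g i + x (P (\<theta> g) i)) + ((h \<otimes> x) (P (\<theta> g) i) - x (P (\<theta> g) i)) * s"
    proof eventually_elim
      case (elim s)
      have "snd c (q (y s)) i = (g \<otimes> y s) i"
        using chart_q_act[OF W(3) yd W(6)[OF elim]] W(4) by simp
      also have "\<dots> = g i + y s (P (\<theta> g) i)"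
        using act[OF W(3) yd, of i s] i by simp
      finally show ?case by (simp add: y_def mult.commute)
    qed
    then show "((deriv ^^ k) (\<lambda>s. snd c (q (y s)) i)) differentiable (at t)"
      by (rule differentiable_higher_deriv_affine)
  qed
  then have "piecewise_smooth_path N (\<lambda>t. q (y t))"
    unfolding piecewise_smooth_path_def pathin_def
    using cq by (intro conjI exI[of _ "{0, 1}"]) (auto intro!: exI[of _ "1::real"])
  moreover have "parallel_transport N delta_metric (\<lambda>t. q (y t)) = tau x a"
    unfolding parallel_transport_lift[of y, OF cont yd refl, simplified] tau_def y01 push_act[OF x h(1)]
    using h(2) a by simp
  moreover have "q (y 0) = q x" "q (y 1) = q x"
    using y01 q_act[OF h(1) x] by simp_all
  ultimately show ?thesis by blast
qed

lemma holonomy_iso: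
  assumes "p \<in> topspace (mfd_top N)"
  shows "holonomy_group N delta_metric p \<cong> A"
proof -
  obtain x where x: "x \<in> vecs d" "p = q x"
    using assms unfolding topspace_N by blast
  have car: "carrier (holonomy_group N delta_metric p) = tau x ` carrier A"
  proof (intro equalityI subsetI)
    fix f assume "f \<in> carrier (holonomy_group N delta_metric p)"
    then obtain \<gamma> where "f = parallel_transport N delta_metric \<gamma>" "pathin (mfd_top N) \<gamma>" "\<gamma> 0 = q x" "\<gamma> 1 = q x"
      by (auto simp: holonomy_group_def piecewise_smooth_path_def x(2))
    then show "f \<in> tau x ` carrier A"
      using holonomy_loop[OF x(1)] by blast
  next
    fix f assume "f \<in> tau x ` carrier A"
    then obtain \<gamma> where "piecewise_smooth_path N \<gamma>" "\<gamma> 0 = q x" "\<gamma> 1 = q x" "parallel_transport N delta_metric \<gamma> = f"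
      using holonomy_loop_exists[OF x(1)] by (elim imageE) metis
    then show "f \<in> carrier (holonomy_group N delta_metric p)"
      unfolding holonomy_group_def x(2) by auto
  qed
  have "tau x \<in> iso A (holonomy_group N delta_metric p)"
    unfolding iso_def hom_def
  proof (intro CollectI conjI ballI)
    show "tau x \<in> carrier A \<rightarrow> carrier (holonomy_group N delta_metric p)"
      using car by auto
    show "bij_betw (tau x) (carrier A) (carrier (holonomy_group N delta_metric p))"
      unfolding car using tau_inj[OF x(1)] by (intro inj_on_imp_bij_betw inj_onI)
    fix a b assume ab: "a \<in> carrier A" "b \<in> carrier A"
    have "tau x (a \<otimes>\<^bsub>A\<^esub> b) = compose (tangent_space N p) (tau x a) (tau x b)"
      using tau_tau[OF x(1) ab] unfolding x(2) by (auto simp: compose_def tau_def[of x "a \<otimes>\<^bsub>A\<^esub> b"])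
    then show "tau x (a \<otimes>\<^bsub>A\<^esub> b) = tau x a \<otimes>\<^bsub>holonomy_group N delta_metric p\<^esub> tau x b"
      using tau_Bij[OF x(1)] ab by (simp add: holonomy_group_def BijGroup_def x(2))
  qed
  then show ?thesis
    by (intro A.iso_sym is_isoI)
qed

end

section \<open>Groups of Euclidean isometries\<close>

lemma continuous_map_Euclidean_spaceI:
  assumes "\<And>x. x \<in> topspace X \<Longrightarrow> F x \<in> vecs n"
    and "\<And>i. i < n \<Longrightarrow> continuous_map X euclideanreal (\<lambda>x. F x i)"
  shows "continuous_map X (Euclidean_space n) F"
proof (rule continuous_map_eq)
  show "continuous_map X (Euclidean_space n) (\<lambda>x i. if i < n then F x i else 0)"
    using assms(2) by (simp add: continuous_map_componentwise_Euclidean_space)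
  show "(\<lambda>i. if i < n then F x i else 0) = F x" if "x \<in> topspace X" for x
    using assms(1)[OF that] by (auto simp: vecs_def)
qed

lemma continuous_map_Euclidean_coordinate: "continuous_map (Euclidean_space n) euclideanreal (\<lambda>x. x i)"
  unfolding Euclidean_space_eq
  by (simp add: continuous_on_subset[OF continuous_on_product_coordinates])

lemma continuous_map_elementary:
  assumes "f \<in> elementary" "\<And>i. continuous_map X euclideanreal (\<lambda>x. G x i)"
  shows "continuous_map X euclideanreal (\<lambda>x. f (G x))"
proof -
  have "continuous_map X (product_topology (\<lambda>i. euclideanreal) UNIV) G"
    using assms(2) by (simp add: continuous_map_componentwise_UNIV)
  then have "continuous_map X euclidean G"
    by (simp add: euclidean_product_topology)
  moreover have "continuous_map euclidean euclideanreal f"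
    using continuous_on_elementary[OF assms(1), of UNIV] by simp
  ultimately have "continuous_map X euclideanreal (f \<circ> G)"
    by (rule continuous_map_compose)
  then show ?thesis
    by (simp add: o_def)
qed

definition fst_part :: "nat \<Rightarrow> (nat \<Rightarrow> real) \<Rightarrow> nat \<Rightarrow> real" where
  "fst_part d z = (\<lambda>i. if i < d then z i else 0)"

definition snd_part :: "nat \<Rightarrow> (nat \<Rightarrow> real) \<Rightarrow> nat \<Rightarrow> real" where
  "snd_part d z = (\<lambda>i. if i < d then z (i + d) else 0)"

text \<open>The chart that \<open>prod_manifold\<close> forms from two identity charts;
  \<open>fst_part\<close> and \<open>snd_part\<close> undo it.\<close>

definition pair_chart :: "nat \<Rightarrow> ((nat \<Rightarrow> real) \<times> (nat \<Rightarrow> real)) chart" where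
  "pair_chart d = (vecs d \<times> vecs d, \<lambda>(a, b) i. if i < d then a i else b (i - d))"

lemma parts_vecs [simp]: "fst_part d z \<in> vecs d" "snd_part d z \<in> vecs d"
  by (auto simp: fst_part_def snd_part_def vecs_def)

lemma pair_chart_parts: "z \<in> vecs (d + d) \<Longrightarrow> snd (pair_chart d) (fst_part d z, snd_part d z) = z"
  by (auto simp: pair_chart_def fst_part_def snd_part_def vecs_def fun_eq_iff)

lemma parts_pair_chart:
  assumes "a \<in> vecs d" "b \<in> vecs d"
  shows "fst_part d (snd (pair_chart d) (a, b)) = a" "snd_part d (snd (pair_chart d) (a, b)) = b"
    "snd (pair_chart d) (a, b) \<in> vecs (d + d)"
  using assms by (auto simp: pair_chart_def fst_part_def snd_part_def vecs_def fun_eq_iff)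

lemma chart_inv_pair_chart:
  assumes "z \<in> vecs (d + d)"
  shows "chart_inv (pair_chart d) z = (fst_part d z, snd_part d z)"
proof -
  have "inj_on (snd (pair_chart d)) (fst (pair_chart d))"
  proof (rule inj_onI)
    fix p p' assume p: "p \<in> fst (pair_chart d)" "p' \<in> fst (pair_chart d)"
      and e: "snd (pair_chart d) p = snd (pair_chart d) p'"
    obtain a b a' b' where [simp]: "p = (a, b)" "p' = (a', b')" by (cases p, cases p')
    have "a \<in> vecs d" "b \<in> vecs d" "a' \<in> vecs d" "b' \<in> vecs d"
      using p by (auto simp: pair_chart_def)
    then show "p = p'"
      using e parts_pair_chart[of a d b] parts_pair_chart[of a' d b'] by simp
  qed
  moreover have "(fst_part d z, snd_part d z) \<in> fst (pair_chart d)"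
    by (simp add: pair_chart_def)
  ultimately have "inv_into (fst (pair_chart d)) (snd (pair_chart d)) (snd (pair_chart d) (fst_part d z, snd_part d z))
      = (fst_part d z, snd_part d z)"
    by (rule inv_into_f_f)
  then show ?thesis
    unfolding chart_inv_def pair_chart_parts[OF assms] .
qed

lemma mfd_charts_prod_Euclidean:
  "mfd_charts (prod_manifold (euclidean_manifold d) (euclidean_manifold d)) = {pair_chart d}"
  by (simp add: prod_manifold_def pair_chart_def case_prod_beta' cong: if_cong)

text \<open>Left translations are affine with linear part \<open>L a\<close>. Its orthogonality,
  stated by norms, yields left invariance of the Euclidean metric, and the elementary formulas for
  product and inverse yield smoothness.\<close>

locale affine_lie_group =
  group G for G :: "(nat \<Rightarrow> real) monoid" (structure) +
  fixes d :: nat and L :: "(nat \<Rightarrow> real) \<Rightarrow> (nat \<Rightarrow> real) \<Rightarrow> nat \<Rightarrow> real"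
  assumes carrier_vecs: "carrier G = vecs d"
    and mult_affine: "a \<in> vecs d \<Longrightarrow> x \<in> vecs d \<Longrightarrow> i < d \<Longrightarrow> (a \<otimes> x) i = a i + L a x i"
    and linear_part: "a \<in> vecs d \<Longrightarrow> x \<in> vecs d \<Longrightarrow> y \<in> vecs d \<Longrightarrow> i < d \<Longrightarrow>
      L a (\<lambda>j. x j + c * y j) i = L a x i + c * L a y i"
    and linear_part_norm: "a \<in> vecs d \<Longrightarrow> x \<in> vecs d \<Longrightarrow> (\<Sum>i<d. (L a x i)\<^sup>2) = (\<Sum>i<d. (x i)\<^sup>2)"
    and mult_elementary: "i < d \<Longrightarrow> \<exists>f\<in>elementary. \<forall>z\<in>vecs (d + d). f z = (fst_part d z \<otimes> snd_part d z) i"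
    and inv_elementary: "i < d \<Longrightarrow> \<exists>f\<in>elementary. \<forall>x\<in>vecs d. f x = (inv x) i"
begin

lemma smooth_map_mult:
  "smooth_map (prod_manifold (euclidean_manifold d) (euclidean_manifold d)) (euclidean_manifold d) (\<lambda>(a, b). a \<otimes> b)"
  unfolding smooth_map_def mfd_charts_prod_Euclidean
proof (intro conjI ballI allI impI)
  let ?X = "prod_topology (Euclidean_space d) (Euclidean_space d)"
  have c: "continuous_map ?X euclideanreal (\<lambda>p. snd (pair_chart d) p i)" for i
  proof -
    have "continuous_map ?X euclideanreal (\<lambda>p. if i < d then fst p i else snd p (i - d))"
      using continuous_map_compose[OF continuous_map_fst continuous_map_Euclidean_coordinate[of d i], of "Euclidean_space d"]
        continuous_map_compose[OF continuous_map_snd continuous_map_Euclidean_coordinate[of d "i - d"], of "Euclidean_space d"]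
      by (simp add: o_def)
    then show ?thesis
      by (simp add: pair_chart_def case_prod_beta)
  qed
  have "continuous_map ?X (Euclidean_space d) (\<lambda>p. fst p \<otimes> snd p)"
  proof (rule continuous_map_Euclidean_spaceI)
    show "fst p \<otimes> snd p \<in> vecs d" if "p \<in> topspace ?X" for p
      using that m_closed[of "fst p" "snd p"] by (auto simp: carrier_vecs)
    fix i assume "i < d"
    then obtain f where f: "f \<in> elementary" "\<forall>z\<in>vecs (d + d). f z = (fst_part d z \<otimes> snd_part d z) i"
      using mult_elementary by blast
    show "continuous_map ?X euclideanreal (\<lambda>p. (fst p \<otimes> snd p) i)"
    proof (rule continuous_map_eq[OF continuous_map_elementary[OF f(1) c]])
      show "f (snd (pair_chart d) p) = (fst p \<otimes> snd p) i" if "p \<in> topspace ?X" for p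
        using that f(2) parts_pair_chart[of "fst p" d "snd p"] by auto
    qed
  qed
  then show "continuous_map (mfd_top (prod_manifold (euclidean_manifold d) (euclidean_manifold d)))
      (mfd_top (euclidean_manifold d)) (\<lambda>(a, b). a \<otimes> b)"
    by (simp add: prod_manifold_def case_prod_beta')
  fix c c' i assume c: "c \<in> {pair_chart d}" and c': "c' \<in> mfd_charts (euclidean_manifold d)"
    and i: "i < mfd_dim (euclidean_manifold d)"
  then obtain f where f: "f \<in> elementary" "\<forall>z\<in>vecs (d + d). f z = (fst_part d z \<otimes> snd_part d z) i"
    using mult_elementary by auto
  have "snd c ` (fst c \<inter> (\<lambda>(a, b). a \<otimes> b) -` fst c') = snd (pair_chart d) ` (vecs d \<times> vecs d)"
    using c c' m_closed by (auto simp: pair_chart_def carrier_vecs)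
  also have "\<dots> = vecs (d + d)"
  proof (intro equalityI subsetI)
    fix z assume "z \<in> snd (pair_chart d) ` (vecs d \<times> vecs d)"
    then show "z \<in> vecs (d + d)" using parts_pair_chart(3) by auto
  next
    fix z assume "z \<in> vecs (d + d)"
    then show "z \<in> snd (pair_chart d) ` (vecs d \<times> vecs d)"
      using pair_chart_parts[of z d] by (intro image_eqI[of _ _ "(fst_part d z, snd_part d z)"]) auto
  qed
  finally have im: "snd c ` (fst c \<inter> (\<lambda>(a, b). a \<otimes> b) -` fst c') = vecs (d + d)" .
  show "smooth_on (mfd_dim (prod_manifold (euclidean_manifold d) (euclidean_manifold d)))
      (snd c ` (fst c \<inter> (\<lambda>(a, b). a \<otimes> b) -` fst c'))
      (\<lambda>x. snd c' ((\<lambda>(a, b). a \<otimes> b) (chart_inv c x)) i)"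
    unfolding im
    using c c' f openin_topspace[of "Euclidean_space (d + d)"]
    by (intro smooth_on_elementary[OF _ f(1)]) (auto simp: prod_manifold_def chart_inv_pair_chart)
qed

lemma smooth_map_inv: "smooth_map (euclidean_manifold d) (euclidean_manifold d) (\<lambda>a. inv a)"
  unfolding smooth_map_def
proof (intro conjI ballI allI impI)
  have "continuous_map (Euclidean_space d) (Euclidean_space d) (\<lambda>a. inv a)"
  proof (rule continuous_map_Euclidean_spaceI)
    show "inv a \<in> vecs d" if "a \<in> topspace (Euclidean_space d)" for a
      using that inv_closed[of a] by (simp add: carrier_vecs)
    fix i assume "i < d"
    then obtain f where f: "f \<in> elementary" "\<forall>x\<in>vecs d. f x = (inv x) i"
      using inv_elementary by blast
    show "continuous_map (Euclidean_space d) euclideanreal (\<lambda>a. (inv a) i)"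
      by (rule continuous_map_eq[OF continuous_map_elementary[OF f(1) continuous_map_Euclidean_coordinate]])
        (use f(2) in auto)
  qed
  then show "continuous_map (mfd_top (euclidean_manifold d)) (mfd_top (euclidean_manifold d)) (\<lambda>a. inv a)"
    by simp
  fix c c' i assume c: "c \<in> mfd_charts (euclidean_manifold d)" and c': "c' \<in> mfd_charts (euclidean_manifold d)"
    and i: "i < mfd_dim (euclidean_manifold d)"
  then obtain f where f: "f \<in> elementary" "\<forall>x\<in>vecs d. f x = (inv x) i"
    using inv_elementary by auto
  have im: "snd c ` (fst c \<inter> (\<lambda>a. inv a) -` fst c') = vecs d"
    using c c' inv_closed by (auto simp: carrier_vecs)
  show "smooth_on (mfd_dim (euclidean_manifold d)) (snd c ` (fst c \<inter> (\<lambda>a. inv a) -` fst c'))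
      (\<lambda>x. snd c' (inv (chart_inv c x)) i)"
    unfolding im
    using c c' f openin_topspace[of "Euclidean_space d"]
    by (intro smooth_on_elementary[OF _ f(1)]) auto
qed

lemma lie_group_Euclidean: "lie_group G (euclidean_manifold d)"
  using is_group smooth_manifold_Euclidean smooth_map_mult smooth_map_inv
  by (simp add: lie_group_def carrier_vecs)

text \<open>Polarization: a linear map that preserves norms preserves inner products.\<close>

lemma linear_part_inner:
  assumes "a \<in> vecs d" "x \<in> vecs d" "y \<in> vecs d"
  shows "(\<Sum>k<d. L a x k * L a y k) = (\<Sum>k<d. x k * y k)"
proof -
  let ?s = "\<lambda>j. x j + 1 * y j"
  have pol: "(\<Sum>k<d. (u k + v k)\<^sup>2) = (\<Sum>k<d. (u k)\<^sup>2) + (\<Sum>k<d. (v k)\<^sup>2) + 2 * (\<Sum>k<d. u k * v k)"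
    for u v :: "nat \<Rightarrow> real"
    by (simp add: power2_sum sum.distrib sum_distrib_left mult.assoc)
  have "?s \<in> vecs d" using assms by (auto simp: vecs_def)
  have "(\<Sum>k<d. (L a x k + L a y k)\<^sup>2) = (\<Sum>k<d. (L a ?s k)\<^sup>2)"
    using linear_part[OF assms, of _ 1] by (intro sum.cong) auto
  also have "\<dots> = (\<Sum>k<d. (x k + y k)\<^sup>2)"
    using linear_part_norm[OF assms(1) \<open>?s \<in> vecs d\<close>] by simp
  finally show ?thesis
    unfolding pol using linear_part_norm[OF assms(1,2)] linear_part_norm[OF assms(1,3)] by simp
qed

definition basis_vec :: "nat \<Rightarrow> nat \<Rightarrow> real" where
  "basis_vec i = (\<lambda>j. if j = i then 1 else 0)"

lemma left_mult_partial:
  assumes "a \<in> vecs d" "x \<in> vecs d" "i < d" "k < d"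
  shows "partial i (\<lambda>x. (a \<otimes> chart_inv (vecs d, \<lambda>x. x) x) k) x = L a (basis_vec i) k"
proof -
  have b: "basis_vec i \<in> vecs d" using assms by (auto simp: basis_vec_def vecs_def)
  have "(a \<otimes> chart_inv (vecs d, \<lambda>x. x) (x(i := t))) k =
      a k + L a (x(i := 0)) k + t * L a (basis_vec i) k" for t
  proof -
    \<comment> \<open>Splitting off the i-th basis vector shows that the translation is affine in
      \<open>t\<close>, with the i-th column of \<open>L a\<close> as slope.\<close>
    have "x(i := t) = (\<lambda>j. (x(i := 0)) j + t * basis_vec i j)"
      by (auto simp: basis_vec_def)
    then show ?thesis
      using mult_affine[of a "x(i := t)" k] linear_part[of a "x(i := 0)" "basis_vec i" k t] assms b
        vecs_upd[of x d i t] vecs_upd[of x d i 0] by simp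
  qed
  moreover have "((\<lambda>t. a k + L a (x(i := 0)) k + t * L a (basis_vec i) k) has_real_derivative L a (basis_vec i) k) (at (x i))"
    by (auto intro!: derivative_eq_intros)
  ultimately show ?thesis
    unfolding partial_def by (simp add: DERIV_imp_deriv)
qed

lemma left_invariant_delta: "left_invariant_metric G (euclidean_manifold d) delta_metric"
  unfolding left_invariant_metric_def
proof (intro conjI ballI)
  have inv: "preserves_metric (euclidean_manifold d) delta_metric (euclidean_manifold d) delta_metric (\<lambda>x. a \<otimes> x)"
    if a: "a \<in> vecs d" for a
    unfolding preserves_metric_def sum_delta_metric
  proof (intro ballI allI impI)
    fix p c c' i j assume "p \<in> topspace (mfd_top (euclidean_manifold d))" "c \<in> charts_at (euclidean_manifold d) p"
      "c' \<in> charts_at (euclidean_manifold d) (a \<otimes> p)" "i < mfd_dim (euclidean_manifold d)" "j < mfd_dim (euclidean_manifold d)"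
    then have p: "p \<in> vecs d" and c: "c = (vecs d, \<lambda>x. x)" "c' = (vecs d, \<lambda>x. x)" and ij: "i < d" "j < d"
      by (auto simp: charts_at_def)
    have "(\<Sum>k<d. jac c c' (\<lambda>x. a \<otimes> x) p k i * jac c c' (\<lambda>x. a \<otimes> x) p k j) =
        (\<Sum>k<d. L a (basis_vec i) k * L a (basis_vec j) k)"
      using left_mult_partial[OF a p] ij by (intro sum.cong) (auto simp: jac_def cpartial_def c)
    also have "\<dots> = (\<Sum>k<d. basis_vec i k * basis_vec j k)"
      using ij by (intro linear_part_inner a) (auto simp: basis_vec_def vecs_def)
    also have "\<dots> = (\<Sum>k<d. if k = i then (if i = j then 1 else 0) else 0)"
      by (rule sum.cong) (auto simp: basis_vec_def)
    also have "\<dots> = delta_metric c p i j"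
      using ij by (simp add: delta_metric_def)
    finally show "delta_metric c p i j = (\<Sum>k<mfd_dim (euclidean_manifold d).
        jac c c' (\<lambda>x. a \<otimes> x) p k i * jac c c' (\<lambda>x. a \<otimes> x) p k j)"
      by simp
  qed
  then show "preserves_metric (euclidean_manifold d) delta_metric (euclidean_manifold d) delta_metric (\<lambda>x. a \<otimes> x)"
    if "a \<in> carrier G" for a
    using that carrier_vecs by blast
  have "preserves_metric (euclidean_manifold d) delta_metric (euclidean_manifold d) delta_metric (\<lambda>x. x)"
    unfolding preserves_metric_def sum_delta_metric
  proof (intro ballI allI impI)
    fix p c c' i j assume "p \<in> topspace (mfd_top (euclidean_manifold d))" "c \<in> charts_at (euclidean_manifold d) p"
      "c' \<in> charts_at (euclidean_manifold d) p" "i < mfd_dim (euclidean_manifold d)" "j < mfd_dim (euclidean_manifold d)"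
    then have p: "p \<in> vecs d" and c: "c = (vecs d, \<lambda>x. x)" "c' = (vecs d, \<lambda>x. x)" and ij: "i < d" "j < d"
      by (auto simp: charts_at_def)
    have "jac c c' (\<lambda>x. x) p k i = (if k = i then 1 else 0)" if "i < d" for k i
    proof -
      have "((\<lambda>t. (p(i := t)) k) has_real_derivative (if k = i then 1 else 0)) (at (p i))"
        by (auto intro!: derivative_eq_intros)
      then show ?thesis
        using vecs_upd[OF p that] by (simp add: jac_def cpartial_def partial_def c DERIV_imp_deriv)
    qed
    then have "(\<Sum>k<d. jac c c' (\<lambda>x. x) p k i * jac c c' (\<lambda>x. x) p k j) =
        (\<Sum>k<d. if k = i then (if i = j then 1 else 0) else 0)"
      using ij by (intro sum.cong) auto
    then show "delta_metric c p i j = (\<Sum>k<mfd_dim (euclidean_manifold d).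
        jac c c' (\<lambda>x. x) p k i * jac c c' (\<lambda>x. x) p k j)"
      using ij by (simp add: delta_metric_def)
  qed
  then show "riemannian_metric (euclidean_manifold d) delta_metric"
    using openin_topspace[of "Euclidean_space d"] by (intro riemannian_metric_deltaI) auto
qed

end

section \<open>Fractional powers of translations\<close>

definition complex_elementary :: "((nat \<Rightarrow> real) \<Rightarrow> complex) \<Rightarrow> bool" where
  "complex_elementary F \<longleftrightarrow> (\<lambda>z. Re (F z)) \<in> elementary \<and> (\<lambda>z. Im (F z)) \<in> elementary"

lemma complex_elementary_const: "complex_elementary (\<lambda>z. c)"
  by (simp add: complex_elementary_def elementary.intros)

lemma complex_elementary_mult:
  "complex_elementary F \<Longrightarrow> complex_elementary F' \<Longrightarrow> complex_elementary (\<lambda>z. F z * F' z)"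
  by (simp add: complex_elementary_def elementary_add elementary_diff elementary_mult)

lemma complex_elementary_sum:
  "(\<And>j. j \<in> J \<Longrightarrow> complex_elementary (F j)) \<Longrightarrow> complex_elementary (\<lambda>z. \<Sum>j\<in>J. F j z)"
  by (simp add: complex_elementary_def elementary_sum)

lemma complex_elementary_cis: "f \<in> elementary \<Longrightarrow> complex_elementary (\<lambda>z. cis (f z))"
  by (simp add: complex_elementary_def elementary_sin elementary_cos)

text \<open>The sum runs over a full period, and \<open>j \<mapsto> m - j\<close> modulo n is an
  involution of the residues.\<close>

lemma sum_periodic_reflect:
  fixes F :: "int \<Rightarrow> complex"
  assumes "n > 0" "\<And>j. F (j + int n) = F j"
  shows "(\<Sum>j\<in>{0..<int n}. F (m - j)) = (\<Sum>j\<in>{0..<int n}. F j)"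
proof -
  have 1: "F (j + int k * int n) = F j" for j k
  proof (induction k)
    case (Suc k)
    have "F (j + int (Suc k) * int n) = F (j + int k * int n + int n)"
      by (simp add: algebra_simps)
    then show ?case using assms(2) Suc by simp
  qed simp
  have 2: "F (j + k * int n) = F j" for j k
  proof (cases "k \<ge> 0")
    case True
    then show ?thesis using 1[of j "nat k"] by simp
  next
    case False
    then show ?thesis using 1[of "j + k * int n" "nat (- k)"] by (simp add: algebra_simps)
  qed
  have 3: "F (j mod int n) = F j" for j
    using 2[of "j mod int n" "j div int n"] by simp
  show ?thesis
  proof (rule sum.reindex_bij_witness[where i = "\<lambda>j. (m - j) mod int n" and j = "\<lambda>j. (m - j) mod int n"])
    fix j assume j: "j \<in> {0..<int n}"
    have "(m - (m - j) mod int n) mod int n = (m - (m - j)) mod int n"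
      by (rule mod_diff_right_eq)
    then show "(m - (m - j) mod int n) mod int n = j" using j by simp
    then show "(m - (m - j) mod int n) mod int n = j" .
    show "(m - j) mod int n \<in> {0..<int n}" using assms(1) by simp
    then show "(m - j) mod int n \<in> {0..<int n}" .
    show "F ((m - j) mod int n) = F (m - j)" by (rule 3)
  qed
qed

text \<open>A shift is the composition of two reflections.\<close>

lemma sum_periodic_shift:
  fixes F :: "int \<Rightarrow> complex"
  assumes "n > 0" "\<And>j. F (j + int n) = F j"
  shows "(\<Sum>j\<in>{0..<int n}. F (m + j)) = (\<Sum>j\<in>{0..<int n}. F j)"
proof -
  have "(\<Sum>j\<in>{0..<int n}. F (m + j)) = (\<Sum>j\<in>{0..<int n}. (\<lambda>i. F (m - i)) (0 - j))"
    by simp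
  also have "\<dots> = (\<Sum>j\<in>{0..<int n}. F (m - j))"
  proof (rule sum_periodic_reflect[OF assms(1)])
    show "F (m - (j + int n)) = F (m - j)" for j
      using assms(2)[of "m - (j + int n)"] by simp
  qed
  also have "\<dots> = (\<Sum>j\<in>{0..<int n}. F j)"
    by (rule sum_periodic_reflect[where F = F, OF assms])
  finally show ?thesis .
qed

section \<open>Fourier coefficients of fractional powers\<close>

definition ucis :: "nat \<Rightarrow> real \<Rightarrow> complex" where
  "ucis n x = cis (2 * pi * x / real n)"

lemma ucis_add: "ucis n (x + y) = ucis n x * ucis n y"
  by (simp add: ucis_def cis_mult distrib_left add_divide_distrib)

lemma ucis_0 [simp]: "ucis n 0 = 1"
  by (simp add: ucis_def)

lemma cnj_ucis: "cnj (ucis n x) = ucis n (- x)"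
  by (simp add: ucis_def cis_cnj)

lemma ucis_multiple:
  assumes "n > 0"
  shows "ucis n (real n * real_of_int k) = 1"
proof -
  have "2 * pi * (real n * real_of_int k) / real n = 2 * pi * real_of_int k"
    using assms by simp
  then show ?thesis
    unfolding ucis_def by (simp add: cis_multiple_2pi)
qed

lemma ucis_eq_1:
  assumes "n > 0" "ucis n (real_of_int l) = 1"
  shows "int n dvd l"
proof -
  have "cos (2 * pi * real_of_int l / real n) = 1"
    using assms(2) by (simp add: ucis_def complex_eq_iff)
  then obtain k where "2 * pi * real_of_int l / real n = real_of_int k * 2 * pi"
    using cos_one_2pi_int by blast
  then have "real_of_int l = real_of_int (int n * k)"
    using assms(1) by (simp add: field_simps)
  then have "l = int n * k"
    by (rule of_int_eq_iff[THEN iffD1])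
  then show ?thesis by simp
qed

text \<open>Orthogonality of the characters of the cyclic group of order n: shifting the index
  multiplies the sum by \<open>ucis n l\<close>, so the sum vanishes unless this factor is
  1.\<close>

lemma sum_ucis:
  assumes "n > 0"
  shows "(\<Sum>j\<in>{0..<int n}. ucis n (real_of_int (l * j))) = (if int n dvd l then of_nat n else 0)"
proof (cases "int n dvd l")
  case True
  then obtain k where "l = int n * k" by blast
  then have "ucis n (real_of_int (l * j)) = 1" for j
    using ucis_multiple[OF assms, of "k * j"] by (simp add: mult.assoc)
  then show ?thesis using True by simp
next
  case False
  let ?S = "\<Sum>j\<in>{0..<int n}. ucis n (real_of_int (l * j))"
  have "ucis n (real_of_int (l * (j + int n))) = ucis n (real_of_int (l * j))" for j
    using ucis_multiple[OF assms, of l] ucis_add[of n "real_of_int (l * j)" "real n * real_of_int l"]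
    by (simp add: algebra_simps)
  then have "?S = (\<Sum>j\<in>{0..<int n}. ucis n (real_of_int (l * (1 + j))))"
    using sum_periodic_shift[OF assms, of "\<lambda>j. ucis n (real_of_int (l * j))" 1] by simp
  also have "\<dots> = ucis n (real_of_int l) * ?S"
    by (simp add: sum_distrib_left ucis_add distrib_left)
  finally have "(1 - ucis n (real_of_int l)) * ?S = 0"
    by (simp add: algebra_simps)
  then show ?thesis
    using False ucis_eq_1[OF assms, of l] by auto
qed

text \<open>
  \<open>\<Sum>j<n. flow_coeff n t j T^j\<close> is the power \<open>T^t\<close> of a linear map \<open>T\<close> with \<open>T^n = 1\<close>, for the branch
  of the logarithm for which the eigenvalue \<open>exp (2 \<pi> i k / n)\<close> with \<open>0 \<le> k < n\<close> has the power
  \<open>exp (2 \<pi> i k t / n)\<close>.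
\<close>

definition flow_coeff :: "nat \<Rightarrow> real \<Rightarrow> int \<Rightarrow> complex" where
  "flow_coeff n t j = (\<Sum>k\<in>{0..<int n}. ucis n (real_of_int k * (t - real_of_int j))) / of_nat n"

lemma flow_coeff_periodic: "n > 0 \<Longrightarrow> flow_coeff n t (j + int n) = flow_coeff n t j"
proof -
  assume n: "n > 0"
  have "ucis n (real_of_int k * (t - real_of_int (j + int n))) = ucis n (real_of_int k * (t - real_of_int j))" for k
    using ucis_multiple[OF n, of "- k"] ucis_add[of n "real_of_int k * (t - real_of_int j)" "real n * real_of_int (- k)"]
    by (simp add: algebra_simps)
  then show ?thesis by (simp add: flow_coeff_def)
qed

text \<open>For unitary \<open>T\<close> this says that the adjoint of \<open>T^t\<close> is
  \<open>T^(-t)\<close>.\<close>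

lemma cnj_flow_coeff: "cnj (flow_coeff n t j) = flow_coeff n (- t) (- j)"
  by (simp add: flow_coeff_def cnj_ucis algebra_simps)

text \<open>At integer times the sum is an orthogonality relation and a single residue survives, so
  that \<open>T^m\<close> is the ordinary power.\<close>

lemma flow_coeff_of_int:
  assumes "n > 0"
  shows "flow_coeff n (real_of_int m) j = (if int n dvd m - j then 1 else 0)"
  using sum_ucis[OF assms, of "m - j"] assms by (simp add: flow_coeff_def mult.commute)

text \<open>The law \<open>T^s T^t = T^(s+t)\<close> on coefficients: after expanding, the sum over
  j is an orthogonality relation that leaves only the diagonal \<open>l = k\<close>.\<close>

lemma flow_coeff_convolution:
  assumes n: "n > 0"
  shows "(\<Sum>j\<in>{0..<int n}. flow_coeff n s j * flow_coeff n t (r - j)) = flow_coeff n (s + t) r"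
proof -
  let ?I = "{0..<int n}"
  let ?e = "\<lambda>k l. ucis n (real_of_int k * s + real_of_int l * (t - real_of_int r))"
  have "flow_coeff n s j * flow_coeff n t (r - j) =
      (\<Sum>k\<in>?I. \<Sum>l\<in>?I. ?e k l * ucis n (real_of_int ((l - k) * j))) / (of_nat n * of_nat n)" for j
    unfolding flow_coeff_def times_divide_times_eq sum_product ucis_add[symmetric]
    by (simp add: algebra_simps)
  then have "(\<Sum>j\<in>?I. flow_coeff n s j * flow_coeff n t (r - j)) =
      (\<Sum>j\<in>?I. \<Sum>k\<in>?I. \<Sum>l\<in>?I. ?e k l * ucis n (real_of_int ((l - k) * j))) / (of_nat n * of_nat n)"
    by (simp add: sum_divide_distrib)
  also have "(\<Sum>j\<in>?I. \<Sum>k\<in>?I. \<Sum>l\<in>?I. ?e k l * ucis n (real_of_int ((l - k) * j))) =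
      (\<Sum>k\<in>?I. \<Sum>j\<in>?I. \<Sum>l\<in>?I. ?e k l * ucis n (real_of_int ((l - k) * j)))"
    by (rule sum.swap)
  also have "\<dots> = (\<Sum>k\<in>?I. \<Sum>l\<in>?I. \<Sum>j\<in>?I. ?e k l * ucis n (real_of_int ((l - k) * j)))"
    by (intro sum.cong refl sum.swap)
  also have "\<dots> = (\<Sum>k\<in>?I. \<Sum>l\<in>?I. if l = k then ?e k k * of_nat n else 0)"
  proof (intro sum.cong refl)
    fix k l assume kl: "k \<in> ?I" "l \<in> ?I"
    have "\<bar>l - k\<bar> < int n" using kl by auto
    then have "int n dvd l - k \<longleftrightarrow> l = k"
      using dvd_imp_le_int[of "l - k" "int n"] by auto
    then show "(\<Sum>j\<in>?I. ?e k l * ucis n (real_of_int ((l - k) * j))) = (if l = k then ?e k k * of_nat n else 0)"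
      using sum_ucis[OF n, of "l - k"] by (simp flip: sum_distrib_left)
  qed
  also have "\<dots> = (\<Sum>k\<in>?I. ?e k k) * of_nat n"
    by (simp add: sum_distrib_right)
  also have "(\<Sum>k\<in>?I. ?e k k) * of_nat n / (of_nat n * of_nat n) = flow_coeff n (s + t) r"
    using n by (simp add: flow_coeff_def algebra_simps)
  finally show ?thesis .
qed

lemma complex_elementary_flow_coeff:
  assumes "f \<in> elementary"
  shows "complex_elementary (\<lambda>z. flow_coeff n (f z) j)"
proof -
  have "complex_elementary (\<lambda>z. ucis n (real_of_int k * (f z - real_of_int j)))" for k
  proof -
    have "(\<lambda>z. (2 * pi / real n) * (real_of_int k * (f z - real_of_int j))) \<in> elementary"
      by (intro elementary_mult elementary_const elementary_diff assms)
    from complex_elementary_cis[OF this] show ?thesis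
      by (simp add: ucis_def)
  qed
  then have "complex_elementary (\<lambda>z. (1 / of_nat n) * (\<Sum>k\<in>{0..<int n}. ucis n (real_of_int k * (f z - real_of_int j))))"
    by (intro complex_elementary_mult complex_elementary_const complex_elementary_sum)
  then show ?thesis
    by (simp add: flow_coeff_def)
qed

lemma sum_lessThan_add: "(\<Sum>i<m + k. g i) = (\<Sum>i<m. g i) + (\<Sum>i<k. g (m + i :: nat))" for g :: "nat \<Rightarrow> real"
  by (induction k) simp_all

lemma elementary_fst_part: "(\<lambda>z. fst_part d z i) \<in> elementary"
  by (cases "i < d") (simp_all add: fst_part_def elementary.intros)

lemma elementary_snd_part: "(\<lambda>z. snd_part d z i) \<in> elementary"
  by (cases "i < d") (simp_all add: snd_part_def elementary.intros)

text \<open>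
  The underlying set of the group consists of numbers because its elements serve as coordinate
  indices below.
\<close>

locale indexed_comm_group = comm_group A for A :: "nat monoid" (structure) +
  fixes n :: nat
  assumes carrier_index: "carrier A = {..<n}"
begin

section \<open>Flows of translations on functions on A\<close>

lemma n_pos: "n > 0"
  using one_closed carrier_index by auto

text \<open>By Lagrange the order of A is an exponent for every element, so the same coefficients
  \<open>flow_coeff n\<close> serve for all of A.\<close>

lemma int_pow_period:
  assumes "a < n"
  shows "a [^] (j + int n) = a [^] j"
proof -
  have a: "a \<in> carrier A" using assms carrier_index by simp
  have "a [^] n = \<one>"
    using pow_order_eq_1[OF a] carrier_index by (simp add: order_def)
  then show ?thesis
    using a by (simp add: int_pow_mult int_pow_int)
qed

lemma int_pow_lt [simp]: "a < n \<Longrightarrow> a [^] (j::int) < n"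
  using int_pow_closed[of a j] carrier_index by simp

lemma mult_lt [simp]: "a < n \<Longrightarrow> b < n \<Longrightarrow> a \<otimes> b < n"
  using m_closed[of a b] carrier_index by simp

lemma int_pow_add: "a < n \<Longrightarrow> x < n \<Longrightarrow> x \<otimes> a [^] i \<otimes> a [^] j = x \<otimes> a [^] (i + j :: int)"
  using int_pow_mult[of a i j] m_assoc[of x "a [^] i" "a [^] j"] carrier_index by simp

text \<open>The fractional power with exponent t of the translation that takes \<open>f\<close> to
  \<open>\<lambda>x. f (x \<otimes> a)\<close>.\<close>

definition flow :: "nat \<Rightarrow> real \<Rightarrow> (nat \<Rightarrow> complex) \<Rightarrow> nat \<Rightarrow> complex" where
  "flow a t f x = (\<Sum>j\<in>{0..<int n}. flow_coeff n t j * f (x \<otimes> a [^] j))"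

text \<open>Functions are defined on all numbers, but only their values below n represent elements
  of the group algebra. This is why many identities below are pointwise and need congruence
  rules.\<close>

lemma flow_cong: "a < n \<Longrightarrow> x < n \<Longrightarrow> (\<And>y. y < n \<Longrightarrow> f y = g y) \<Longrightarrow> flow a t f x = flow a t g x"
  by (simp add: flow_def)

lemma flow_linear: "flow a t (\<lambda>x. f x + c * g x) x = flow a t f x + c * flow a t g x"
  by (simp add: flow_def sum.distrib sum_distrib_left algebra_simps)

text \<open>With \<open>r = j + l\<close> as summation index, allowed by periodicity, the
  coefficients form the convolution already computed.\<close>

lemma flow_add:
  assumes a: "a < n" and x: "x < n"
  shows "flow a s (flow a t f) x = flow a (s + t) f x"
proof -
  let ?I = "{0..<int n}"
  have "flow a s (flow a t f) x =
      (\<Sum>j\<in>?I. flow_coeff n s j * (\<Sum>l\<in>?I. flow_coeff n t l * f (x \<otimes> a [^] (j + l))))"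
    using a x by (simp add: flow_def int_pow_add)
  also have "\<dots> = (\<Sum>j\<in>?I. flow_coeff n s j * (\<Sum>r\<in>?I. flow_coeff n t (r - j) * f (x \<otimes> a [^] r)))"
  proof (intro sum.cong refl)
    fix j
    have "(\<Sum>l\<in>?I. flow_coeff n t (j + l - j) * f (x \<otimes> a [^] (j + l))) =
        (\<Sum>r\<in>?I. flow_coeff n t (r - j) * f (x \<otimes> a [^] r))"
    proof (rule sum_periodic_shift[OF n_pos])
      show "flow_coeff n t (r + int n - j) * f (x \<otimes> a [^] (r + int n)) = flow_coeff n t (r - j) * f (x \<otimes> a [^] r)" for r
        using flow_coeff_periodic[OF n_pos, of t "r - j"] int_pow_period[OF a] by (simp add: algebra_simps)
    qed
    then show "flow_coeff n s j * (\<Sum>l\<in>?I. flow_coeff n t l * f (x \<otimes> a [^] (j + l))) =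
        flow_coeff n s j * (\<Sum>r\<in>?I. flow_coeff n t (r - j) * f (x \<otimes> a [^] r))"
      by simp
  qed
  also have "\<dots> = (\<Sum>r\<in>?I. (\<Sum>j\<in>?I. flow_coeff n s j * flow_coeff n t (r - j)) * f (x \<otimes> a [^] r))"
    unfolding sum_distrib_left sum_distrib_right mult.assoc by (rule sum.swap)
  also have "\<dots> = flow a (s + t) f x"
    by (simp add: flow_coeff_convolution[OF n_pos] flow_def)
  finally show ?thesis .
qed

lemma flow_commute:
  assumes a: "a < n" and b: "b < n" and x: "x < n"
  shows "flow a s (flow b t f) x = flow b t (flow a s f) x"
proof -
  have "x \<otimes> a [^] i \<otimes> b [^] j = x \<otimes> b [^] j \<otimes> a [^] i" for i j :: int
    using m_assoc[of x "a [^] i" "b [^] j"] m_assoc[of x "b [^] j" "a [^] i"] m_comm[of "a [^] i" "b [^] j"]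
      a b x carrier_index by simp
  then have "flow a s (flow b t f) x = (\<Sum>i\<in>{0..<int n}. \<Sum>j\<in>{0..<int n}.
      flow_coeff n t j * (flow_coeff n s i * f (x \<otimes> b [^] j \<otimes> a [^] i)))"
    by (simp add: flow_def sum_distrib_left mult.left_commute)
  also have "\<dots> = flow b t (flow a s f) x"
    unfolding flow_def sum_distrib_left by (rule sum.swap)
  finally show ?thesis .
qed

lemma flow_of_int:
  assumes a: "a < n"
  shows "flow a (real_of_int m) f x = f (x \<otimes> a [^] m)"
proof -
  have "flow a (real_of_int m) f x = (\<Sum>j\<in>{0..<int n}. (\<lambda>i. if int n dvd i then f (x \<otimes> a [^] (m - i)) else 0) (m - j))"
    by (simp add: flow_def flow_coeff_of_int[OF n_pos] if_distrib cong: if_cong)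
      (rule sum.cong, auto)
  also have "\<dots> = (\<Sum>j\<in>{0..<int n}. if int n dvd j then f (x \<otimes> a [^] (m - j)) else 0)"
  proof (rule sum_periodic_reflect[OF n_pos])
    show "(if int n dvd j + int n then f (x \<otimes> a [^] (m - (j + int n))) else 0) =
        (if int n dvd j then f (x \<otimes> a [^] (m - j)) else 0)" for j
      using int_pow_period[OF a, of "m - (j + int n)"] by simp
  qed
  also have "\<dots> = (\<Sum>j\<in>{0..<int n}. if j = 0 then f (x \<otimes> a [^] m) else 0)"
    by (rule sum.cong) (use zdvd_imp_le[of "int n"] in force)+
  also have "\<dots> = f (x \<otimes> a [^] m)"
    using n_pos by simp
  finally show ?thesis .
qed

lemma sum_translate:
  fixes F :: "nat \<Rightarrow> complex"
  assumes "c < n"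
  shows "(\<Sum>x<n. F (x \<otimes> c)) = (\<Sum>x<n. F x)"
  by (rule sum.reindex_bij_witness[where i = "\<lambda>x. x \<otimes> inv c" and j = "\<lambda>x. x \<otimes> c"])
    (use assms inv_closed[of c] m_closed carrier_index in \<open>auto simp: m_assoc\<close>)

text \<open>Translating the summation variable shows that the adjoint of a translation is the
  inverse translation; reflecting j then matches the conjugated coefficients with those of time
  \<open>- t\<close>.\<close>

lemma flow_adjoint:
  assumes a: "a < n"
  shows "(\<Sum>x<n. flow a t f x * cnj (g x)) = (\<Sum>x<n. f x * cnj (flow a (- t) g x))"
proof -
  let ?I = "{0..<int n}"
  have "(\<Sum>x<n. flow a t f x * cnj (g x)) = (\<Sum>x<n. \<Sum>j\<in>?I. flow_coeff n t j * f (x \<otimes> a [^] j) * cnj (g x))"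
    by (simp add: flow_def sum_distrib_right)
  also have "\<dots> = (\<Sum>j\<in>?I. \<Sum>x<n. flow_coeff n t j * f (x \<otimes> a [^] j) * cnj (g x))"
    by (rule sum.swap)
  also have "\<dots> = (\<Sum>j\<in>?I. \<Sum>x<n. flow_coeff n t j * f x * cnj (g (x \<otimes> a [^] (- j))))"
  proof (rule sum.cong[OF refl])
    fix j :: int
    have "x \<otimes> a [^] j \<otimes> a [^] (- j) = x" if "x < n" for x
      using int_pow_add[OF a that, of j "- j"] that carrier_index by simp
    then have "(\<Sum>x<n. flow_coeff n t j * f (x \<otimes> a [^] j) * cnj (g x)) =
        (\<Sum>x<n. flow_coeff n t j * f (x \<otimes> a [^] j) * cnj (g (x \<otimes> a [^] j \<otimes> a [^] (- j))))"
      by (intro sum.cong) auto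
    also have "\<dots> = (\<Sum>x<n. flow_coeff n t j * f x * cnj (g (x \<otimes> a [^] (- j))))"
      by (rule sum_translate) (use a in simp)
    finally show "(\<Sum>x<n. flow_coeff n t j * f (x \<otimes> a [^] j) * cnj (g x)) =
        (\<Sum>x<n. flow_coeff n t j * f x * cnj (g (x \<otimes> a [^] (- j))))" .
  qed
  also have "\<dots> = (\<Sum>x<n. f x * (\<Sum>j\<in>?I. (\<lambda>i. flow_coeff n t (- i) * cnj (g (x \<otimes> a [^] i))) (0 - j)))"
    by (subst sum.swap) (simp add: sum_distrib_left mult_ac)
  also have "\<dots> = (\<Sum>x<n. f x * (\<Sum>j\<in>?I. flow_coeff n t (- j) * cnj (g (x \<otimes> a [^] j))))"
  proof (rule sum.cong[OF refl])
    fix x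
    have "flow_coeff n t (- (j + int n)) * cnj (g (x \<otimes> a [^] (j + int n))) = flow_coeff n t (- j) * cnj (g (x \<otimes> a [^] j))" for j
      using flow_coeff_periodic[OF n_pos, of t "- (j + int n)"] int_pow_period[OF a] by simp
    then have "(\<Sum>j\<in>?I. (\<lambda>i. flow_coeff n t (- i) * cnj (g (x \<otimes> a [^] i))) (0 - j)) =
        (\<Sum>j\<in>?I. flow_coeff n t (- j) * cnj (g (x \<otimes> a [^] j)))"
      by (rule sum_periodic_reflect[OF n_pos])
    then show "f x * (\<Sum>j\<in>?I. (\<lambda>i. flow_coeff n t (- i) * cnj (g (x \<otimes> a [^] i))) (0 - j)) =
        f x * (\<Sum>j\<in>?I. flow_coeff n t (- j) * cnj (g (x \<otimes> a [^] j)))"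
      by (rule arg_cong)
  qed
  also have "\<dots> = (\<Sum>x<n. f x * cnj (flow a (- t) g x))"
    by (simp add: flow_def cnj_flow_coeff)
  finally show ?thesis .
qed

text \<open>The adjoint is the flow for time \<open>- t\<close>, which undoes the flow for time
  \<open>t\<close>.\<close>

lemma flow_norm:
  assumes a: "a < n"
  shows "(\<Sum>x<n. (cmod (flow a t f x))\<^sup>2) = (\<Sum>x<n. (cmod (f x))\<^sup>2)"
proof -
  have *: "complex_of_real (\<Sum>x<n. (cmod (g x))\<^sup>2) = (\<Sum>x<n. g x * cnj (g x))" for g
    by (simp add: complex_norm_square del: of_real_power)
  have "flow a (- t) (flow a t f) x = f x" if "x < n" for x
    using flow_add[OF a that, of "- t" t f] flow_of_int[OF a, of 0 f x] that carrier_index by simp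
  then have "complex_of_real (\<Sum>x<n. (cmod (flow a t f x))\<^sup>2) = complex_of_real (\<Sum>x<n. (cmod (f x))\<^sup>2)"
    unfolding * flow_adjoint[OF a] by simp
  then show ?thesis
    by (simp only: of_real_eq_iff)
qed

text \<open>For \<open>k = n\<close> the action of R^n: each element of A, being a number, is at
  once the index of its own time coordinate. The partial composites exist for induction.\<close>

primrec rho :: "nat \<Rightarrow> (nat \<Rightarrow> real) \<Rightarrow> (nat \<Rightarrow> complex) \<Rightarrow> nat \<Rightarrow> complex" where
  "rho 0 s f = f"
| "rho (Suc k) s f = flow k (s k) (rho k s f)"

text \<open>The element of A by whose translation an integer vector of times acts, see
  \<open>rho_of_int\<close>.\<close>

primrec word :: "nat \<Rightarrow> (nat \<Rightarrow> int) \<Rightarrow> nat" where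
  "word 0 m = \<one>"
| "word (Suc k) m = word k m \<otimes> k [^] m k"

lemma rho_cong:
  assumes "k \<le> n" "x < n" "\<And>i. i < k \<Longrightarrow> s i = t i" "\<And>y. y < n \<Longrightarrow> f y = g y"
  shows "rho k s f x = rho k t g x"
  using assms by (induction k arbitrary: x) (auto intro!: flow_cong)

lemma rho_linear: "rho k s (\<lambda>x. f x + c * g x) x = rho k s f x + c * rho k s g x"
proof (induction k arbitrary: x)
  case (Suc k)
  then have "rho k s (\<lambda>x. f x + c * g x) = (\<lambda>x. rho k s f x + c * rho k s g x)"
    by blast
  then show ?case by (simp add: flow_linear)
qed simp

lemma rho_flow:
  assumes "k \<le> n" "b < n" "x < n"
  shows "rho k s (flow b t f) x = flow b t (rho k s f) x"
  using assms
proof (induction k arbitrary: x)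
  case (Suc k)
  have "rho (Suc k) s (flow b t f) x = flow k (s k) (flow b t (rho k s f)) x"
    using Suc by (auto intro!: flow_cong)
  also have "\<dots> = flow b t (flow k (s k) (rho k s f)) x"
    using Suc.prems by (intro flow_commute) auto
  finally show ?case by simp
qed simp

text \<open>\<open>rho_flow\<close> moves the last flow of the inner composite past the outer ones,
  next to its partner.\<close>

lemma rho_add:
  assumes "k \<le> n" "x < n"
  shows "rho k s (rho k t f) x = rho k (\<lambda>i. s i + t i) f x"
  using assms
proof (induction k arbitrary: x)
  case (Suc k)
  have k: "k < n" "k \<le> n" using Suc.prems by auto
  have "rho (Suc k) s (rho (Suc k) t f) x = flow k (s k) (flow k (t k) (rho k s (rho k t f))) x"
    using rho_flow[OF k(2,1)] by (auto intro!: flow_cong k Suc.prems)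
  also have "\<dots> = flow k (s k + t k) (rho k s (rho k t f)) x"
    using k Suc.prems by (intro flow_add)
  also have "\<dots> = flow k (s k + t k) (rho k (\<lambda>i. s i + t i) f) x"
    using k Suc.prems Suc.IH by (intro flow_cong) auto
  finally show ?case by simp
qed simp

lemma rho_norm: "k \<le> n \<Longrightarrow> (\<Sum>x<n. (cmod (rho k s f x))\<^sup>2) = (\<Sum>x<n. (cmod (f x))\<^sup>2)"
  by (induction k) (simp_all add: flow_norm)

lemma word_lt: "k \<le> n \<Longrightarrow> word k m < n"
  using one_closed carrier_index by (induction k) auto

lemma rho_of_int:
  assumes "k \<le> n" "x < n"
  shows "rho k (\<lambda>i. real_of_int (m i)) f x = f (x \<otimes> word k m)"
  using assms
proof (induction k arbitrary: x)
  case (Suc k)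
  have k: "k < n" "k \<le> n" using Suc.prems by auto
  have "x \<otimes> k [^] m k \<otimes> word k m = x \<otimes> (word k m \<otimes> k [^] m k)"
    using m_assoc[of x "k [^] m k" "word k m"] m_comm[of "word k m" "k [^] m k"] word_lt[OF k(2), of m] k Suc.prems
      carrier_index by simp
  then show ?case
    using Suc.IH[OF k(2), of "x \<otimes> k [^] m k"] k Suc.prems by (simp add: flow_of_int)
qed (simp add: carrier_index)

lemma word_add: "k \<le> n \<Longrightarrow> word k (\<lambda>i. m i + m' i) = word k m \<otimes> word k m'"
proof (induction k)
  case (Suc k)
  have k: "k < n" "k \<le> n" using Suc.prems by auto
  then have c: "k \<in> carrier A" "word k m \<in> carrier A" "word k m' \<in> carrier A" "k [^] m k \<in> carrier A" "k [^] m' k \<in> carrier A"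
    using word_lt carrier_index by auto
  show ?case
    using Suc.IH[OF k(2)] c by (simp add: int_pow_mult m_ac)
qed simp

text \<open>The unit vector at index \<open>a\<close> acts as \<open>a\<close>, so every element of
  A comes from an integer point.\<close>

lemma word_single: "k \<le> n \<Longrightarrow> a < n \<Longrightarrow> word k (\<lambda>i. if i = a then 1 else 0) = (if a < k then a else \<one>)"
  by (induction k) (auto simp: carrier_index int_pow_def nat_pow_def less_Suc_eq r_one[OF one_closed])

lemma complex_elementary_flow:
  assumes "a < n" "x < n" "s \<in> elementary" "\<And>y. y < n \<Longrightarrow> complex_elementary (\<lambda>z. f z y)"
  shows "complex_elementary (\<lambda>z. flow a (s z) (f z) x)"
  unfolding flow_def
  using assms by (intro complex_elementary_sum complex_elementary_mult complex_elementary_flow_coeff) auto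

lemma complex_elementary_rho:
  assumes "k \<le> n" "x < n" "\<And>i. (\<lambda>z. s z i) \<in> elementary" "\<And>y. y < n \<Longrightarrow> complex_elementary (\<lambda>z. f z y)"
  shows "complex_elementary (\<lambda>z. rho k (s z) (f z) x)"
  using assms by (induction k arbitrary: x) (auto intro!: complex_elementary_flow)

text \<open>
  Points of \<open>\<real>\<^sup>n \<times> \<complex>[A]\<close>: the coordinates from n on are the real parts, those from 2 n on the
  imaginary parts of the coefficients of the second component.
\<close>

definition join :: "(nat \<Rightarrow> real) \<Rightarrow> (nat \<Rightarrow> complex) \<Rightarrow> nat \<Rightarrow> real" where
  "join s f i = (if i < n then s i else if i < 2 * n then Re (f (i - n)) else if i < 3 * n then Im (f (i - 2 * n)) else 0)"

definition cpart :: "(nat \<Rightarrow> real) \<Rightarrow> nat \<Rightarrow> complex" where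
  "cpart a x = Complex (a (n + x)) (a (2 * n + x))"

text \<open>The product of the semidirect product. \<open>rho n a\<close> reads only the entries of
  \<open>a\<close> below n, so the full vector can stand for its R^n component.\<close>

definition aff_mult :: "(nat \<Rightarrow> real) \<Rightarrow> (nat \<Rightarrow> real) \<Rightarrow> nat \<Rightarrow> real" where
  "aff_mult a b = join (\<lambda>i. a i + b i) (\<lambda>x. cpart a x + rho n a (cpart b) x)"

definition aff_inv :: "(nat \<Rightarrow> real) \<Rightarrow> nat \<Rightarrow> real" where
  "aff_inv a = join (\<lambda>i. - a i) (\<lambda>x. - rho n (\<lambda>i. - a i) (cpart a) x)"

definition Aff :: "(nat \<Rightarrow> real) monoid" where
  "Aff = \<lparr>carrier = vecs (3 * n), monoid.mult = aff_mult, one = (\<lambda>i. 0)\<rparr>"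

lemma Aff_sel [simp]: "carrier Aff = vecs (3 * n)" "monoid.mult Aff = aff_mult" "one Aff = (\<lambda>i. 0)"
  by (simp_all add: Aff_def)

lemma join_vecs [simp]: "join s f \<in> vecs (3 * n)"
  by (auto simp: join_def vecs_def)

lemma join_fst: "i < n \<Longrightarrow> join s f i = s i"
  by (simp add: join_def)

lemma cpart_join: "x < n \<Longrightarrow> cpart (join s f) x = f x"
  by (simp add: cpart_def join_def complex_eq_iff)

lemma join_cong: "(\<And>i. i < n \<Longrightarrow> s i = t i) \<Longrightarrow> (\<And>x. x < n \<Longrightarrow> f x = g x) \<Longrightarrow> join s f = join t g"
  by (auto simp: join_def fun_eq_iff)

lemma join_cpart: "a \<in> vecs (3 * n) \<Longrightarrow> join a (cpart a) = a"
  by (auto simp: join_def cpart_def vecs_def fun_eq_iff)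

text \<open>Carries unitarity of \<open>rho\<close> over to orthogonality on the real
  coordinates.\<close>

lemma join_norm: "(\<Sum>i<3 * n. (join s f i)\<^sup>2) = (\<Sum>i<n. (s i)\<^sup>2) + (\<Sum>x<n. (cmod (f x))\<^sup>2)"
proof -
  have "3 * n = n + n + n" by simp
  then have "(\<Sum>i<3 * n. (join s f i)\<^sup>2) = (\<Sum>i<n. (s i)\<^sup>2) + (\<Sum>x<n. (Re (f x))\<^sup>2) + (\<Sum>x<n. (Im (f x))\<^sup>2)"
    by (simp only: sum_lessThan_add) (simp add: join_def)
  then show ?thesis
    by (simp add: cmod_power2 sum.distrib)
qed

lemma elementary_join:
  assumes "\<And>i. (\<lambda>z. s z i) \<in> elementary" "\<And>x. x < n \<Longrightarrow> complex_elementary (\<lambda>z. f z x)"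
  shows "(\<lambda>z. join (s z) (f z) i) \<in> elementary"
proof -
  consider "i < n" | "n \<le> i" "i < 2 * n" | "2 * n \<le> i" "i < 3 * n" | "3 * n \<le> i" by linarith
  then show ?thesis
  proof cases
    case 1
    then show ?thesis using assms(1) by (simp add: join_def)
  next
    case 2
    then show ?thesis using assms(2)[of "i - n"] by (simp add: join_def complex_elementary_def)
  next
    case 3
    then have "i - 2 * n < n" by linarith
    then show ?thesis using 3 assms(2)[of "i - 2 * n"] by (simp add: join_def complex_elementary_def)
  next
    case 4
    then show ?thesis by (simp add: join_def elementary_const)
  qed
qed

lemma complex_elementary_cpart: "(\<And>i. (\<lambda>z. a z i) \<in> elementary) \<Longrightarrow> complex_elementary (\<lambda>z. cpart (a z) x)"
  by (simp add: complex_elementary_def cpart_def)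

lemma complex_elementary_add:
  "complex_elementary F \<Longrightarrow> complex_elementary F' \<Longrightarrow> complex_elementary (\<lambda>z. F z + F' z)"
  by (simp add: complex_elementary_def elementary_add)

lemma complex_elementary_minus: "complex_elementary F \<Longrightarrow> complex_elementary (\<lambda>z. - F z)"
  by (simp add: complex_elementary_def elementary_minus)

lemma rho_zero: "x < n \<Longrightarrow> (\<And>i. i < n \<Longrightarrow> s i = 0) \<Longrightarrow> rho n s f x = f x"
proof -
  assume x: "x < n" and s: "\<And>i. i < n \<Longrightarrow> s i = 0"
  have w: "word k (\<lambda>i. 0) = \<one>" for k
    by (induction k) (auto simp: int_pow_def)
  have "rho n s f x = rho n (\<lambda>i. real_of_int 0) f x"
    using s x by (intro rho_cong) auto
  then show ?thesis
    using rho_of_int[of n x "\<lambda>i. 0" f] x by (simp add: w carrier_index)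
qed

lemma aff_mult_fst: "i < n \<Longrightarrow> aff_mult a b i = a i + b i"
  by (simp add: aff_mult_def join_fst)

lemma cpart_aff_mult: "x < n \<Longrightarrow> cpart (aff_mult a b) x = cpart a x + rho n a (cpart b) x"
  by (simp add: aff_mult_def cpart_join)

lemma aff_assoc: "aff_mult (aff_mult a b) c = aff_mult a (aff_mult b c)"
proof -
  have 1: "rho n (aff_mult a b) (cpart c) x = rho n (\<lambda>i. a i + b i) (cpart c) x" if "x < n" for x
    using that by (intro rho_cong) (simp_all add: aff_mult_fst)
  \<comment> \<open>The factor 1 gives the sum the shape required by
    \<open>rho_linear\<close>.\<close>
  have 2: "rho n a (cpart (aff_mult b c)) x = rho n a (\<lambda>x. cpart b x + 1 * rho n b (cpart c) x) x" if "x < n" for x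
    using that by (intro rho_cong) (simp_all add: cpart_aff_mult)
  have 3: "rho n a (\<lambda>x. cpart b x + 1 * rho n b (cpart c) x) x =
      rho n a (cpart b) x + rho n (\<lambda>i. a i + b i) (cpart c) x" if "x < n" for x
    unfolding rho_linear rho_add[OF order_refl that] by simp
  have "aff_mult (aff_mult a b) c =
      join (\<lambda>i. aff_mult a b i + c i) (\<lambda>x. cpart (aff_mult a b) x + rho n (aff_mult a b) (cpart c) x)"
    by (rule aff_mult_def)
  also have "\<dots> = join (\<lambda>i. a i + aff_mult b c i) (\<lambda>x. cpart a x + rho n a (cpart (aff_mult b c)) x)"
  proof (rule join_cong)
    show "aff_mult a b i + c i = a i + aff_mult b c i" if "i < n" for i
      using that by (simp add: aff_mult_fst)
    show "cpart (aff_mult a b) x + rho n (aff_mult a b) (cpart c) x = cpart a x + rho n a (cpart (aff_mult b c)) x"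
      if "x < n" for x
      unfolding 1[OF that] 2[OF that] 3[OF that] cpart_aff_mult[OF that] by (rule add.assoc)
  qed
  also have "\<dots> = aff_mult a (aff_mult b c)"
    by (rule aff_mult_def[symmetric])
  finally show ?thesis .
qed

lemma aff_inv_mult: "aff_mult (aff_inv a) a = (\<lambda>i. 0)"
proof -
  have "rho n (aff_inv a) (cpart a) x = rho n (\<lambda>i. - a i) (cpart a) x" if "x < n" for x
    using that by (intro rho_cong) (simp_all add: aff_inv_def join_fst)
  then have "aff_mult (aff_inv a) a = join (\<lambda>i. 0) (\<lambda>x. 0)"
    unfolding aff_mult_def by (intro join_cong) (simp_all add: aff_inv_def join_fst cpart_join)
  also have "\<dots> = (\<lambda>i. 0)"
    by (simp add: join_def fun_eq_iff)
  finally show ?thesis .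
qed

lemma group_Aff: "group Aff"
proof (rule groupI)
  show "\<one>\<^bsub>Aff\<^esub> \<in> carrier Aff"
    by (simp add: vecs_def)
  show "\<one>\<^bsub>Aff\<^esub> \<otimes>\<^bsub>Aff\<^esub> a = a" if a: "a \<in> carrier Aff" for a
  proof -
    have "aff_mult (\<lambda>i. 0) a = join a (cpart a)"
      unfolding aff_mult_def by (rule join_cong) (simp_all add: rho_zero cpart_def complex_eq_iff)
    then show ?thesis using a join_cpart by simp
  qed
  show "\<exists>b\<in>carrier Aff. b \<otimes>\<^bsub>Aff\<^esub> a = \<one>\<^bsub>Aff\<^esub>" if a: "a \<in> carrier Aff" for a
  proof
    show "aff_inv a \<otimes>\<^bsub>Aff\<^esub> a = \<one>\<^bsub>Aff\<^esub>"
      by (simp add: aff_inv_mult)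
    show "aff_inv a \<in> carrier Aff"
      by (simp add: aff_inv_def)
  qed
  show "a \<otimes>\<^bsub>Aff\<^esub> b \<in> carrier Aff" for a b
    by (simp add: aff_mult_def)
  show "a \<otimes>\<^bsub>Aff\<^esub> b \<otimes>\<^bsub>Aff\<^esub> c = a \<otimes>\<^bsub>Aff\<^esub> (b \<otimes>\<^bsub>Aff\<^esub> c)" for a b c
    by (simp add: aff_assoc)
qed

lemma inv_Aff:
  assumes a: "a \<in> vecs (3 * n)"
  shows "inv\<^bsub>Aff\<^esub> a = aff_inv a"
  using group.inv_equality[OF group_Aff, of "aff_inv a" a] a aff_inv_mult[of a] by (simp add: aff_inv_def)

definition aff_linear :: "(nat \<Rightarrow> real) \<Rightarrow> (nat \<Rightarrow> real) \<Rightarrow> nat \<Rightarrow> real" where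
  "aff_linear a x = join x (rho n a (cpart x))"

lemma aff_mult_eq:
  assumes "i < 3 * n"
  shows "aff_mult a x i = a i + aff_linear a x i"
  using assms by (auto simp: aff_mult_def aff_linear_def join_def cpart_def)

lemma affine_lie_group_Aff: "affine_lie_group Aff (3 * n) aff_linear"
proof (intro affine_lie_group.intro affine_lie_group_axioms.intro group_Aff)
  show "(a \<otimes>\<^bsub>Aff\<^esub> x) i = a i + aff_linear a x i" if "i < 3 * n" for a x i
    using aff_mult_eq[OF that] by simp
  show "aff_linear a (\<lambda>j. x j + c * y j) i = aff_linear a x i + c * aff_linear a y i" for a x y c i
  proof -
    have "cpart (\<lambda>j. x j + c * y j) = (\<lambda>k. cpart x k + complex_of_real c * cpart y k)"
      by (simp add: cpart_def fun_eq_iff complex_eq_iff)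
    then show ?thesis
      by (simp add: aff_linear_def join_def rho_linear)
  qed
  show "(\<Sum>i<3 * n. (aff_linear a x i)\<^sup>2) = (\<Sum>i<3 * n. (x i)\<^sup>2)" if "x \<in> vecs (3 * n)" for a x
    using join_norm[of x "cpart x"] join_cpart[OF that] by (simp add: aff_linear_def join_norm rho_norm)
  show "\<exists>f\<in>elementary. \<forall>z\<in>vecs (3 * n + 3 * n). f z = (fst_part (3 * n) z \<otimes>\<^bsub>Aff\<^esub> snd_part (3 * n) z) i" for i
  proof (rule bexI[of _ "\<lambda>z. aff_mult (fst_part (3 * n) z) (snd_part (3 * n) z) i"])
    show "(\<lambda>z. aff_mult (fst_part (3 * n) z) (snd_part (3 * n) z) i) \<in> elementary"
      unfolding aff_mult_def
      by (intro elementary_join elementary_add complex_elementary_add complex_elementary_cpart complex_elementary_rho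
        elementary_fst_part elementary_snd_part order_refl)
  qed simp
  show "\<exists>f\<in>elementary. \<forall>x\<in>vecs (3 * n). f x = (inv\<^bsub>Aff\<^esub> x) i" for i
  proof (rule bexI[of _ "\<lambda>x. aff_inv x i"])
    show "(\<lambda>x. aff_inv x i) \<in> elementary"
      unfolding aff_inv_def
      by (intro elementary_join elementary_minus complex_elementary_minus complex_elementary_cpart complex_elementary_rho
        elementary_coord order_refl)
  qed (simp add: inv_Aff)
qed simp

text \<open>The time coordinates add, so commutators lie in the subgroup \<open>?V\<close> with
  vanishing times. There \<open>rho\<close> is trivial and the product is addition, hence the
  derived length is at most 2.\<close>

lemma solvable_Aff: "solvable Aff"
proof -
  interpret G: group Aff by (rule group_Aff)
  let ?V = "{a \<in> vecs (3 * n). \<forall>i<n. a i = 0}"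
  have inv_fst: "aff_inv a i = - a i" if "i < n" for a i
    using that by (simp add: aff_inv_def join_fst)
  have V: "subgroup ?V Aff"
  proof (rule G.subgroupI)
    show "?V \<noteq> {}" by (auto simp: vecs_def intro!: exI[of _ "\<lambda>i. 0"])
    show "inv\<^bsub>Aff\<^esub> a \<in> ?V" if "a \<in> ?V" for a
      using that G.inv_closed[of a] by (auto simp: inv_Aff inv_fst)
    show "a \<otimes>\<^bsub>Aff\<^esub> b \<in> ?V" if "a \<in> ?V" "b \<in> ?V" for a b
      using that G.m_closed[of a b] by (auto simp: aff_mult_fst)
  qed auto
  have comm: "a \<otimes>\<^bsub>Aff\<^esub> b = b \<otimes>\<^bsub>Aff\<^esub> a" if "a \<in> ?V" "b \<in> ?V" for a b
    using that by (auto simp: aff_mult_def rho_zero intro!: join_cong)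
  have "derived Aff (carrier Aff) \<subseteq> ?V"
    unfolding derived_def
  proof (rule G.generate_subgroup_incl[OF _ V])
    show "(\<Union>a\<in>carrier Aff. \<Union>b\<in>carrier Aff. {a \<otimes>\<^bsub>Aff\<^esub> b \<otimes>\<^bsub>Aff\<^esub> inv\<^bsub>Aff\<^esub> a \<otimes>\<^bsub>Aff\<^esub> inv\<^bsub>Aff\<^esub> b}) \<subseteq> ?V"
    proof (intro UN_least)
      fix a b assume ab: "a \<in> carrier Aff" "b \<in> carrier Aff"
      then have "a \<otimes>\<^bsub>Aff\<^esub> b \<otimes>\<^bsub>Aff\<^esub> inv\<^bsub>Aff\<^esub> a \<otimes>\<^bsub>Aff\<^esub> inv\<^bsub>Aff\<^esub> b \<in> vecs (3 * n)"
        using G.m_closed G.inv_closed by (metis Aff_sel(1))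
      then show "{a \<otimes>\<^bsub>Aff\<^esub> b \<otimes>\<^bsub>Aff\<^esub> inv\<^bsub>Aff\<^esub> a \<otimes>\<^bsub>Aff\<^esub> inv\<^bsub>Aff\<^esub> b} \<subseteq> ?V"
        using ab by (simp add: inv_Aff aff_mult_fst inv_fst)
    qed
  qed
  then have "derived Aff (derived Aff (carrier Aff)) \<subseteq> derived Aff ?V"
    by (rule G.mono_derived)
  also have "derived Aff ?V \<subseteq> {\<one>\<^bsub>Aff\<^esub>}"
    unfolding derived_def
  proof (rule G.generate_subgroup_incl)
    show "(\<Union>a\<in>?V. \<Union>b\<in>?V. {a \<otimes>\<^bsub>Aff\<^esub> b \<otimes>\<^bsub>Aff\<^esub> inv\<^bsub>Aff\<^esub> a \<otimes>\<^bsub>Aff\<^esub> inv\<^bsub>Aff\<^esub> b}) \<subseteq> {\<one>\<^bsub>Aff\<^esub>}"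
    proof (intro UN_least)
      fix a b assume ab: "a \<in> ?V" "b \<in> ?V"
      then have c: "a \<in> carrier Aff" "b \<in> carrier Aff" by auto
      have "a \<otimes>\<^bsub>Aff\<^esub> b \<otimes>\<^bsub>Aff\<^esub> inv\<^bsub>Aff\<^esub> a = b"
        using comm[OF ab] c by (metis G.inv_closed G.m_assoc G.r_inv G.r_one)
      then show "{a \<otimes>\<^bsub>Aff\<^esub> b \<otimes>\<^bsub>Aff\<^esub> inv\<^bsub>Aff\<^esub> a \<otimes>\<^bsub>Aff\<^esub> inv\<^bsub>Aff\<^esub> b} \<subseteq> {\<one>\<^bsub>Aff\<^esub>}"
        using G.r_inv[OF c(2)] by simp
    qed
  qed (rule G.triv_subgroup)
  finally have "(derived Aff ^^ 2) (carrier Aff) \<subseteq> {\<one>\<^bsub>Aff\<^esub>}"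
    by (simp add: numeral_2_eq_2)
  moreover have "\<one>\<^bsub>Aff\<^esub> \<in> (derived Aff ^^ 2) (carrier Aff)"
    by (rule subgroup.one_closed[OF G.exp_of_derived_is_subgroup[OF G.subgroup_self]])
  ultimately have "(derived Aff ^^ 2) (carrier Aff) = {\<one>\<^bsub>Aff\<^esub>}"
    by blast
  then show ?thesis
    unfolding G.solvable_iff_trivial_derived_seq by blast
qed

section \<open>The lattice of integer points and its permutations\<close>

definition lat :: "(nat \<Rightarrow> real) set" where
  "lat = {a \<in> vecs (3 * n). \<forall>i. a i \<in> \<int>}"

text \<open>On \<open>lat\<close> the floor merely converts integral reals to integers.\<close>

definition hol :: "(nat \<Rightarrow> real) \<Rightarrow> nat" where
  "hol a = word n (\<lambda>i. \<lfloor>a i\<rfloor>)"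

text \<open>Identity on the times, translation by \<open>a\<close> on the index block of the real
  parts and on that of the imaginary parts.\<close>

definition perm :: "nat \<Rightarrow> nat \<Rightarrow> nat" where
  "perm a i = (if i < n then i else if i < 2 * n then n + (i - n) \<otimes> a
    else if i < 3 * n then 2 * n + (i - 2 * n) \<otimes> a else i)"

lemma hol_lt [simp]: "hol a < n"
  by (simp add: hol_def word_lt)

lemma perm_mult:
  assumes a: "a < n" and b: "b < n"
  shows "perm (a \<otimes> b) = perm a \<circ> perm b"
proof
  have *: "j \<otimes> (a \<otimes> b) = j \<otimes> b \<otimes> a" if "j < n" for j
    using that a b carrier_index m_comm[of a b] m_assoc[of j b a] by simp
  show "perm (a \<otimes> b) i = (perm a \<circ> perm b) i" for i
  proof -
    consider "i < n" | "n \<le> i" "i < 2 * n" | "2 * n \<le> i" "i < 3 * n" | "3 * n \<le> i" by linarith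
    then show ?thesis
    proof cases
      case 2
      then have "i - n < n" by linarith
      then show ?thesis using 2 * mult_lt[OF _ b, of "i - n"] by (simp add: perm_def)
    next
      case 3
      then have "i - 2 * n < n" by linarith
      then show ?thesis using 3 * mult_lt[OF _ b, of "i - 2 * n"] by (simp add: perm_def)
    qed (simp_all add: perm_def)
  qed
qed

lemma perm_one: "perm \<one> i = i"
proof -
  have "j \<otimes> \<one> = j" if "j < n" for j using that carrier_index by simp
  then show ?thesis by (auto simp: perm_def)
qed

lemma perm_permutes:
  assumes a: "a < n"
  shows "perm a permutes {..<3 * n}"
proof -
  have inv: "inv a < n" "inv a \<otimes> a = \<one>" "a \<otimes> inv a = \<one>"
    using a carrier_index inv_closed[of a] by auto
  have "perm (inv a) (perm a i) = i" "perm a (perm (inv a) i) = i" for i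
    using perm_mult[OF inv(1) a] perm_mult[OF a inv(1)] inv perm_one by (metis comp_apply)+
  then have "\<exists>!i. perm a i = j" for j
    by metis
  moreover have "perm a i = i" if "i \<notin> {..<3 * n}" for i
    using that by (simp add: perm_def)
  ultimately show ?thesis
    by (simp add: permutes_def)
qed

lemma floor_lat: "h \<in> lat \<Longrightarrow> (\<lambda>i. real_of_int \<lfloor>h i\<rfloor>) = h"
  by (simp add: lat_def fun_eq_iff)

lemma rho_lat: "h \<in> lat \<Longrightarrow> x < n \<Longrightarrow> rho n h f x = f (x \<otimes> hol h)"
  using rho_of_int[of n x "\<lambda>i. \<lfloor>h i\<rfloor>" f] by (simp add: floor_lat hol_def)

lemma aff_mult_lat:
  assumes h: "h \<in> lat" and i: "i < 3 * n"
  shows "aff_mult h x i = h i + x (perm (hol h) i)"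
proof -
  consider "i < n" | "n \<le> i" "i < 2 * n" | "2 * n \<le> i" using i by linarith
  then have "aff_linear h x i = x (perm (hol h) i)"
  proof cases
    case 2
    then have "i - n < n" by linarith
    then show ?thesis using 2 rho_lat[OF h, of "i - n"] by (simp add: aff_linear_def join_def perm_def cpart_def)
  next
    case 3
    then have "i - 2 * n < n" using i by linarith
    then show ?thesis using 3 i rho_lat[OF h, of "i - 2 * n"] by (simp add: aff_linear_def join_def perm_def cpart_def)
  qed (simp add: aff_linear_def join_def perm_def)
  then show ?thesis using aff_mult_eq[OF i] by simp
qed

lemma lat_vecs: "h \<in> lat \<Longrightarrow> h \<in> vecs (3 * n)"
  by (simp add: lat_def)

lemma subgroup_lat: "subgroup lat Aff"
proof -
  interpret G: group Aff by (rule group_Aff)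
  show ?thesis
  proof (rule G.subgroupI)
    show "lat \<subseteq> carrier Aff" by (auto simp: lat_def)
    show "lat \<noteq> {}" by (auto simp: lat_def vecs_def intro!: exI[of _ "\<lambda>i. 0"])
    show "a \<otimes>\<^bsub>Aff\<^esub> b \<in> lat" if a: "a \<in> lat" and b: "b \<in> lat" for a b
    proof -
      have v: "aff_mult a b \<in> vecs (3 * n)"
        using G.m_closed[of a b] a b by (simp add: lat_vecs)
      have "aff_mult a b i \<in> \<int>" for i
      proof (cases "i < 3 * n")
        case True
        then show ?thesis using aff_mult_lat[OF a True] a b by (simp add: lat_def)
      next
        case False
        then show ?thesis using v by (simp add: vecs_def)
      qed
      with v show ?thesis by (simp add: lat_def)
    qed
    show "inv\<^bsub>Aff\<^esub> a \<in> lat" if a: "a \<in> lat" for a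
    proof -
      have c: "a \<in> carrier Aff" using lat_vecs[OF a] by simp
      let ?b = "inv\<^bsub>Aff\<^esub> a"
      have v: "?b \<in> vecs (3 * n)" using G.inv_closed[OF c] by simp
      have "?b j \<in> \<int>" for j
      proof (cases "j < 3 * n")
        case True
        \<comment> \<open>Coordinate \<open>i\<close> of the equation for the inverse determines its
          entry at \<open>perm (hol a) i\<close>, so \<open>j\<close> is written in this
          form.\<close>
        obtain i where i: "j = perm (hol a) i" "i < 3 * n"
          using permutes_image[OF perm_permutes[OF hol_lt[of a]]] True by (metis imageE lessThan_iff)
        have "aff_mult a ?b i = 0"
          using G.r_inv[OF c] by simp
        then have "?b j = - a i"
          using aff_mult_lat[OF a i(2), of ?b] i(1) by simp
        then show ?thesis using a by (simp add: lat_def)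
      next
        case False
        then show ?thesis using v by (simp add: vecs_def)
      qed
      with v show ?thesis by (simp add: lat_def)
    qed
  qed
qed

lemma hol_zero: "hol (\<lambda>i. 0) = \<one>"
proof -
  have "word k (\<lambda>i. 0) = \<one>" for k
    by (induction k) (auto simp: int_pow_def)
  then show ?thesis by (simp add: hol_def)
qed

lemma word_cong: "(\<And>i. i < k \<Longrightarrow> m i = m' i) \<Longrightarrow> word k m = word k m'"
  by (induction k) auto

lemma crystallographic_Aff: "crystallographic Aff A (3 * n) lat hol perm"
proof (intro crystallographic.intro crystallographic_axioms.intro group_Aff comm_group_axioms subgroup_lat)
  show "(h \<otimes>\<^bsub>Aff\<^esub> x) i = h i + x (perm (hol h) i)" if "h \<in> lat" "i < 3 * n" for h x i
    using aff_mult_lat[OF that] by simp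
  show "perm a permutes {..<3 * n}" if "a \<in> carrier A" for a
    using that perm_permutes carrier_index by simp
  show "perm (a \<otimes> b) = perm a \<circ> perm b" if "a \<in> carrier A" "b \<in> carrier A" for a b
    using that perm_mult carrier_index by simp
  show "inj_on perm (carrier A)"
  proof (rule inj_onI)
    fix a b assume ab: "a \<in> carrier A" "b \<in> carrier A" "perm a = perm b"
    have o: "\<one> < n" using one_closed carrier_index by auto
    \<comment> \<open>The index of the real part at the unit goes to the index of the real part at
      \<open>c\<close>, which reveals \<open>c\<close>.\<close>
    have "perm c (n + \<one>) = n + c" if "c \<in> carrier A" for c
      using that o by (simp add: perm_def)
    then show "a = b" using ab by (metis add_left_cancel)
  qed
  show "hol (h \<otimes>\<^bsub>Aff\<^esub> k) = hol h \<otimes> hol k" if hk: "h \<in> lat" "k \<in> lat" for h k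
  proof -
    have "\<lfloor>h i + k i\<rfloor> = \<lfloor>h i\<rfloor> + \<lfloor>k i\<rfloor>" for i
      using hk by (auto simp: lat_def elim!: Ints_cases[of "h i"])
    then have "word n (\<lambda>i. \<lfloor>aff_mult h k i\<rfloor>) = word n (\<lambda>i. \<lfloor>h i\<rfloor> + \<lfloor>k i\<rfloor>)"
      by (intro word_cong) (simp add: aff_mult_fst)
    then show ?thesis
      by (simp add: hol_def word_add)
  qed
  show "hol ` lat = carrier A"
  proof (intro equalityI subsetI)
    show "a \<in> carrier A" if "a \<in> hol ` lat" for a
      using that by (rule imageE) (simp add: carrier_index)
    fix a assume a: "a \<in> carrier A"
    let ?h = "\<lambda>i. if i = a then 1 else 0 :: real"
    have "?h \<in> lat"
      using a carrier_index by (simp add: lat_def vecs_def)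
    moreover have "hol ?h = word n (\<lambda>i. if i = a then 1 else 0)"
      unfolding hol_def by (rule word_cong) simp
    moreover have "word n (\<lambda>i. if i = a then 1 else 0) = a"
      using word_single[of n a] a carrier_index by simp
    ultimately show "a \<in> hol ` lat"
      by (metis imageI)
  qed
  show "\<exists>i<3 * n. 1 \<le> \<bar>(h \<otimes>\<^bsub>Aff\<^esub> x) i - x i\<bar>" if h: "h \<in> lat" "h \<noteq> \<one>\<^bsub>Aff\<^esub>" for h x
  proof -
    have abs: "1 \<le> \<bar>h i\<bar>" if "h i \<noteq> 0" for i
      using h(1) that by (intro Ints_nonzero_abs_ge1) (auto simp: lat_def)
    show ?thesis
    \<comment> \<open>Times are not permuted, so a nonzero one shifts every point by at least 1. If
      all vanish, \<open>hol h\<close> is trivial and \<open>h\<close> is a translation by a nonzero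
      integer vector.\<close>
    proof (cases "\<exists>i<n. h i \<noteq> 0")
      case True
      then obtain i where "i < n" "h i \<noteq> 0" by blast
      then show ?thesis
        using abs[of i] by (intro exI[of _ i]) (simp add: aff_mult_fst)
    next
      case False
      then have "hol h = hol (\<lambda>i. 0)"
        unfolding hol_def by (intro word_cong) simp
      then have "perm (hol h) i = i" for i
        by (simp add: hol_zero perm_one)
      moreover obtain i where "i < 3 * n" "h i \<noteq> 0"
        using vecs_eqI[of h "3 * n" "\<lambda>i. 0"] h lat_vecs[OF h(1)] by (auto simp: vecs_def)
      ultimately show ?thesis
        using abs[of i] aff_mult_lat[OF h(1), of i x] by (intro exI[of _ i]) simp
    qed
  qed
  show "\<exists>h\<in>lat. \<forall>i<3 * n. (h \<otimes>\<^bsub>Aff\<^esub> x) i \<in> {0..1}" for x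
  proof -
    \<comment> \<open>The times come first because they alone fix the linear part of the action. The
      remaining entries of \<open>h\<close> can then be chosen to move the resulting vector
      \<open>w\<close> into the unit cube.\<close>
    define s where "s i = - real_of_int \<lfloor>x i\<rfloor>" for i
    define w where "w = aff_linear s x"
    define h where "h i = (if i < 3 * n then - real_of_int \<lfloor>w i\<rfloor> else 0)" for i
    have h: "h \<in> lat"
      by (auto simp: lat_def vecs_def h_def)
    have "h i = s i" if "i < n" for i
      using that by (simp add: h_def w_def s_def aff_linear_def join_fst)
    then have "aff_linear h x = w"
      unfolding aff_linear_def w_def by (intro join_cong rho_cong) auto
    then have "aff_mult h x i \<in> {0..1}" if "i < 3 * n" for i
      using aff_mult_eq[OF that, of h x] that by (simp add: h_def) linarith
    with h show ?thesis by auto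
  qed
qed simp

lemma flat_solvmanifold_exists:
  "\<exists>(G :: (nat \<Rightarrow> real) monoid) M g H N h. flat_solvmanifold G M g H N h \<and>
     (\<forall>p\<in>topspace (mfd_top N). holonomy_group N h p \<cong> A)"
proof -
  interpret C: crystallographic Aff A "3 * n" lat hol perm
    by (rule crystallographic_Aff)
  interpret L: affine_lie_group Aff "3 * n" aff_linear
    by (rule affine_lie_group_Aff)
  have "flat_solvmanifold Aff (euclidean_manifold (3 * n)) delta_metric lat C.N delta_metric"
    unfolding flat_solvmanifold_def
    using L.lie_group_Euclidean simply_connected_Euclidean_space solvable_Aff L.left_invariant_delta flat_delta
      C.lattice_H C.smooth_manifold_N C.riemannian_metric_N C.smooth_map_q C.preserves_metric_q
    by (simp add: C.N_def)
  then show ?thesis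
    using C.holonomy_iso by blast
qed

end

theorem theorem3p10:
  fixes A :: "('a, 'b) monoid_scheme"
  assumes "comm_group A" and "finite (carrier A)"
  shows "\<exists>(G :: (nat \<Rightarrow> real) monoid) M g H N h.
           flat_solvmanifold G M g H N h \<and>
           (\<forall>p\<in>topspace (mfd_top N). holonomy_group N h p \<cong> A)"
proof -
  interpret A: comm_group A by fact
  define n where "n = card (carrier A)"
  obtain e where e: "bij_betw e {..<n} (carrier A)"
    using bij_betw_from_nat_into_finite[OF assms(2)] unfolding n_def by blast
  define e' where "e' = inv_into {..<n} e"
  \<comment> \<open>The structure of A transported to numbers along \<open>e\<close>, as needed for
    using group elements as coordinate indices.\<close>
  define B :: "nat monoid" where "B = \<lparr>carrier = {..<n}, monoid.mult = \<lambda>i j. e' (e i \<otimes>\<^bsub>A\<^esub> e j), one = e' \<one>\<^bsub>A\<^esub>\<rparr>"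
  have e1: "e i \<in> carrier A" if "i < n" for i
    using bij_betwE[OF e] that by simp
  have e2: "e' a < n" "e (e' a) = a" if "a \<in> carrier A" for a
    using that e inv_into_into[of a e "{..<n}"] unfolding e'_def
    by (auto simp: bij_betw_def f_inv_into_f)
  have e3: "e' (e i) = i" if "i < n" for i
    using that e unfolding e'_def by (simp add: bij_betw_inv_into_left)
  have "comm_group B"
  proof (rule comm_groupI)
    fix i j k assume "i \<in> carrier B" "j \<in> carrier B" "k \<in> carrier B"
    then show "i \<otimes>\<^bsub>B\<^esub> j \<otimes>\<^bsub>B\<^esub> k = i \<otimes>\<^bsub>B\<^esub> (j \<otimes>\<^bsub>B\<^esub> k)"
      by (simp add: B_def e1 e2 A.m_assoc)
  next
    fix i assume "i \<in> carrier B"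
    then show "\<exists>j\<in>carrier B. j \<otimes>\<^bsub>B\<^esub> i = \<one>\<^bsub>B\<^esub>"
      by (intro bexI[of _ "e' (inv\<^bsub>A\<^esub> e i)"]) (simp_all add: B_def e1 e2)
  qed (simp_all add: B_def e1 e2 e3 A.m_comm)
  then interpret B: indexed_comm_group B n
    by (intro indexed_comm_group.intro indexed_comm_group_axioms.intro) (simp_all add: B_def)
  have "e \<in> iso B A"
    using e by (auto simp: iso_def hom_def B_def e1 e2)
  then have "B \<cong> A" by (rule is_isoI)
  then show ?thesis
    using B.flat_solvmanifold_exists iso_trans by blast
qed

end
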